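(* Let $n\ge1$, let $J_n\in\mathbb{C}^{n\times n}$ satisfy $J_n^*=J_n^{-1}=-J_n$, and let $Q\in L^1_{\mathrm{loc}}(\mathbb{R}_+,\mathbb{C}^{n\times n})$ have bounded imaginary part $Q_2=\mathrm{Im}\,Q$, i.e. $\|Q_2(x)\|\le C$ for $x\in\mathbb{R}_+$ with some $C\in\mathbb{R}$. Let $\kappa_\pm=\dim\ker(J_n\pm iI_n)$ and let $A:=D^+_{\min}(Q)$, $B:=D^+_{\min}(Q^* )$. Then $\mathrm{dom}\,A=\mathrm{dom}\,B=:\mathcal{D}$, $\mathrm{dom}\,A^*=\mathrm{dom}\,B^*$, and $$\alpha_Q\|f\|^2\le\mathrm{Im}(Af,f)\le\beta_Q\|f\|^2,\qquad -\beta_Q\|f\|^2\le\mathrm{Im}(Bf,f)\le-\alpha_Q\|f\|^2,\qquad f\in\mathcal{D}.$$ Moreover, $\mathbb{C}_{\alpha_Q,-}\cup\mathbb{C}_{\beta_Q,+}\subset\widehat\rho\{A,B\}$ and $$\dim\mathfrak{N}_\lambda(B)=\kappa_+,\quad \dim\mathfrak{N}_{\overline\lambda}(A)=\kappa_-,\qquad\lambda\in\mathbb{C}_{\beta_Q,+},$$ $$\dim\mathfrak{N}_\lambda(B)=\kappa_-,\quad \dim\mathfrak{N}_{\overline\lambda}(A)=\kappa_+,\qquad\lambda\in\mathbb{C}_{\alpha_Q,-}.$$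
   Context: $\mathbb{R}_+=[0,\infty)$ and $D(Q)y=J_ny'+Q(x)y$. The maximal operator $D^+_{\max}(Q)$ in $L^2(\mathbb{R}_+,\mathbb{C}^n)$ has domain $\{y\in L^2: y\in AC_{\mathrm{loc}}(\mathbb{R}_+,\mathbb{C}^n),\ D(Q)y\in L^2\}$ and acts as $y\mapsto D(Q)y$; the minimal operator $D^+_{\min}(Q)$ is the closure of its restriction to those $y\in\mathrm{dom}\,D^+_{\max}(Q)$ with compact support and $y(0)=0$. One has $(D^+_{\min}(Q))^*=D^+_{\max}(Q^* )$. Write $Q=Q_1+iQ_2$ with $Q_1=\mathrm{Re}\,Q=\frac12(Q+Q^* )$, $Q_2=\mathrm{Im}\,Q=\frac1{2i}(Q-Q^* )$. The expression $D(Q)$ is called almost formally selfadjoint when $Q_2$ is bounded. Put $\alpha_Q=\operatorname{ess\,inf}_{x\in\mathbb{R}_+}\alpha(x)$ and $\beta_Q=\operatorname{ess\,sup}_{x\in\mathbb{R}_+}\beta(x)$, where $\alpha(x)=\inf_{h\ne0}\frac{(Q_2(x)h,h)}{\|h\|^2}$ and $\beta(x)=\sup_{h\ne0}\frac{(Q_2(x)h,h)}{\|h\|^2}$. For $\alpha\in\mathbb{R}$, $\mathbb{C}_{\alpha,+}=\{z:\mathrm{Im}\,z>\alpha\}$ and $\mathbb{C}_{\alpha,-}=\{z:\mathrm{Im}\,z<\alpha\}$. Inner products are linear in the first argument. $\mathfrak{N}_\lambda(T)=\ker(T^*-\lambda)$. $\widehat\rho(T)$ is the set of $\lambda$ such that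 $\|Tf-\lambda f\|\ge\varepsilon\|f\|$, $f\in\mathrm{dom}\,T$, for some $\varepsilon>0$, and $\widehat\rho\{A,B\}=\{\lambda:\lambda\in\widehat\rho(A),\ \overline\lambda\in\widehat\rho(B)\}$. *)

theory Defs
  imports "HOL-Analysis.Analysis" "HOL-Probability.Essential_Supremum"
begin

section \<open>Matrices and vectors over the complex numbers\<close>

definition cdot :: "complex^'n \<Rightarrow> complex^'n \<Rightarrow> complex"
  where "cdot u v = (\<Sum>i\<in>UNIV. u $ i * cnj (v $ i))"

definition cadj :: "complex^'n^'n \<Rightarrow> complex^'n^'n"
  where "cadj M = (\<chi> i j. cnj (M $ j $ i))"

definition Im_part :: "complex^'n^'n \<Rightarrow> complex^'n^'n"
  where "Im_part M = (\<chi> i j. (M - cadj M) $ i $ j / (2 * \<i>))"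

text \<open>Applied to the Hermitian matrix \<open>Im_part (Q x)\<close>; there the quadratic form is real, so
  taking its real part only changes the type.\<close>

definition form_lower :: "complex^'n^'n \<Rightarrow> real"
  where "form_lower M = (INF h\<in>-{0}. Re (cdot (M *v h) h) / (norm h)\<^sup>2)"

definition form_upper :: "complex^'n^'n \<Rightarrow> real"
  where "form_upper M = (SUP h\<in>-{0}. Re (cdot (M *v h) h) / (norm h)\<^sup>2)"

definition kappa_plus :: "complex^'n^'n \<Rightarrow> nat"
  where "kappa_plus J = vec.dim {v. (J + mat \<i>) *v v = 0}"

definition kappa_minus :: "complex^'n^'n \<Rightarrow> nat"
  where "kappa_minus J = vec.dim {v. (J - mat \<i>) *v v = 0}"


section \<open>The Hilbert space of square integrable functions on the half-line\<close>

abbreviation half_line :: "real measure"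
  where "half_line \<equiv> lebesgue_on {0..}"

definition sq_integrable :: "(real \<Rightarrow> complex^'n) \<Rightarrow> bool"
  where "sq_integrable f \<longleftrightarrow>
    f \<in> borel_measurable half_line \<and> integrable half_line (\<lambda>x. (norm (f x))\<^sup>2)"

definition l2_rel :: "(real \<Rightarrow> complex^'n) \<Rightarrow> (real \<Rightarrow> complex^'n) \<Rightarrow> bool"
  where "l2_rel f g \<longleftrightarrow> sq_integrable f \<and> sq_integrable g \<and> (AE x in half_line. f x = g x)"

lemma sq_integrable_measurable [measurable_dest]:
  "sq_integrable f \<Longrightarrow> f \<in> borel_measurable half_line"
  by (simp add: sq_integrable_def)

lemma sq_integrable_zero [simp]: "sq_integrable (\<lambda>x. 0)"
  by (simp add: sq_integrable_def)

lemma sq_integrable_add: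
  assumes "sq_integrable f" "sq_integrable g"
  shows "sq_integrable (\<lambda>x. f x + g x)"
proof -
  have [measurable]: "f \<in> borel_measurable half_line" "g \<in> borel_measurable half_line"
    using assms by (auto simp: sq_integrable_def)
  have "integrable half_line (\<lambda>x. 2 * (norm (f x))\<^sup>2 + 2 * (norm (g x))\<^sup>2)"
    using assms by (auto simp: sq_integrable_def)
  then have "integrable half_line (\<lambda>x. (norm (f x + g x))\<^sup>2)"
  proof (rule Bochner_Integration.integrable_bound)
    show "AE x in half_line. norm ((norm (f x + g x))\<^sup>2)
        \<le> norm (2 * (norm (f x))\<^sup>2 + 2 * (norm (g x))\<^sup>2)"
    proof (rule AE_I2)
      fix x
      have "(norm (f x + g x))\<^sup>2 \<le> (norm (f x) + norm (g x))\<^sup>2"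
        by (simp add: norm_triangle_ineq power_mono)
      also have "\<dots> \<le> 2 * (norm (f x))\<^sup>2 + 2 * (norm (g x))\<^sup>2"
        using sum_squares_bound[of "norm (f x)" "norm (g x)"]
        by (simp add: power2_eq_square algebra_simps)
      finally show "norm ((norm (f x + g x))\<^sup>2) \<le> norm (2 * (norm (f x))\<^sup>2 + 2 * (norm (g x))\<^sup>2)"
        by simp
    qed
  qed measurable
  then show ?thesis
    by (simp add: sq_integrable_def)
qed

lemma norm_vector_smult: "norm (c *s v) = cmod c * norm (v :: complex^'n)"
  by (simp add: norm_vec_def norm_mult L2_set_right_distrib)

lemma measurable_vector_smult [measurable]:
  fixes f :: "'a \<Rightarrow> complex^'n"
  assumes "f \<in> borel_measurable M"
  shows "(\<lambda>x. c *s f x) \<in> borel_measurable M"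
proof -
  have "continuous_on UNIV (\<lambda>v::complex^'n. \<chi> i. c * v $ i)"
    by (intro continuous_intros)
  then have "(\<lambda>v::complex^'n. c *s v) \<in> borel_measurable borel"
    by (intro borel_measurable_continuous_onI) (simp add: vector_scalar_mult_def)
  from measurable_compose[OF assms this] show ?thesis .
qed

lemma sq_integrable_smult:
  assumes "sq_integrable f"
  shows "sq_integrable (\<lambda>x. c *s f x)"
  using assms by (auto simp: sq_integrable_def norm_vector_smult power_mult_distrib)

lemma scaleR_eq_smult: "r *\<^sub>R v = complex_of_real r *s (v :: complex^'n)"
  by (simp add: vec_eq_iff scaleR_conv_of_real[symmetric] scaleR_vec_def)

lemma measurable_cdot:
  fixes f g :: "'a \<Rightarrow> complex^'n"
  assumes "f \<in> borel_measurable M" "g \<in> borel_measurable M"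
  shows "(\<lambda>x. cdot (f x) (g x)) \<in> borel_measurable M"
proof (rule borel_measurable_continuous_Pair[OF assms])
  show "continuous_on UNIV (\<lambda>p. cdot (fst p) (snd p :: complex^'n))"
    unfolding cdot_def by (intro continuous_intros)
qed

lemma cdot_self: "cdot v v = complex_of_real ((norm v)\<^sup>2)"
  by (simp add: cdot_def norm_vec_def L2_set_def sum_nonneg complex_norm_square[symmetric]
      flip: of_real_power)

lemma cdot_bound: "cmod (cdot u v) \<le> norm u * norm v"
proof -
  have "cmod (cdot u v) \<le> (\<Sum>i\<in>UNIV. \<bar>cmod (u $ i)\<bar> * \<bar>cmod (v $ i)\<bar>)"
    unfolding cdot_def by (rule order_trans[OF norm_sum]) (simp add: norm_mult)
  also have "\<dots> \<le> norm u * norm v"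
    unfolding norm_vec_def by (rule L2_set_mult_ineq)
  finally show ?thesis .
qed

lemma integrable_cdot:
  assumes "sq_integrable f" "sq_integrable g"
  shows "integrable half_line (\<lambda>x. cdot (f x) (g x))"
proof -
  have meas: "(\<lambda>x. cdot (f x) (g x)) \<in> borel_measurable half_line"
    using assms by (auto simp: sq_integrable_def intro: measurable_cdot)
  have "integrable half_line (\<lambda>x. (norm (f x))\<^sup>2 + (norm (g x))\<^sup>2)"
    using assms by (auto simp: sq_integrable_def)
  then show ?thesis
  proof (rule Bochner_Integration.integrable_bound[OF _ meas])
    show "AE x in half_line. norm (cdot (f x) (g x)) \<le> norm ((norm (f x))\<^sup>2 + (norm (g x))\<^sup>2)"
    proof (rule AE_I2)
      fix x
      have "norm (f x) * norm (g x) \<le> (norm (f x))\<^sup>2 + (norm (g x))\<^sup>2"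
        using sum_squares_bound[of "norm (f x)" "norm (g x)"]
          mult_nonneg_nonneg[OF norm_ge_zero[of "f x"] norm_ge_zero[of "g x"]] by linarith
      then show "norm (cdot (f x) (g x)) \<le> norm ((norm (f x))\<^sup>2 + (norm (g x))\<^sup>2)"
        using cdot_bound[of "f x" "g x"] by simp
    qed
  qed
qed

text \<open>Elements are almost-everywhere classes; the values of a representative on the negative
  half-axis are irrelevant, since \<open>half_line\<close> does not see them.\<close>

quotient_type (overloaded) 'n l2 = "real \<Rightarrow> complex^('n::finite)" / partial: l2_rel
proof (rule part_equivpI)
  show "\<exists>f::real \<Rightarrow> complex^'n. l2_rel f f"
    by (rule exI[of _ "\<lambda>x. 0"]) (simp add: l2_rel_def)
  show "symp (l2_rel :: (real \<Rightarrow> complex^'n) \<Rightarrow> _)"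
    by (rule sympI) (auto simp: l2_rel_def)
  show "transp (l2_rel :: (real \<Rightarrow> complex^'n) \<Rightarrow> _)"
    by (rule transpI) (auto simp: l2_rel_def elim: AE_mp)
qed

instantiation l2 :: (finite) ab_group_add
begin

lift_definition zero_l2 :: "'a l2" is "\<lambda>x. 0"
  by (simp add: l2_rel_def)

lift_definition plus_l2 :: "'a l2 \<Rightarrow> 'a l2 \<Rightarrow> 'a l2" is "\<lambda>f g x. f x + g x"
  by (auto simp: l2_rel_def sq_integrable_add)

lift_definition uminus_l2 :: "'a l2 \<Rightarrow> 'a l2" is "\<lambda>f x. - f x"
  by (auto simp: l2_rel_def sq_integrable_def)

definition minus_l2 :: "'a l2 \<Rightarrow> 'a l2 \<Rightarrow> 'a l2"
  where "minus_l2 f g = f + - g"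

instance
proof
  fix a b c :: "'a l2"
  show "a + b + c = a + (b + c)"
    by transfer (auto simp: l2_rel_def sq_integrable_add add.assoc)
  show "a + b = b + a"
    by transfer (auto simp: l2_rel_def sq_integrable_add add.commute)
  show "0 + a = a"
    by transfer (auto simp: l2_rel_def)
  show "- a + a = 0"
    by transfer (auto simp: l2_rel_def)
  show "a - b = a + - b"
    by (simp add: minus_l2_def)
qed

end

lift_definition scaleC :: "complex \<Rightarrow> 'n::finite l2 \<Rightarrow> 'n l2" is "\<lambda>c f x. c *s f x"
  by (auto simp: l2_rel_def sq_integrable_smult)

lift_definition cinner :: "'n::finite l2 \<Rightarrow> 'n l2 \<Rightarrow> complex"
  is "\<lambda>f g. LINT x|half_line. cdot (f x) (g x)"
  unfolding l2_rel_def
  by (intro integral_cong_AE measurable_cdot sq_integrable_measurable) auto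

global_interpretation l2: vector_space "scaleC :: complex \<Rightarrow> 'n::finite l2 \<Rightarrow> 'n l2"
proof
  fix a b :: complex and x y :: "'n l2"
  show "scaleC a (x + y) = scaleC a x + scaleC a y"
    by transfer (auto simp: l2_rel_def sq_integrable_add sq_integrable_smult vec.scale_right_distrib)
  show "scaleC (a + b) x = scaleC a x + scaleC b x"
    by transfer (auto simp: l2_rel_def sq_integrable_add sq_integrable_smult vec.scale_left_distrib)
  show "scaleC a (scaleC b x) = scaleC (a * b) x"
    by transfer (auto simp: l2_rel_def sq_integrable_smult)
  show "scaleC 1 x = x"
    by transfer (auto simp: l2_rel_def)
qed

lemma cinner_commute: "cinner f g = cnj (cinner g f)"
proof transfer
  fix f g :: "real \<Rightarrow> complex^'n"
  have "cdot (f x) (g x) = cnj (cdot (g x) (f x))" for x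
    by (simp add: cdot_def mult.commute)
  then show "(LINT x|half_line. cdot (f x) (g x)) = cnj (LINT x|half_line. cdot (g x) (f x))"
    by simp
qed

lemma cinner_add_left: "cinner (f + g) h = cinner f h + cinner g h"
proof transfer
  fix f g h :: "real \<Rightarrow> complex^'n"
  assume "l2_rel f f" "l2_rel g g" "l2_rel h h"
  moreover have "cdot (f x + g x) (h x) = cdot (f x) (h x) + cdot (g x) (h x)" for x
    by (simp add: cdot_def sum.distrib distrib_right)
  ultimately show "(LINT x|half_line. cdot (f x + g x) (h x))
      = (LINT x|half_line. cdot (f x) (h x)) + (LINT x|half_line. cdot (g x) (h x))"
    by (simp add: l2_rel_def integrable_cdot)
qed

lemma cinner_scaleC_left: "cinner (scaleC c f) h = c * cinner f h"
proof transfer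
  fix f h :: "real \<Rightarrow> complex^'n" and c
  have "cdot (c *s f x) (h x) = c * cdot (f x) (h x)" for x
    by (simp add: cdot_def sum_distrib_left mult.assoc)
  then show "(LINT x|half_line. cdot (c *s f x) (h x)) = c * (LINT x|half_line. cdot (f x) (h x))"
    by simp
qed

lemma cinner_self_abs:
  "sq_integrable f \<Longrightarrow>
    cinner (abs_l2 f) (abs_l2 f) = complex_of_real (LINT x|half_line. (norm (f x))\<^sup>2)"
  by (subst cinner.abs_eq) (simp_all add: l2_rel_def cdot_self del: of_real_power)

instantiation l2 :: (finite) real_vector
begin

definition scaleR_l2 :: "real \<Rightarrow> 'a l2 \<Rightarrow> 'a l2"
  where "scaleR_l2 r f = scaleC (complex_of_real r) f"

instance
  by standard (simp_all add: scaleR_l2_def l2.scale_right_distrib l2.scale_left_distrib)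

end

text \<open>The topology is the norm topology; the real inner product is the real part of the complex one.\<close>

instantiation l2 :: (finite) real_inner
begin

definition inner_l2 :: "'a l2 \<Rightarrow> 'a l2 \<Rightarrow> real"
  where "inner_l2 f g = Re (cinner f g)"

definition norm_l2 :: "'a l2 \<Rightarrow> real"
  where "norm_l2 f = sqrt (inner f f)"

definition sgn_l2 :: "'a l2 \<Rightarrow> 'a l2"
  where "sgn_l2 f = f /\<^sub>R norm f"

definition dist_l2 :: "'a l2 \<Rightarrow> 'a l2 \<Rightarrow> real"
  where "dist_l2 f g = norm (f - g)"

definition uniformity_l2 :: "('a l2 \<times> 'a l2) filter"
  where "uniformity_l2 = (INF e\<in>{0<..}. principal {(x, y). dist x y < e})"

definition open_l2 :: "'a l2 set \<Rightarrow> bool"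
  where "open_l2 U \<longleftrightarrow> (\<forall>x\<in>U. eventually (\<lambda>(x', y). x' = x \<longrightarrow> y \<in> U) uniformity)"

instance
proof
  fix x y z :: "'a l2" and r :: real and U :: "'a l2 set"
  show "sgn x = x /\<^sub>R norm x"
    by (rule sgn_l2_def)
  show "dist x y = norm (x - y)"
    by (rule dist_l2_def)
  show "(uniformity :: ('a l2 \<times> 'a l2) filter) = (INF e\<in>{0<..}. principal {(x, y). dist x y < e})"
    by (rule uniformity_l2_def)
  show "open U \<longleftrightarrow> (\<forall>x\<in>U. eventually (\<lambda>(x', y). x' = x \<longrightarrow> y \<in> U) uniformity)"
    by (rule open_l2_def)
  show "inner x y = inner y x"
    by (subst inner_l2_def, subst cinner_commute) (simp add: inner_l2_def)
  show "inner (x + y) z = inner x z + inner y z"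
    by (simp add: inner_l2_def cinner_add_left)
  show "inner (r *\<^sub>R x) y = r * inner x y"
    by (simp add: inner_l2_def scaleR_l2_def cinner_scaleC_left)
  show "norm x = sqrt (inner x x)"
    by (rule norm_l2_def)
  obtain f where f: "x = abs_l2 f" "sq_integrable f"
  proof -
    have "\<exists>f. x = abs_l2 f \<and> sq_integrable f"
      by (induct x rule: l2.abs_induct) (auto simp: l2_rel_def)
    then show ?thesis using that by blast
  qed
  have eq: "inner x x = (LINT x|half_line. (norm (f x))\<^sup>2)"
    using f by (simp add: inner_l2_def cinner_self_abs)
  show "0 \<le> inner x x"
    unfolding eq by (simp add: integral_nonneg_AE)
  have "inner x x = 0 \<longleftrightarrow> (AE x in half_line. (norm (f x))\<^sup>2 = 0)"
    unfolding eq using f(2)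
    by (intro integral_nonneg_eq_0_iff_AE) (auto simp: sq_integrable_def)
  also have "\<dots> \<longleftrightarrow> l2_rel f (\<lambda>x. 0)"
    using f(2) by (simp add: l2_rel_def)
  also have "\<dots> \<longleftrightarrow> x = 0"
    using f Quotient3_rel[OF Quotient3_l2, of f "\<lambda>x. 0"]
    by (auto simp: zero_l2_def l2_rel_def)
  finally show "inner x x = 0 \<longleftrightarrow> x = 0" .
qed

end

lemma norm_abs_l2:
  "sq_integrable f \<Longrightarrow> norm (abs_l2 f) = sqrt (LINT x|half_line. (norm (f x))\<^sup>2)"
  by (simp add: norm_l2_def inner_l2_def cinner_self_abs)

text \<open>\<open>l2.dim\<close> is \<open>0\<close> on infinite-dimensional spaces, so we ask for a finite basis explicitly.\<close>

definition has_cdim :: "'n::finite l2 set \<Rightarrow> nat \<Rightarrow> bool"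
  where "has_cdim S k \<longleftrightarrow> (\<exists>B. finite B \<and> card B = k \<and> l2.independent B \<and> l2.span B = S)"


section \<open>Operators as graphs\<close>

definition op_dom :: "('n::finite l2 \<times> 'n l2) set \<Rightarrow> 'n l2 set"
  where "op_dom T = fst ` T"

definition adj_op :: "('n::finite l2 \<times> 'n l2) set \<Rightarrow> ('n l2 \<times> 'n l2) set"
  where "adj_op T = {(g, h). \<forall>(f, k)\<in>T. cinner k g = cinner f h}"

definition defect_space :: "complex \<Rightarrow> ('n::finite l2 \<times> 'n l2) set \<Rightarrow> 'n l2 set"
  where "defect_space l T = {f. (f, scaleC l f) \<in> adj_op T}"

definition rho_hat :: "('n::finite l2 \<times> 'n l2) set \<Rightarrow> complex set"
  where "rho_hat T = {l. \<exists>e>0. \<forall>(f, k)\<in>T. norm (k - scaleC l f) \<ge> e * norm f}"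

definition rho_hat_pair ::
    "('n::finite l2 \<times> 'n l2) set \<Rightarrow> ('n l2 \<times> 'n l2) set \<Rightarrow> complex set"
  where "rho_hat_pair A B = {l. l \<in> rho_hat A \<and> cnj l \<in> rho_hat B}"


section \<open>The differential expression and its operators\<close>

definition abs_cont_on :: "real \<Rightarrow> real \<Rightarrow> (real \<Rightarrow> 'a::real_normed_vector) \<Rightarrow> bool"
  where "abs_cont_on a b y \<longleftrightarrow>
    (\<forall>e>0. \<exists>d>0. \<forall>P. finite P \<and> (\<forall>(s, t)\<in>P. a \<le> s \<and> s < t \<and> t \<le> b) \<and>
        pairwise (\<lambda>(s, t) (s', t'). {s<..<t} \<inter> {s'<..<t'} = {}) P \<and>
        (\<Sum>(s, t)\<in>P. t - s) < d
      \<longrightarrow> (\<Sum>(s, t)\<in>P. norm (y t - y s)) < e)"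

definition AC_loc :: "(real \<Rightarrow> 'a::real_normed_vector) \<Rightarrow> bool"
  where "AC_loc y \<longleftrightarrow> (\<forall>b>0. abs_cont_on 0 b y)"

definition L1_loc :: "(real \<Rightarrow> complex^'n^'n) \<Rightarrow> bool"
  where "L1_loc Q \<longleftrightarrow> (\<forall>b>0. Q absolutely_integrable_on {0..b})"

text \<open>For \<open>AC_loc y\<close> the derivative exists almost everywhere; elsewhere \<open>vector_derivative\<close> is an
  arbitrary value, which does not affect the class of \<open>D_expr J Q y\<close>.\<close>

definition D_expr ::
    "complex^'n^'n \<Rightarrow> (real \<Rightarrow> complex^'n^'n) \<Rightarrow> (real \<Rightarrow> complex^'n) \<Rightarrow> real \<Rightarrow> complex^'n"
  where "D_expr J Q y x = J *v vector_derivative y (at x within {0..}) + Q x *v y x"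

text \<open>The locally absolutely continuous representatives of the elements of the domain of the
  maximal operator.\<close>

definition D_max_fun :: "complex^'n^'n \<Rightarrow> (real \<Rightarrow> complex^'n^'n) \<Rightarrow> (real \<Rightarrow> complex^'n) set"
  where "D_max_fun J Q = {y. AC_loc y \<and> sq_integrable y \<and> sq_integrable (D_expr J Q y)}"

text \<open>The closure of an operator is the closure of its graph in the product norm topology.
  The operator is closable, so this is the graph of an operator, but nothing below relies on it:
  statements about \<open>A f\<close> are made for all pairs in the graph.\<close>

definition D_min ::
    "complex^'n::finite^'n \<Rightarrow> (real \<Rightarrow> complex^'n^'n) \<Rightarrow> ('n l2 \<times> 'n l2) set"
  where "D_min J Q = closure ((\<lambda>y. (abs_l2 y, abs_l2 (D_expr J Q y))) `
    {y \<in> D_max_fun J Q. compact (closure {x\<in>{0..}. y x \<noteq> 0}) \<and> y 0 = 0})"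

definition alpha_ess :: "(real \<Rightarrow> complex^'n^'n) \<Rightarrow> real"
  where "alpha_ess Q =
    real_of_ereal (- esssup half_line (\<lambda>x. ereal (- form_lower (Im_part (Q x)))))"

definition beta_ess :: "(real \<Rightarrow> complex^'n^'n) \<Rightarrow> real"
  where "beta_ess Q = real_of_ereal (esssup half_line (\<lambda>x. ereal (form_upper (Im_part (Q x)))))"

end

theory Submission
  imports Defs
begin

text \<open>
  Everything about the defect spaces comes from one scalar quantity. For a solution \<open>z\<close> of
  \<open>J z' + Q z = l z\<close> put \<open>w = Im (J z, z)\<close>. Since \<open>J\<close> is skew and unitary,
  \<open>w' = 2 (Im l |z|\<^sup>2 - Im (Q z, z))\<close>, and if \<open>Im (Q h, h) \<le> \<beta> |h|\<^sup>2\<close> with \<open>\<beta> < Im l\<close>, this is at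
  least \<open>2 (Im l - \<beta>) |z|\<^sup>2\<close> (\<open>boundary_form_growth\<close>). So \<open>w\<close> increases, and \<open>z\<close> is square integrable
  exactly when \<open>w \<le> 0\<close> on the whole half-line: in that case the integral of \<open>|z|\<^sup>2\<close> is controlled by
  \<open>- w(0)\<close>, whereas a positive value of \<open>w\<close> persists and is dominated by \<open>|z|\<^sup>2\<close>. A nonzero square
  integrable solution even has \<open>w(0) < 0\<close>, so the initial values of such solutions form a space that
  meets \<open>ker (J - \<i>)\<close> only in \<open>0\<close>; its dimension is at most \<open>kappa_plus J\<close>. It is not smaller: initial
  values for which \<open>z(N)\<close> lies in \<open>ker (J + \<i>)\<close> satisfy \<open>w \<le> 0\<close> on \<open>[0, N]\<close>, they form a space of
  dimension at least \<open>kappa_plus J\<close>, and compactness of the unit sphere lets \<open>N\<close> tend to infinity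
  (\<open>dim_sq_integrable_solutions\<close>). Passing from \<open>(J, Q, l)\<close> to \<open>(-J, -Q, -l)\<close> does not change the
  equation but exchanges the two half-planes and \<open>kappa_plus\<close> with \<open>kappa_minus\<close>, and passing from
  \<open>Q\<close> to its adjoint exchanges the operators; this yields all four dimensions.

  That the elements of \<open>ker (B\<^sup>* - l)\<close> are the square integrable solutions
  (\<open>defect_space_D_min_adjoint\<close>) needs some care, because \<open>Q\<close> is only locally integrable and smooth
  functions of compact support need not belong to the domain of the minimal operator. Suitable test
  functions are \<open>y = U \<phi>\<close>, where \<open>U\<close> is the fundamental matrix of the adjoint equation: the
  coefficient cancels and only \<open>J U \<phi>'\<close> is left. If \<open>f\<close> is a weak solution, the choice
  \<open>\<phi>' = h - c\<close>, where \<open>h = U\<^sup>* J f\<close> and \<open>c\<close> is its mean over \<open>[0, b]\<close>, forces \<open>h = c\<close>, as in the lemma of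
  du Bois-Reymond. The identity \<open>U\<^sup>* J Z = J\<close> for the fundamental matrix \<open>Z\<close> of the equation itself then
  turns this into \<open>f = Z \<eta>\<close>.

  For a function \<open>y\<close> of compact support with \<open>y(0) = 0\<close> the term \<open>Im (J y', y)\<close> is half the derivative
  of \<open>Im (J y, y)\<close> and integrates to zero, so \<open>Im (A y, y)\<close> is the integral of \<open>Im (Q y, y)\<close>. The bounds
  on the numerical range follow by passing to the closure, and with them the points of regular type,
  by the Cauchy-Schwarz inequality. Finally, \<open>A\<close> and \<open>B\<close> differ on their common core by multiplication
  with a bounded matrix function, which changes neither the domain of the closure nor that of the
  adjoint.

  All of this computes with functions that are absolutely continuous in the \<open>\<epsilon>\<close>-\<open>\<delta>\<close> sense. The link
  between this definition and integration is \<open>ac_deriv_iff\<close>: such functions are precisely the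
  indefinite integrals of their almost everywhere existing derivatives. It combines Lebesgue's
  differentiation theorem with a decomposition into monotone functions, to whose Stieltjes measures
  the Radon-Nikodym theorem applies.
\<close>

section \<open>Lebesgue's differentiation theorem\<close>

lemma integral_diff_point:
  fixes f :: "real \<Rightarrow> 'a::euclidean_space"
  assumes f: "f integrable_on {a..b}" and st: "s \<in> {a..b}" "t \<in> {a..b}" "s \<le> t"
  shows "integral {a..t} f - integral {a..s} f = integral {s..t} f"
proof -
  have "integral {a..s} f + integral {s..t} f = integral {a..t} f"
    using st by (intro Henstock_Kurzweil_Integration.integral_combine integrable_subinterval_real[OF f]) auto
  then show ?thesis by (simp add: algebra_simps)
qed

text \<open>
  On an interval with endpoints \<open>x\<close> and \<open>t\<close> that violates the slope estimate, the Riemann term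
  \<open>(t - x) f x\<close> differs from the integral by more than \<open>e \<bar>t - x\<bar>\<close>. By Henstock's lemma the differences
  over disjoint fine intervals have an arbitrarily small sum, hence so do the lengths; and by Vitali's
  theorem such intervals cover almost all exceptional points.
\<close>

lemma negligible_slope_exceeds:
  fixes f :: "real \<Rightarrow> 'a::euclidean_space"
  assumes f: "f integrable_on {a..b}" and e: "e > 0"
  shows "negligible {x \<in> {a..b}. \<forall>d>0. \<exists>t\<in>{a..b}. t \<noteq> x \<and> \<bar>t - x\<bar> < d \<and>
    norm (integral {a..t} f - integral {a..x} f - (t - x) *\<^sub>R f x) > e * \<bar>t - x\<bar>}"
    (is "negligible ?E")
  unfolding negligible_outer_le
proof (intro allI impI)
  fix \<eta> :: real assume \<eta>: "\<eta> > 0"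
  let ?F = "\<lambda>t. integral {a..t} f"
  from Henstock_lemma[of f a b "\<eta> * e"] f e \<eta> obtain \<gamma> where \<gamma>: "gauge \<gamma>"
    "\<And>p. \<lbrakk>p tagged_partial_division_of (cbox a b); \<gamma> fine p\<rbrakk> \<Longrightarrow>
             sum (\<lambda>(x,k). norm(measure lborel k *\<^sub>R f x - integral k f)) p < \<eta> * e"
    by auto
  \<comment> \<open>the violating intervals, written as balls about their midpoints as the covering theorem demands\<close>
  define K where "K = {(x,t). x \<in> {a..b} \<and> t \<in> {a..b} \<and> t \<noteq> x \<and> closed_segment x t \<subseteq> \<gamma> x \<and>
     norm (?F t - ?F x - (t - x) *\<^sub>R f x) > e * \<bar>t - x\<bar>}"
  define ctr where "ctr = (\<lambda>(x::real,t). (x + t) / 2)"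
  define rad where "rad = (\<lambda>(x::real,t). \<bar>t - x\<bar> / 2)"
  have seg: "cball (ctr (x,t)) (rad (x,t)) = closed_segment x t" for x t
    by (auto simp: ctr_def rad_def cball_eq_atLeastAtMost closed_segment_eq_real_ivl field_simps)
  have cover: "\<exists>i. i \<in> K \<and> x \<in> cball (ctr i) (rad i) \<and> rad i < d" if x: "x \<in> ?E" and d: "0 < d" for x d
  proof -
    have "open (\<gamma> x)" "x \<in> \<gamma> x"
      using \<gamma>(1) by (auto simp: gauge_def)
    then obtain r where r: "r > 0" "ball x r \<subseteq> \<gamma> x"
      by (auto simp: open_contains_ball)
    have "min r d > 0" using r d by simp
    then obtain t where t: "t \<in> {a..b}" "t \<noteq> x" "\<bar>t - x\<bar> < min r d"
        "norm (?F t - ?F x - (t - x) *\<^sub>R f x) > e * \<bar>t - x\<bar>"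
      using x by blast
    have "closed_segment x t \<subseteq> ball x r"
      using t r by (intro closed_segment_subset convex_ball) (auto simp: dist_real_def)
    then have "(x, t) \<in> K"
      using x t r unfolding K_def by auto
    moreover have "x \<in> cball (ctr (x,t)) (rad (x,t))"
      unfolding seg by simp
    moreover have "rad (x,t) < d"
      using t by (auto simp: rad_def)
    ultimately show ?thesis by blast
  qed
  have rpos: "0 < rad i" if "i \<in> K" for i
    using that by (auto simp: K_def rad_def)
  obtain C where C: "countable C" "C \<subseteq> K"
     "pairwise (\<lambda>i j. disjnt (cball (ctr i) (rad i)) (cball (ctr j) (rad j))) C"
     "negligible(?E - (\<Union>i \<in> C. cball (ctr i) (rad i)))"
    by (rule Vitali_covering_theorem_cballs[of K rad ?E ctr, OF rpos cover])
  let ?B = "\<lambda>i. cball (ctr i) (rad i)"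
  have bound: "measure lebesgue (\<Union>i\<in>D. ?B i) \<le> \<eta>" if D: "D \<subseteq> C" "finite D" for D
  proof -
    define p where "p = (\<lambda>i. (fst i, ?B i)) ` D"
    have inj: "inj_on (\<lambda>i. (fst i, ?B i)) D"
    proof (rule inj_onI)
      fix i j assume ij: "i \<in> D" "j \<in> D" "(fst i, ?B i) = (fst j, ?B j)"
      have "?B i \<noteq> {}" using rpos[of i] ij D C by auto
      then have "\<not> disjnt (?B i) (?B j)" using ij by (auto simp: disjnt_def)
      with C(3) ij D show "i = j" unfolding pairwise_def by blast
    qed
    have part: "p tagged_partial_division_of (cbox a b)"
      unfolding tagged_partial_division_of_def
    proof (intro conjI allI impI)
      show "finite p" using D by (simp add: p_def)
    next
      fix x k assume "(x, k) \<in> p"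
      then obtain t where t: "(x, t) \<in> D" "k = ?B (x, t)" by (auto simp: p_def)
      then have xt: "x \<in> {a..b}" "t \<in> {a..b}" using D C by (auto simp: K_def)
      show "x \<in> k" unfolding t seg by simp
      show "k \<subseteq> cbox a b" unfolding t seg using xt
        by (simp add: closed_segment_subset)
      show "\<exists>u v. k = cbox u v" unfolding t cball_eq_atLeastAtMost cbox_interval[symmetric] by blast
    next
      fix x1 k1 x2 k2 assume *: "(x1, k1) \<in> p \<and> (x2, k2) \<in> p \<and> (x1, k1) \<noteq> (x2, k2)"
      then obtain i j where ij: "i \<in> D" "j \<in> D" "k1 = ?B i" "k2 = ?B j" "i \<noteq> j"
        by (auto simp: p_def)
      then have "disjnt k1 k2" using C(3) D by (auto simp: pairwise_def)
      then show "interior k1 \<inter> interior k2 = {}"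
        using interior_subset by (fastforce simp: disjnt_def)
    qed
    have fine: "\<gamma> fine p"
      unfolding fine_def
    proof clarify
      fix x k z assume "(x, k) \<in> p" "z \<in> k"
      then obtain t where t: "(x, t) \<in> D" "z \<in> closed_segment x t" by (auto simp: p_def seg)
      then have "(x, t) \<in> K" using D C by blast
      then show "z \<in> \<gamma> x" using t by (auto simp: K_def)
    qed
    have "sum (\<lambda>(x,k). norm(measure lborel k *\<^sub>R f x - integral k f)) p < \<eta> * e"
      by (rule \<gamma>(2)[OF part fine])
    also have "sum (\<lambda>(x,k). norm(measure lborel k *\<^sub>R f x - integral k f)) p =
        (\<Sum>i\<in>D. norm (measure lborel (?B i) *\<^sub>R f (fst i) - integral (?B i) f))"
      unfolding p_def by (subst sum.reindex[OF inj]) (simp add: o_def)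
    finally have lt: "(\<Sum>i\<in>D. norm (measure lborel (?B i) *\<^sub>R f (fst i) - integral (?B i) f)) < \<eta> * e" .
    have each: "e * measure lebesgue (?B i) \<le> norm (measure lborel (?B i) *\<^sub>R f (fst i) - integral (?B i) f)"
      if "i \<in> D" for i
    proof -
      obtain x t where i: "i = (x, t)" by (cases i)
      have k: "x \<in> {a..b}" "t \<in> {a..b}" "t \<noteq> x" "norm (?F t - ?F x - (t - x) *\<^sub>R f x) > e * \<bar>t - x\<bar>"
        using that D C i by (auto simp: K_def)
      have "measure lebesgue (?B i) = \<bar>t - x\<bar>"
        unfolding i seg by (auto simp: closed_segment_eq_real_ivl)
      moreover have "norm (measure lborel (?B i) *\<^sub>R f (fst i) - integral (?B i) f) =
          norm (?F t - ?F x - (t - x) *\<^sub>R f x)"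
      proof (cases "x \<le> t")
        case True
        then show ?thesis unfolding i seg using integral_diff_point[OF f k(1,2)]
          by (simp add: closed_segment_eq_real_ivl norm_minus_commute)
      next
        case False
        then have "?F x - ?F t = integral {t..x} f"
          using integral_diff_point[OF f k(2,1)] by simp
        moreover have "?F t - ?F x - (t - x) *\<^sub>R f x = (x - t) *\<^sub>R f x - (?F x - ?F t)"
          by (simp add: algebra_simps)
        ultimately show ?thesis unfolding i seg using False
          by (simp add: closed_segment_eq_real_ivl)
      qed
      ultimately show ?thesis using k(4) by simp
    qed
    have "e * measure lebesgue (\<Union>i\<in>D. ?B i) \<le> e * (\<Sum>i\<in>D. measure lebesgue (?B i))"
      using e D by (intro mult_left_mono measure_UNION_le) auto
    also have "\<dots> \<le> (\<Sum>i\<in>D. norm (measure lborel (?B i) *\<^sub>R f (fst i) - integral (?B i) f))"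
      unfolding sum_distrib_left by (rule sum_mono[OF each])
    finally have "e * measure lebesgue (\<Union>i\<in>D. ?B i) \<le> e * \<eta>"
      using lt by (simp add: mult.commute)
    then show ?thesis using e by simp
  qed
  have U: "(\<Union>i\<in>C. ?B i) \<in> lmeasurable \<and> measure lebesgue (\<Union>i\<in>C. ?B i) \<le> \<eta>"
  proof (cases "C = {}")
    case False
    have "?B i \<in> lmeasurable" for i by simp
    then show ?thesis
      using fmeasurable_UN_bound[OF C(1), of ?B lebesgue \<eta>] measure_UN_bound[OF C(1), of ?B lebesgue \<eta>] bound
      by blast
  qed (use \<eta> in simp)
  let ?T = "(\<Union>i\<in>C. ?B i) \<union> (?E - (\<Union>i\<in>C. ?B i))"
  have "?T \<in> lmeasurable"
    using U C(4) by (intro fmeasurable.Un) (auto intro: negligible_imp_measurable)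
  moreover have "measure lebesgue ?T \<le> \<eta>"
    using U C(4) measure_Un_le[of "(\<Union>i\<in>C. ?B i)" lebesgue "?E - (\<Union>i\<in>C. ?B i)"]
    by (auto simp: negligible_imp_measure0 negligible_imp_sets intro: fmeasurableD)
  ultimately show "\<exists>T. ?E \<subseteq> T \<and> T \<in> lmeasurable \<and> measure lebesgue T \<le> \<eta>"
    by (intro exI[of _ ?T]) auto
qed

theorem lebesgue_differentiation:
  fixes f :: "real \<Rightarrow> 'a::euclidean_space"
  assumes f: "f integrable_on {a..b}"
  shows "negligible {x \<in> {a..b}. \<not> ((\<lambda>t. integral {a..t} f) has_vector_derivative f x) (at x within {a..b})}"
proof (rule negligible_subset)
  let ?F = "\<lambda>t. integral {a..t} f"
  let ?E = "\<lambda>e. {x \<in> {a..b}. \<forall>d>0. \<exists>t\<in>{a..b}. t \<noteq> x \<and> \<bar>t - x\<bar> < d \<and>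
    norm (integral {a..t} f - integral {a..x} f - (t - x) *\<^sub>R f x) > e * \<bar>t - x\<bar>}"
  show "negligible (\<Union>n. ?E (1 / real (Suc n)))"
    by (intro negligible_Union_nat negligible_slope_exceeds[OF f]) simp
  show "{x \<in> {a..b}. \<not> (?F has_vector_derivative f x) (at x within {a..b})} \<subseteq> (\<Union>n. ?E (1 / real (Suc n)))"
  proof (rule subsetI, rule ccontr)
    fix x assume x: "x \<in> {x \<in> {a..b}. \<not> (?F has_vector_derivative f x) (at x within {a..b})}"
      and n: "x \<notin> (\<Union>n. ?E (1 / real (Suc n)))"
    have "(?F has_vector_derivative f x) (at x within {a..b})"
      unfolding has_vector_derivative_def has_derivative_within_alt
    proof (intro conjI allI impI)
      show "bounded_linear (\<lambda>t. t *\<^sub>R f x)" by (rule bounded_linear_scaleR_left)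
      fix e :: real assume "e > 0"
      then obtain m where m: "1 / real (Suc m) < e" by (metis nat_approx_posE)
      from n x obtain d where d: "d > 0" "\<And>t. t\<in>{a..b} \<Longrightarrow> t \<noteq> x \<Longrightarrow> \<bar>t - x\<bar> < d \<Longrightarrow>
         \<not> norm (?F t - ?F x - (t - x) *\<^sub>R f x) > 1 / real (Suc m) * \<bar>t - x\<bar>"
        by blast
      show "\<exists>d>0. \<forall>y\<in>{a..b}. norm (y - x) < d \<longrightarrow> norm (?F y - ?F x - (y - x) *\<^sub>R f x) \<le> e * norm (y - x)"
      proof (intro exI[of _ d] conjI ballI impI d(1))
        fix y assume y: "y \<in> {a..b}" "norm (y - x) < d"
        show "norm (?F y - ?F x - (y - x) *\<^sub>R f x) \<le> e * norm (y - x)"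
        proof (cases "y = x")
          case False
          with d(2)[of y] y have "norm (?F y - ?F x - (y - x) *\<^sub>R f x) \<le> 1 / real (Suc m) * \<bar>y - x\<bar>" by auto
          also have "\<dots> \<le> e * \<bar>y - x\<bar>" using m by (intro mult_right_mono) auto
          finally show ?thesis by simp
        qed simp
      qed
    qed
    with x show False by simp
  qed
qed

section \<open>Variation of absolutely continuous functions\<close>

text \<open>
  The families of intervals that occur in the definition of absolute continuity. Their open interiors
  are disjoint; common endpoints are allowed.
\<close>

definition interval_family :: "real \<Rightarrow> real \<Rightarrow> (real \<times> real) set \<Rightarrow> bool"
  where "interval_family a b P \<longleftrightarrow> finite P \<and> (\<forall>(s, t)\<in>P. a \<le> s \<and> s < t \<and> t \<le> b) \<and>
        pairwise (\<lambda>(s, t) (s', t'). {s<..<t} \<inter> {s'<..<t'} = {}) P"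

definition variation_over :: "(real \<Rightarrow> 'a::real_normed_vector) \<Rightarrow> (real \<times> real) set \<Rightarrow> real"
  where "variation_over y P = (\<Sum>(s, t)\<in>P. norm (y t - y s))"

lemma abs_cont_on_iff:
  "abs_cont_on a b y \<longleftrightarrow> (\<forall>e>0. \<exists>d>0. \<forall>P. interval_family a b P \<and> (\<Sum>(s, t)\<in>P. t - s) < d
      \<longrightarrow> variation_over y P < e)"
  by (simp add: abs_cont_on_def interval_family_def variation_over_def conj_assoc)

lemma interval_familyD:
  assumes "interval_family a b P" "(s, t) \<in> P"
  shows "a \<le> s" "s < t" "t \<le> b"
  using assms by (auto simp: interval_family_def)

text \<open>
  Disjointness of the open intervals in the form in which it is used: two members of the family that
  share an interior point coincide.
\<close>

lemma interval_family_inj: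
  assumes "interval_family a b P" "(s, t) \<in> P" "(s', t') \<in> P" "s < x" "x < t" "s' < x" "x < t'"
  shows "s = s' \<and> t = t'"
proof (rule ccontr)
  assume "\<not> (s = s' \<and> t = t')"
  then have "{s<..<t} \<inter> {s'<..<t'} = {}"
    using assms(1,2,3) unfolding interval_family_def pairwise_def by fastforce
  then show False using assms by auto
qed

lemma interval_familyI:
  assumes "finite P" "\<And>s t. (s, t) \<in> P \<Longrightarrow> a \<le> s \<and> s < t \<and> t \<le> b"
    "\<And>s t s' t' x. (s, t) \<in> P \<Longrightarrow> (s', t') \<in> P \<Longrightarrow> s < x \<Longrightarrow> x < t \<Longrightarrow> s' < x \<Longrightarrow> x < t' \<Longrightarrow> s = s' \<and> t = t'"
  shows "interval_family a b P"
  unfolding interval_family_def pairwise_def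
  using assms(1,2) by (fastforce dest: assms(3))

lemma interval_family_empty [simp]: "interval_family a b {}"
  by (simp add: interval_family_def)

lemma interval_family_single: "a \<le> s \<Longrightarrow> s < t \<Longrightarrow> t \<le> b \<Longrightarrow> interval_family a b {(s, t)}"
  by (simp add: interval_family_def)

lemma interval_family_length_le:
  assumes P: "interval_family a b P" and U: "U \<in> lmeasurable" and sub: "\<And>s t. (s, t) \<in> P \<Longrightarrow> {s<..<t} \<subseteq> U"
  shows "(\<Sum>(s, t)\<in>P. t - s) \<le> measure lebesgue U"
proof -
  let ?I = "\<lambda>(s::real, t). {s<..<t}"
  have fin: "finite P" using P by (simp add: interval_family_def)
  have meas: "?I p \<in> lmeasurable" for p by (auto split: prod.split)
  have "(\<Sum>(s, t)\<in>P. t - s) = (\<Sum>p\<in>P. measure lebesgue (?I p))"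
    using interval_familyD[OF P] by (intro sum.cong refl) fastforce
  also have "\<dots> = measure lebesgue (\<Union>p\<in>P. ?I p)"
  proof (intro measure_UNION'[symmetric] fin meas)
    show "pairwise (\<lambda>p q. disjnt (?I p) (?I q)) P"
      using P by (simp add: interval_family_def disjnt_def case_prod_unfold)
  qed
  also have "\<dots> \<le> measure lebesgue U"
    using sub by (intro measure_mono_fmeasurable U fmeasurableD fmeasurable.finite_UN fin meas) fastforce
  finally show ?thesis .
qed

lemma interval_family_length_le_interval:
  assumes "interval_family a b P" "a \<le> b"
  shows "(\<Sum>(s, t)\<in>P. t - s) \<le> b - a"
  using interval_family_length_le[OF assms(1), of "{a..b}"] interval_familyD[OF assms(1)] assms(2)
  by fastforce

lemma interval_family_append:
  assumes P: "interval_family a b P" and R: "interval_family b c R" and "a \<le> b" "b \<le> c"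
  shows "interval_family a c (P \<union> R)" "variation_over y (P \<union> R) = variation_over y P + variation_over y R"
proof -
  have fin: "finite P" "finite R" using P R by (auto simp: interval_family_def)
  show "interval_family a c (P \<union> R)"
  proof (rule interval_familyI)
    show "finite (P \<union> R)" using fin by simp
    show "a \<le> s \<and> s < t \<and> t \<le> c" if "(s, t) \<in> P \<union> R" for s t
      using that interval_familyD[OF P] interval_familyD[OF R] assms(3,4) by fastforce
    show "s = s' \<and> t = t'" if st: "(s, t) \<in> P \<union> R" "(s', t') \<in> P \<union> R" "s < x" "x < t" "s' < x" "x < t'" for s t s' t' x
    proof -
      have "x < b" if "(s, t) \<in> P" "x < t" for s t using interval_familyD[OF P that(1)] that by linarith
      moreover have "b < x" if "(s, t) \<in> R" "s < x" for s t using interval_familyD[OF R that(1)] that by linarith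
      ultimately consider "(s, t) \<in> P" "(s', t') \<in> P" | "(s, t) \<in> R" "(s', t') \<in> R"
        using st by (metis Un_iff less_asym)
      then show ?thesis
        using interval_family_inj[OF P] interval_family_inj[OF R] st by cases blast+
    qed
  qed
  have "P \<inter> R = {}"
    using interval_familyD[OF P] interval_familyD[OF R] by fastforce
  then show "variation_over y (P \<union> R) = variation_over y P + variation_over y R"
    unfolding variation_over_def by (intro sum.union_disjoint fin)
qed

text \<open>
  Subadditivity of variation: a member that contains \<open>b\<close> in its interior is replaced by its two
  parts, and the triangle inequality bounds its increment by theirs.
\<close>

lemma interval_family_cut:
  assumes P: "interval_family a c P" and "a \<le> b" "b \<le> c"
  obtains P1 P2 where "interval_family a b P1" "interval_family b c P2"
    "variation_over y P \<le> variation_over y P1 + variation_over y P2"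
proof
  define L where "L = {p \<in> P. fst p < b}"
  define R where "R = {p \<in> P. b < snd p}"
  let ?l = "\<lambda>(s, t). (s, min t b)" and ?r = "\<lambda>(s, t). (max s b, t)"
  have fin: "finite P" "finite L" "finite R" using P by (auto simp: interval_family_def L_def R_def)
  have injl: "inj_on ?l L"
  proof (rule inj_onI)
    fix p q assume pq: "p \<in> L" "q \<in> L" "?l p = ?l q"
    obtain s t s' t' where [simp]: "p = (s, t)" "q = (s', t')" by fastforce
    obtain x where "s < x" "x < min (min t t') b"
      using dense[of s "min (min t t') b"] pq interval_familyD[OF P, of s t] interval_familyD[OF P, of s' t']
      by (auto simp: L_def)
    then show "p = q"
      using interval_family_inj[OF P, of s t s' t' x] pq by (auto simp: L_def)
  qed
  have injr: "inj_on ?r R"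
  proof (rule inj_onI)
    fix p q assume pq: "p \<in> R" "q \<in> R" "?r p = ?r q"
    obtain s t s' t' where [simp]: "p = (s, t)" "q = (s', t')" by fastforce
    obtain x where "max (max s s') b < x" "x < t"
      using dense[of "max (max s s') b" t] pq interval_familyD[OF P, of s t] interval_familyD[OF P, of s' t']
      by (auto simp: R_def)
    then show "p = q"
      using interval_family_inj[OF P, of s t s' t' x] pq by (auto simp: R_def)
  qed
  show "interval_family a b (?l ` L)"
  proof (rule interval_familyI)
    fix s t s' t' x assume *: "(s, t) \<in> ?l ` L" "(s', t') \<in> ?l ` L" "s < x" "x < t" "s' < x" "x < t'"
    then obtain r r' where "(s, r) \<in> L" "t = min r b" "(s', r') \<in> L" "t' = min r' b" by auto
    then show "s = s' \<and> t = t'" using interval_family_inj[OF P, of s r s' r' x] * by (auto simp: L_def)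
  qed (use fin interval_familyD[OF P] in \<open>fastforce simp: L_def\<close>)+
  show "interval_family b c (?r ` R)"
  proof (rule interval_familyI)
    fix s t s' t' x assume *: "(s, t) \<in> ?r ` R" "(s', t') \<in> ?r ` R" "s < x" "x < t" "s' < x" "x < t'"
    then obtain r r' where "(r, t) \<in> R" "s = max r b" "(r', t') \<in> R" "s' = max r' b" by auto
    then show "s = s' \<and> t = t'" using interval_family_inj[OF P, of r t r' t' x] * by (auto simp: R_def)
  qed (use fin interval_familyD[OF P] in \<open>fastforce simp: R_def\<close>)+
  let ?n = "\<lambda>(s, t). norm (y t - y s)"
  have "variation_over y P \<le> (\<Sum>p\<in>P. (if p \<in> L then ?n (?l p) else 0) + (if p \<in> R then ?n (?r p) else 0))"
    unfolding variation_over_def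
  proof (rule sum_mono)
    fix p assume p: "p \<in> P"
    obtain s t where [simp]: "p = (s, t)" by (cases p)
    consider "t \<le> b" | "b \<le> s" | "s < b" "b < t" by linarith
    then show "?n p \<le> (if p \<in> L then ?n (?l p) else 0) + (if p \<in> R then ?n (?r p) else 0)"
    proof cases
      case 3
      then show ?thesis using p norm_triangle_ineq[of "y t - y b" "y b - y s"]
        by (simp add: L_def R_def)
    qed (use p interval_familyD[OF P, of s t] in \<open>auto simp: L_def R_def\<close>)
  qed
  also have "\<dots> = (\<Sum>p\<in>L. ?n (?l p)) + (\<Sum>p\<in>R. ?n (?r p))"
    unfolding sum.distrib using fin
    by (simp add: sum.If_cases L_def R_def Int_def cong: if_cong)
  also have "\<dots> = variation_over y (?l ` L) + variation_over y (?r ` R)"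
    unfolding variation_over_def by (simp add: sum.reindex[OF injl] sum.reindex[OF injr] o_def)
  finally show "variation_over y P \<le> variation_over y (?l ` L) + variation_over y (?r ` R)" .
qed

text \<open>
  Replacing each member of a family by a family inside it gives a family of no larger total length;
  therefore \<open>\<epsilon>\<close>-\<open>\<delta>\<close> estimates for a function carry over to its variation.
\<close>

lemma interval_family_refine:
  assumes P: "interval_family a b P" and Q: "\<And>s t. (s, t) \<in> P \<Longrightarrow> interval_family s t (Q (s, t))"
  shows "interval_family a b (\<Union>p\<in>P. Q p)"
    "variation_over y (\<Union>p\<in>P. Q p) = (\<Sum>p\<in>P. variation_over y (Q p))"
    "(\<Sum>(s, t)\<in>(\<Union>p\<in>P. Q p). t - s) \<le> (\<Sum>(s, t)\<in>P. t - s)"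
proof -
  have fin: "finite P" "\<And>p. p \<in> P \<Longrightarrow> finite (Q p)" using P Q by (auto simp: interval_family_def)
  have same: "p = q" if "p \<in> P" "q \<in> P" "(s, t) \<in> Q p" "(s', t') \<in> Q q" "s < x" "x < t" "s' < x" "x < t'"
    for p q s t s' t' x
  proof -
    obtain u v u' v' where [simp]: "p = (u, v)" "q = (u', v')" by fastforce
    show ?thesis
      using interval_family_inj[OF P, of u v u' v' x] interval_familyD[OF Q[of u v], of s t]
        interval_familyD[OF Q[of u' v'], of s' t'] that by auto
  qed
  show fam: "interval_family a b (\<Union>p\<in>P. Q p)"
  proof (rule interval_familyI)
    show "finite (\<Union>p\<in>P. Q p)" using fin by blast
    fix s t assume "(s, t) \<in> (\<Union>p\<in>P. Q p)"
    then obtain u v where "(u, v) \<in> P" "(s, t) \<in> Q (u, v)" by auto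
    then show "a \<le> s \<and> s < t \<and> t \<le> b"
      using interval_familyD[OF P, of u v] interval_familyD[OF Q[of u v], of s t] by auto
  next
    fix s t s' t' x assume *: "(s, t) \<in> (\<Union>p\<in>P. Q p)" "(s', t') \<in> (\<Union>p\<in>P. Q p)" "s < x" "x < t" "s' < x" "x < t'"
    then obtain p q where pq: "p \<in> P" "q \<in> P" "(s, t) \<in> Q p" "(s', t') \<in> Q q" by auto
    with same * have "p = q" by blast
    then show "s = s' \<and> t = t'"
      using interval_family_inj[OF Q[of "fst p" "snd p"], of s t s' t' x] pq * by auto
  qed
  have disj: "\<forall>p\<in>P. \<forall>q\<in>P. p \<noteq> q \<longrightarrow> Q p \<inter> Q q = {}"
  proof (intro ballI impI, rule ccontr)
    fix p q assume pq: "p \<in> P" "q \<in> P" "p \<noteq> q" "Q p \<inter> Q q \<noteq> {}"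
    then obtain s t where st: "(s, t) \<in> Q p" "(s, t) \<in> Q q" by auto
    then have "s < t" using interval_familyD[OF fam, of s t] pq by blast
    then obtain x where "s < x" "x < t" using dense by blast
    then show False using same[of p q s t s t x] pq st by blast
  qed
  show "variation_over y (\<Union>p\<in>P. Q p) = (\<Sum>p\<in>P. variation_over y (Q p))"
    unfolding variation_over_def using fin disj by (intro sum.UNION_disjoint) auto
  have "(\<Sum>(s, t)\<in>(\<Union>p\<in>P. Q p). t - s) = (\<Sum>p\<in>P. (\<Sum>(s, t)\<in>Q p. t - s))"
    using fin disj by (intro sum.UNION_disjoint) auto
  also have "\<dots> \<le> (\<Sum>(s, t)\<in>P. t - s)"
    using interval_family_length_le_interval[OF Q] interval_familyD[OF P]
    by (intro sum_mono) (fastforce simp: less_imp_le)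
  finally show "(\<Sum>(s, t)\<in>(\<Union>p\<in>P. Q p). t - s) \<le> (\<Sum>(s, t)\<in>P. t - s)" .
qed

text \<open>
  The closure properties of absolute continuity (products, Lipschitz images, components) are all
  instances of domination of increments.
\<close>

lemma abs_cont_on_dominated:
  assumes f: "abs_cont_on a b f" and g: "abs_cont_on a b g" and
    le: "\<And>s t. a \<le> s \<Longrightarrow> s < t \<Longrightarrow> t \<le> b \<Longrightarrow> norm (h t - h s) \<le> K * (norm (f t - f s) + norm (g t - g s))"
  shows "abs_cont_on a b h"
  unfolding abs_cont_on_iff
proof (intro allI impI)
  fix e :: real assume e: "e > 0"
  define k where "k = max K 1"
  have k: "k > 0" "K \<le> k" by (auto simp: k_def)
  then have ek: "e / (2 * k) > 0" using e by simp
  obtain d1 where d1: "d1 > 0" "\<And>P. interval_family a b P \<Longrightarrow> (\<Sum>(s, t)\<in>P. t - s) < d1 \<Longrightarrow> variation_over f P < e / (2 * k)"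
    using f ek unfolding abs_cont_on_iff by meson
  obtain d2 where d2: "d2 > 0" "\<And>P. interval_family a b P \<Longrightarrow> (\<Sum>(s, t)\<in>P. t - s) < d2 \<Longrightarrow> variation_over g P < e / (2 * k)"
    using g ek unfolding abs_cont_on_iff by meson
  have "variation_over h P < e" if P: "interval_family a b P" "(\<Sum>(s, t)\<in>P. t - s) < min d1 d2" for P
  proof -
    have "norm (h t - h s) \<le> k * (norm (f t - f s) + norm (g t - g s))" if "(s, t) \<in> P" for s t
    proof -
      have "norm (h t - h s) \<le> K * (norm (f t - f s) + norm (g t - g s))"
        using le interval_familyD[OF P(1) that] by blast
      also have "\<dots> \<le> k * (norm (f t - f s) + norm (g t - g s))"
        using k by (intro mult_right_mono) auto
      finally show ?thesis .
    qed
    then have "variation_over h P \<le> (\<Sum>(s, t)\<in>P. k * (norm (f t - f s) + norm (g t - g s)))"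
      unfolding variation_over_def by (intro sum_mono) auto
    also have "\<dots> = k * (variation_over f P + variation_over g P)"
      by (simp add: variation_over_def sum_distrib_left sum.distrib distrib_left case_prod_unfold)
    also have "\<dots> < k * (e / (2 * k) + e / (2 * k))"
      using d1(2)[OF P(1)] d2(2)[OF P(1)] P(2) k by (intro mult_strict_left_mono add_strict_mono) auto
    also have "\<dots> = e" using k by (simp add: field_simps)
    finally show ?thesis .
  qed
  then show "\<exists>d>0. \<forall>P. interval_family a b P \<and> (\<Sum>(s, t)\<in>P. t - s) < d \<longrightarrow> variation_over h P < e"
    using d1 d2 by (intro exI[of _ "min d1 d2"]) auto
qed

lemma abs_cont_on_imp_continuous_on:
  assumes f: "abs_cont_on a b f"
  shows "continuous_on {a..b} f"
  unfolding continuous_on_iff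
proof (intro ballI allI impI)
  fix x e :: real assume x: "x \<in> {a..b}" and e: "e > 0"
  obtain d where d: "d > 0" "\<And>P. interval_family a b P \<Longrightarrow> (\<Sum>(s, t)\<in>P. t - s) < d \<Longrightarrow> variation_over f P < e"
    using f e unfolding abs_cont_on_iff by meson
  show "\<exists>d>0. \<forall>x'\<in>{a..b}. dist x' x < d \<longrightarrow> dist (f x') (f x) < e"
  proof (intro exI[of _ d] conjI ballI impI d(1))
    fix x' assume x': "x' \<in> {a..b}" "dist x' x < d"
    have "interval_family a b {(s, t)} \<Longrightarrow> t - s < d \<Longrightarrow> norm (f t - f s) < e" for s t
      using d(2)[of "{(s, t)}"] by (simp add: variation_over_def)
    from this[of x x'] this[of x' x] show "dist (f x') (f x) < e"
      using x x' e interval_family_single[of a x x' b] interval_family_single[of a x' x b]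
      by (cases x x' rule: linorder_cases) (auto simp: dist_norm dist_real_def norm_minus_commute)
  qed
qed

text \<open>
  A family inside an interval shorter than the \<open>\<delta>\<close> belonging to \<open>\<epsilon> = 1\<close> has variation below \<open>1\<close>, and
  finitely many such intervals fill \<open>[a, b]\<close>.
\<close>

lemma abs_cont_on_bounded_variation:
  assumes f: "abs_cont_on a b f"
  obtains M where "\<And>P. interval_family a b P \<Longrightarrow> variation_over f P \<le> M"
proof -
  obtain d where d: "d > 0" "\<And>P. interval_family a b P \<Longrightarrow> (\<Sum>(s, t)\<in>P. t - s) < d \<Longrightarrow> variation_over f P < 1"
    using f unfolding abs_cont_on_iff by (meson zero_less_one)
  \<comment> \<open>steps of length \<open>d / 2\<close>, so that the total length inside each step is strictly less than \<open>d\<close>\<close>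
  have step: "variation_over f P \<le> real k"
    if "interval_family a c P" "c \<le> a + real k * (d / 2)" "c \<le> b" for k c P
    using that
  proof (induction k arbitrary: c P)
    case 0
    then have "P = {}" using interval_familyD[OF 0(1)] by fastforce
    then show ?case by (simp add: variation_over_def)
  next
    case (Suc k)
    let ?m = "a + real k * (d / 2)"
    show ?case
    proof (cases "c \<le> ?m")
      case True
      then show ?thesis using Suc.IH[OF Suc.prems(1) True] Suc.prems by simp
    next
      case False
      have "a \<le> ?m" using d(1) by simp
      obtain P1 P2 where P12: "interval_family a ?m P1" "interval_family ?m c P2"
          "variation_over f P \<le> variation_over f P1 + variation_over f P2"
        using interval_family_cut[OF Suc.prems(1), of ?m f] \<open>a \<le> ?m\<close> False by auto
      have "variation_over f P1 \<le> real k" using Suc.IH[OF P12(1)] False Suc.prems by simp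
      moreover have "variation_over f P2 < 1"
      proof (rule d(2))
        show "interval_family a b P2"
          using P12(2) \<open>a \<le> ?m\<close> Suc.prems(3) unfolding interval_family_def by fastforce
        have "(\<Sum>(s, t)\<in>P2. t - s) \<le> c - ?m"
          using interval_family_length_le_interval[OF P12(2)] False by simp
        also have "\<dots> < d" using Suc.prems(2) d(1) by (simp add: field_simps)
        finally show "(\<Sum>(s, t)\<in>P2. t - s) < d" .
      qed
      ultimately show ?thesis using P12(3) by simp
    qed
  qed
  obtain k where "(b - a) / (d / 2) \<le> real k" using real_arch_simple by blast
  then have "b \<le> a + real k * (d / 2)" using d(1) by (simp add: field_simps)
  then show ?thesis using that[of "real k"] step by blast
qed

text \<open>
  The function \<open>W\<close> is the total variation. Both \<open>W\<close> and \<open>W - f\<close> are nondecreasing, so that \<open>f\<close>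
  is a difference of monotone absolutely continuous functions.
\<close>

lemma abs_cont_on_monotone_split:
  fixes f :: "real \<Rightarrow> real"
  assumes f: "abs_cont_on a b f"
  obtains W where "abs_cont_on a b W" "\<And>s t. a \<le> s \<Longrightarrow> s \<le> t \<Longrightarrow> t \<le> b \<Longrightarrow> W s \<le> W t"
    "\<And>s t. a \<le> s \<Longrightarrow> s \<le> t \<Longrightarrow> t \<le> b \<Longrightarrow> \<bar>f t - f s\<bar> \<le> W t - W s"
proof -
  obtain M where M: "\<And>P. interval_family a b P \<Longrightarrow> variation_over f P \<le> M"
    using abs_cont_on_bounded_variation[OF f] by blast
  define V where "V s t = Sup {variation_over f P | P. interval_family s t P}" for s t
  have sub: "interval_family a b P" if "interval_family s t P" "a \<le> s" "t \<le> b" for s t P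
    using that unfolding interval_family_def by fastforce
  have bdd: "bdd_above {variation_over f P | P. interval_family s t P}" if "a \<le> s" "t \<le> b" for s t
    using M sub that by (intro bdd_aboveI[of _ M]) blast
  have up: "variation_over f P \<le> V s t" if "interval_family s t P" "a \<le> s" "t \<le> b" for s t P
    unfolding V_def using that by (intro cSup_upper bdd) auto
  have least: "V s t \<le> z" if "\<And>P. interval_family s t P \<Longrightarrow> variation_over f P \<le> z" for s t z
    unfolding V_def using that by (intro cSup_least) (auto intro: exI[of _ "{}"])
  have add1: "V a s + V s t \<le> V a t" if "a \<le> s" "s \<le> t" "t \<le> b" for s t
  proof -
    have *: "variation_over f P + variation_over f R \<le> V a t" if "interval_family a s P" "interval_family s t R" for P R
      using interval_family_append(1)[OF that \<open>a \<le> s\<close> \<open>s \<le> t\<close>] interval_family_append(2)[OF that \<open>a \<le> s\<close> \<open>s \<le> t\<close>, of f]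
        up[of a t "P \<union> R"] \<open>t \<le> b\<close> by simp
    have "V a s \<le> V a t - variation_over f R" if "interval_family s t R" for R
      using *[OF _ that] by (intro least) (simp add: algebra_simps)
    then have "V s t \<le> V a t - V a s" by (intro least) (simp add: algebra_simps)
    then show ?thesis by simp
  qed
  have add2: "V a t \<le> V a s + V s t" if st: "a \<le> s" "s \<le> t" "t \<le> b" for s t
  proof (rule least)
    fix P assume "interval_family a t P"
    then obtain P1 P2 where "interval_family a s P1" "interval_family s t P2"
          "variation_over f P \<le> variation_over f P1 + variation_over f P2"
      using interval_family_cut[OF _ st(1,2)] by metis
    then show "variation_over f P \<le> V a s + V s t"
      using up[of a s P1] up[of s t P2] st by simp
  qed
  have jump: "\<bar>f t - f s\<bar> \<le> V a t - V a s" if "a \<le> s" "s \<le> t" "t \<le> b" for s t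
  proof (cases "s = t")
    case False
    then have "\<bar>f t - f s\<bar> \<le> V s t"
      using up[OF interval_family_single[of s s t t]] that by (simp add: variation_over_def)
    then show ?thesis using add1[OF that] by simp
  qed simp
  have "abs_cont_on a b (V a)"
    unfolding abs_cont_on_iff
  proof (intro allI impI)
    fix e :: real assume e: "e > 0"
    obtain d where d: "d > 0" "\<And>P. interval_family a b P \<Longrightarrow> (\<Sum>(s, t)\<in>P. t - s) < d \<Longrightarrow> variation_over f P < e / 2"
      using f e unfolding abs_cont_on_iff by (meson half_gt_zero)
    show "\<exists>d>0. \<forall>P. interval_family a b P \<and> (\<Sum>(s, t)\<in>P. t - s) < d \<longrightarrow> variation_over (V a) P < e"
    proof (intro exI[of _ d] conjI allI impI d(1))
      fix P assume P: "interval_family a b P \<and> (\<Sum>(s, t)\<in>P. t - s) < d"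
      \<comment> \<open>slack for choosing an almost optimal family inside each member of \<open>P\<close>; the sum stays below \<open>e / 2\<close>\<close>
      define r where "r = e / (2 * (real (card P) + 1))"
      have r: "r > 0" using e by (simp add: r_def)
      have "\<exists>Q. interval_family (fst p) (snd p) Q \<and> V (fst p) (snd p) < variation_over f Q + r" for p
      proof (rule ccontr)
        assume "\<not> ?thesis"
        then have "V (fst p) (snd p) \<le> V (fst p) (snd p) - r" by (intro least) (force simp: algebra_simps)
        then show False using r by simp
      qed
      then obtain Q where Q: "\<And>p. interval_family (fst p) (snd p) (Q p)"
          "\<And>p. V (fst p) (snd p) < variation_over f (Q p) + r" by metis
      have Q': "interval_family s t (Q (s, t))" for s t using Q(1)[of "(s, t)"] by simp
      note ref = interval_family_refine[of a b P Q, OF conjunct1[OF P] Q']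
      have "variation_over (V a) P \<le> (\<Sum>p\<in>P. variation_over f (Q p) + r)"
        unfolding variation_over_def[of "V a"]
      proof (rule sum_mono)
        fix p assume p: "p \<in> P"
        obtain s t where [simp]: "p = (s, t)" by (cases p)
        have st: "a \<le> s" "s < t" "t \<le> b" using interval_familyD[OF conjunct1[OF P], of s t] p by auto
        have "norm (V a t - V a s) = V a t - V a s" using jump[of s t] st by simp
        also have "\<dots> \<le> V s t" using add2[of s t] st by simp
        also have "\<dots> \<le> variation_over f (Q p) + r" using Q(2)[of p] by simp
        finally show "(\<lambda>(s, t). norm (V a t - V a s)) p \<le> variation_over f (Q p) + r" by simp
      qed
      also have "\<dots> = variation_over f (\<Union>p\<in>P. Q p) + real (card P) * r"
        using ref(2)[of f] by (simp add: sum.distrib)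
      also have "\<dots> < e / 2 + e / 2"
      proof (rule add_less_le_mono)
        have "(\<Sum>(s, t)\<in>(\<Union>p\<in>P. Q p). t - s) < d" using ref(3) P by simp
        then show "variation_over f (\<Union>p\<in>P. Q p) < e / 2"
          using d(2)[OF ref(1)] by simp
        show "real (card P) * r \<le> e / 2" using e by (simp add: r_def field_simps)
      qed
      finally show "variation_over (V a) P < e" by simp
    qed
  qed
  moreover have "V a s \<le> V a t" if "a \<le> s" "s \<le> t" "t \<le> b" for s t
    using jump[OF that] by linarith
  ultimately show ?thesis using jump that by blast
qed

section \<open>Absolutely continuous functions as indefinite integrals\<close>

lemma continuous_on_UNIV_at_right:
  "continuous_on UNIV G \<Longrightarrow> continuous (at_right a) (G :: real \<Rightarrow> real)"
  using continuous_at_imp_continuous_within continuous_on_eq_continuous_at open_UNIV by blast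

lemma continuous_mono_interval_measure_singleton:
  assumes mono: "\<And>x y. x \<le> y \<Longrightarrow> G x \<le> G y" and cont: "continuous_on UNIV (G :: real \<Rightarrow> real)"
  shows "emeasure (interval_measure G) {x} = 0"
proof -
  note rc = continuous_on_UNIV_at_right[OF cont]
  have le: "emeasure (interval_measure G) {x} \<le> ennreal e" if e: "e > 0" for e
  proof -
    obtain d where d: "d > 0" "\<And>y. dist y x < d \<Longrightarrow> dist (G y) (G x) < e"
      using cont e unfolding continuous_on_iff by (metis UNIV_I)
    let ?y = "x - d / 2"
    have "emeasure (interval_measure G) {x} \<le> emeasure (interval_measure G) {?y<..x}"
      using d by (intro emeasure_mono) auto
    also have "\<dots> = ennreal (G x - G ?y)"
      using d by (intro emeasure_interval_measure_Ioc mono rc) auto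
    also have "\<dots> \<le> ennreal e"
      using d(1) d(2)[of ?y] by (intro ennreal_leI) (auto simp: dist_real_def)
    finally show ?thesis .
  qed
  have "emeasure (interval_measure G) {x} \<le> 0"
    by (rule ennreal_le_epsilon) (use le in simp)
  then show ?thesis by simp
qed

text \<open>
  A null set has an open neighbourhood \<open>U\<close> of small measure, and \<open>U\<close> contains nonoverlapping compact
  intervals that cover the null set. Their total length is small, hence so is the total increment of
  \<open>G\<close>, which is their Stieltjes measure.
\<close>

lemma abs_cont_on_monotone_imp_null_sets:
  fixes G :: "real \<Rightarrow> real"
  assumes mono: "\<And>x y. x \<le> y \<Longrightarrow> G x \<le> G y" and ac: "abs_cont_on u v G" and "u < v"
    and cont: "continuous_on UNIV G"
    and A: "A \<in> null_sets lborel" "A \<subseteq> {u..v}"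
  shows "emeasure (interval_measure G) A = 0"
proof -
  let ?N = "interval_measure G"
  note rc = continuous_on_UNIV_at_right[OF cont]
  have box: "emeasure ?N {s..t} = ennreal (G t - G s)" if "s \<le> t" for s t
  proof -
    have "emeasure ?N {s..t} = emeasure ?N ({s<..t} \<union> {s})"
      using that by (intro arg_cong[of _ _ "emeasure ?N"]) auto
    also have "\<dots> = emeasure ?N {s<..t}"
      using continuous_mono_interval_measure_singleton[OF mono cont]
      by (intro emeasure_Un_null_set) (auto simp: null_sets_def)
    also have "\<dots> = ennreal (G t - G s)"
      by (intro emeasure_interval_measure_Ioc mono rc that)
    finally show ?thesis .
  qed
  have le: "emeasure ?N A \<le> ennreal e" if e: "e > 0" for e
  proof -
    obtain d where d: "d > 0" "\<And>P. interval_family u v P \<Longrightarrow> (\<Sum>(s, t)\<in>P. t - s) < d \<Longrightarrow> variation_over G P < e"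
      using ac e unfolding abs_cont_on_iff by meson
    have A0: "A \<in> null_sets lebesgue" "A \<in> sets lebesgue" using A(1) by (auto intro: null_sets_completionI)
    obtain U where U: "open U" "A \<subseteq> U" "U - A \<in> lmeasurable" "emeasure lebesgue (U - A) < ennreal d"
      using sets_lebesgue_outer_open[OF A0(2) d(1)] by metis
    have "U = (U - A) \<union> A" using U by auto
    then have Um: "U \<in> lmeasurable" using U(3) A0
      by (metis fmeasurable.Un negligible_iff_null_sets negligible_imp_measurable)
    have "emeasure lebesgue U = emeasure lebesgue (U - A)"
      using emeasure_Diff_null_set[OF A0(1), of U] U(1) by simp
    then have "ennreal (measure lebesgue U) < ennreal d"
      using U(4) emeasure_eq_measure2[OF Um] by simp
    then have Ud: "measure lebesgue U < d"
      by (simp add: ennreal_less_iff)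
    \<comment> \<open>only points of \<open>A\<close>, which lie in \<open>U\<close>, occur as tags; outside \<open>U\<close> the gauge may be arbitrary\<close>
    obtain \<D> where D: "countable \<D>"  "\<Union>\<D> \<subseteq> cbox u v"
      "\<And>K. K \<in> \<D> \<Longrightarrow> interior K \<noteq> {} \<and> (\<exists>c d. K = cbox c d)"
      "pairwise (\<lambda>A B. interior A \<inter> interior B = {}) \<D>"
      "\<And>K. K \<in> \<D> \<Longrightarrow> \<exists>x \<in> A \<inter> K. K \<subseteq> (if x \<in> U then U else UNIV)"
      "A \<subseteq> \<Union>\<D>"
    proof (rule covering_lemma[of A u v "\<lambda>x. if x \<in> U then U else UNIV"])
      show "gauge (\<lambda>x. if x \<in> U then U else UNIV)" using U(1) by (simp add: gauge_def)
    qed (use A \<open>u < v\<close> in auto)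
    have DU: "K \<subseteq> U" if "K \<in> \<D>" for K
      using D(5)[OF that] U(2) by (auto split: if_splits)
    define ends where "ends = (\<lambda>K::real set. (Inf K, Sup K))"
    have K: "\<exists>s t. K = {s..t} \<and> s < t \<and> ends K = (s, t) \<and> u \<le> s \<and> t \<le> v" if KD: "K \<in> \<D>" for K
    proof -
      obtain s t where st: "K = {s..t}" using D(3)[OF KD] by auto
      moreover have "s < t" using D(3)[OF KD] st by (auto simp: interior_atLeastAtMost_real)
      moreover have "{s..t} \<subseteq> {u..v}" using subset_trans[OF Union_upper[OF KD] D(2)] st by simp
      ultimately show ?thesis by (auto simp: ends_def)
    qed
    have bound: "measure ?N (\<Union>F) \<le> e" if F: "F \<subseteq> \<D>" "finite F" for F
    proof -
      have KF: "\<exists>s t. k = {s..t} \<and> s < t \<and> ends k = (s, t) \<and> u \<le> s \<and> t \<le> v" if "k \<in> F" for k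
        using K[of k] that F(1) by blast
      have inj: "inj_on ends F"
      proof (rule inj_onI)
        fix k l assume "k \<in> F" "l \<in> F" "ends k = ends l"
        then show "k = l" using KF[OF \<open>k \<in> F\<close>] KF[OF \<open>l \<in> F\<close>] by auto
      qed
      have fam: "interval_family u v (ends ` F)"
      proof (rule interval_familyI)
        fix s t s' t' x assume *: "(s, t) \<in> ends ` F" "(s', t') \<in> ends ` F" "s < x" "x < t" "s' < x" "x < t'"
        then obtain k l where kl: "k \<in> F" "l \<in> F" "ends k = (s, t)" "ends l = (s', t')" by force
        then have "k = {s..t}" "l = {s'..t'}" using KF[OF kl(1)] KF[OF kl(2)] by auto
        then have "x \<in> interior k \<inter> interior l" using * by (simp add: interior_atLeastAtMost_real)
        then have "k = l" using D(4) kl F unfolding pairwise_def by blast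
        then show "s = s' \<and> t = t'" using kl by simp
      next
        fix s t assume "(s, t) \<in> ends ` F"
        then obtain k where "k \<in> F" "ends k = (s, t)" by force
        then show "u \<le> s \<and> s < t \<and> t \<le> v" using KF[of k] by auto
      qed (use F in auto)
      have "(\<Sum>(s, t)\<in>ends ` F. t - s) \<le> measure lebesgue U"
      proof (rule interval_family_length_le[OF fam Um])
        fix s t assume "(s, t) \<in> ends ` F"
        then obtain k where "k \<in> F" "ends k = (s, t)" by force
        then have "{s..t} \<subseteq> U" using KF[of k] F DU[of k] by auto
        then show "{s<..<t} \<subseteq> U" using greaterThanLessThan_subseteq_atLeastAtMost_iff by (auto)
      qed
      then have small: "variation_over G (ends ` F) < e" using d(2)[OF fam] Ud by simp
      have "emeasure ?N (\<Union>F) \<le> (\<Sum>k\<in>F. emeasure ?N k)"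
        using emeasure_subadditive_finite[of F "\<lambda>k. k" ?N] F K by force
      also have "\<dots> = (\<Sum>k\<in>F. ennreal ((\<lambda>(s, t). norm (G t - G s)) (ends k)))"
      proof (rule sum.cong[OF refl])
        fix k assume "k \<in> F"
        then obtain s t where "k = {s..t}" "s < t" "ends k = (s, t)" using KF[of k] by auto
        then show "emeasure ?N k = ennreal ((\<lambda>(s, t). norm (G t - G s)) (ends k))"
          using box[of s t] mono[of s t] by simp
      qed
      also have "\<dots> = ennreal (variation_over G (ends ` F))"
        unfolding variation_over_def by (subst sum_ennreal) (auto simp: sum.reindex[OF inj] o_def split: prod.split)
      also have "\<dots> \<le> ennreal e" using small by (intro ennreal_leI) simp
      finally show ?thesis using e by (simp add: measure_def enn2real_leI)
    qed
    have meas: "K \<in> fmeasurable ?N" if "K \<in> \<D>" for K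
      using K[OF that] box by (auto intro!: fmeasurableI)
    have "emeasure ?N A \<le> emeasure ?N (\<Union>\<D>)"
      by (rule emeasure_mono[OF D(6)], rule sets.countable_Union[OF D(1)], rule subsetI, rule fmeasurableD[OF meas])
    also have "\<dots> \<le> ennreal e"
    proof -
      have 1: "(\<Union>K\<in>\<D>. K) \<in> fmeasurable ?N"
        by (rule fmeasurable_UN_bound[where B=e, OF D(1) meas]) (use bound in auto)
      moreover have "measure ?N (\<Union>K\<in>\<D>. K) \<le> e"
        by (rule measure_UN_bound[where B=e, OF D(1) meas]) (use bound in auto)
      ultimately show ?thesis using e by (simp add: emeasure_eq_measure2 ennreal_leI)
    qed
    finally show ?thesis .
  qed
  have "emeasure ?N A \<le> 0"
    by (rule ennreal_le_epsilon) (use le in simp)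
  then show ?thesis by simp
qed

text \<open>
  The density \<open>g\<close> is the Radon-Nikodym derivative of the Stieltjes measure of \<open>H\<close>, restricted to
  \<open>(u, v]\<close>.
\<close>

lemma abs_cont_on_monotone_imp_integral:
  fixes H :: "real \<Rightarrow> real"
  assumes mono: "\<And>s t. u \<le> s \<Longrightarrow> s \<le> t \<Longrightarrow> t \<le> v \<Longrightarrow> H s \<le> H t" and ac: "abs_cont_on u v H" and uv: "u < v"
  obtains g where "g absolutely_integrable_on {u..v}" "\<And>x. x \<in> {u..v} \<Longrightarrow> (g has_integral (H x - H u)) {u..x}"
proof -
  \<comment> \<open>constant continuation, since Stieltjes measures are formed from functions on the whole line\<close>
  define G where "G = (\<lambda>x. H (max u (min x v)))"
  have G: "G x = H x" if "x \<in> {u..v}" for x using that by (auto simp: G_def)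
  have Gmono: "G x \<le> G y" if "x \<le> y" for x y
    unfolding G_def using that uv by (intro mono) auto
  have "continuous_on UNIV (H \<circ> (\<lambda>x. max u (min x v)))"
    using uv by (intro continuous_on_compose continuous_on_subset[OF abs_cont_on_imp_continuous_on[OF ac]] continuous_intros) auto
  then have cont: "continuous_on UNIV G" by (simp add: G_def o_def)
  have Gac: "abs_cont_on u v G"
    by (rule abs_cont_on_dominated[OF ac ac, of _ 1]) (simp add: G)
  note rc = continuous_on_UNIV_at_right[OF cont]
  let ?N = "interval_measure G"
  define N where "N = density ?N (indicator {u<..v})"
  have emN: "emeasure N A = emeasure ?N ({u<..v} \<inter> A)" if "A \<in> sets borel" for A :: "real set"
    unfolding N_def using that by (subst emeasure_restricted) auto
  have "absolutely_continuous lborel N"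
    unfolding absolutely_continuous_def
  proof
    fix A :: "real set" assume A: "A \<in> null_sets lborel"
    have "{u<..v} \<inter> A \<in> null_sets lborel" by (rule null_set_Int1[OF A]) simp
    moreover have "{u<..v} \<inter> A \<subseteq> {u..v}" by auto
    ultimately have "emeasure ?N ({u<..v} \<inter> A) = 0"
      using abs_cont_on_monotone_imp_null_sets[OF Gmono Gac uv cont] by blast
    then show "A \<in> null_sets N" using A emN[of A] by (auto simp: null_sets_def N_def)
  qed
  moreover have "sets N = sets lborel" by (simp add: N_def)
  ultimately obtain f where f: "f \<in> borel_measurable lborel" "density lborel f = N"
    using sigma_finite_measure.Radon_Nikodym[OF sigma_finite_lborel] by blast
  have [measurable]: "f \<in> borel_measurable borel" using f(1) by simp
  have int: "(\<integral>\<^sup>+x. f x * indicator A x \<partial>lborel) = emeasure ?N ({u<..v} \<inter> A)" if "A \<in> sets borel" for A :: "real set"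
    using that f(2) emN[OF that] emeasure_density[OF f(1), of A] by simp
  have "(\<integral>\<^sup>+x. f x \<partial>lborel) = emeasure ?N {u<..v}" using int[of UNIV] by simp
  also have "\<dots> = ennreal (G v - G u)" using uv by (intro emeasure_interval_measure_Ioc Gmono rc) auto
  finally have "(\<integral>\<^sup>+x. f x \<partial>lborel) \<noteq> \<infinity>" by simp
  then have fin: "AE x in lborel. f x \<noteq> \<infinity>"
    by (rule nn_integral_PInf_AE[rotated]) simp
  define g where "g = (\<lambda>x. enn2real (f x))"
  have g: "(g has_integral (H x - H u)) {u..x}" if x: "x \<in> {u..v}" for x
  proof -
    have "(\<integral>\<^sup>+y. ennreal (g y * indicator {u<..x} y) \<partial>lborel) = (\<integral>\<^sup>+y. f y * indicator {u<..x} y \<partial>lborel)"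
      using fin by (intro nn_integral_cong_AE) (auto simp: g_def split: split_indicator simp: less_top)
    also have "\<dots> = emeasure ?N {u<..x}"
      using x int[of "{u<..x}"] by (simp add: Int_absorb1)
    also have "\<dots> = ennreal (G x - G u)" using x by (intro emeasure_interval_measure_Ioc Gmono rc) auto
    also have "\<dots> = ennreal (H x - H u)" using x by (simp add: G)
    finally have "((\<lambda>y. g y * indicator {u<..x} y) has_integral (H x - H u)) UNIV"
      using x mono[of u x] by (intro nn_integral_has_integral) (auto simp: g_def)
    also have "(\<lambda>y. g y * indicator {u<..x} y) = (\<lambda>y. if y \<in> {u<..x} then g y else 0)"
      by (auto simp: fun_eq_iff)
    finally have "(g has_integral (H x - H u)) {u<..x}" unfolding has_integral_restrict_UNIV .
    then show ?thesis
      by (subst has_integral_spike_set_eq[of _ "{u<..x}"]) (auto intro: negligible_subset[of "{u}"])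
  qed
  moreover have "g absolutely_integrable_on {u..v}"
    using g[of v] uv by (intro nonnegative_absolutely_integrable_1) (auto simp: g_def)
  ultimately show ?thesis using that by blast
qed

theorem abs_cont_on_imp_integral:
  fixes y :: "real \<Rightarrow> 'a::euclidean_space"
  assumes ac: "abs_cont_on a b y" and ab: "a < b"
  obtains g where "g absolutely_integrable_on {a..b}" "\<And>x. x \<in> {a..b} \<Longrightarrow> (g has_integral (y x - y a)) {a..x}"
proof -
  have real_case: "\<exists>g. g absolutely_integrable_on {a..b} \<and> (\<forall>x\<in>{a..b}. (g has_integral (f x - f a)) {a..x})"
    if f: "abs_cont_on a b f" for f :: "real \<Rightarrow> real"
  proof -
    obtain W where W: "abs_cont_on a b W" "\<And>s t. a \<le> s \<Longrightarrow> s \<le> t \<Longrightarrow> t \<le> b \<Longrightarrow> W s \<le> W t"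
      "\<And>s t. a \<le> s \<Longrightarrow> s \<le> t \<Longrightarrow> t \<le> b \<Longrightarrow> \<bar>f t - f s\<bar> \<le> W t - W s"
      using abs_cont_on_monotone_split[OF f] by blast
    obtain g where g: "g absolutely_integrable_on {a..b}" "\<And>x. x \<in> {a..b} \<Longrightarrow> (g has_integral (W x - W a)) {a..x}"
      using abs_cont_on_monotone_imp_integral[OF W(2) W(1) ab] by metis
    have "abs_cont_on a b (\<lambda>x. W x - f x)"
      by (rule abs_cont_on_dominated[OF W(1) f, of _ 1]) auto
    then obtain h where h: "h absolutely_integrable_on {a..b}"
        "\<And>x. x \<in> {a..b} \<Longrightarrow> (h has_integral ((W x - f x) - (W a - f a))) {a..x}"
      using abs_cont_on_monotone_imp_integral[of a b "\<lambda>x. W x - f x"] W(3) ab by (smt (verit, best))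
    show ?thesis
    proof (intro exI[of _ "\<lambda>x. g x - h x"] conjI ballI set_integral_diff(1) g h)
      fix x assume "x \<in> {a..b}"
      from has_integral_diff[OF g(2)[OF this] h(2)[OF this]]
      show "((\<lambda>x. g x - h x) has_integral f x - f a) {a..x}" by simp
    qed
  qed
  have "\<exists>g. g absolutely_integrable_on {a..b} \<and> (\<forall>x\<in>{a..b}. (g has_integral (y x \<bullet> i - y a \<bullet> i)) {a..x})"
    if i: "i \<in> Basis" for i
  proof (rule real_case, rule abs_cont_on_dominated[OF ac ac, of _ 1])
    show "norm (y t \<bullet> i - y s \<bullet> i) \<le> 1 * (norm (y t - y s) + norm (y t - y s))" for s t
      using Basis_le_norm[OF i, of "y t - y s"] by (simp add: inner_diff_left)
  qed
  then obtain g where g: "\<And>i. i \<in> Basis \<Longrightarrow> g i absolutely_integrable_on {a..b}"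
     "\<And>i x. i \<in> Basis \<Longrightarrow> x \<in> {a..b} \<Longrightarrow> (g i has_integral (y x \<bullet> i - y a \<bullet> i)) {a..x}" by metis
  define G where "G = (\<lambda>x. \<Sum>i\<in>Basis. g i x *\<^sub>R i)"
  have Gi: "G x \<bullet> i = g i x" if "i \<in> Basis" for i x
    using that by (simp add: G_def inner_sum_left inner_Basis if_distrib sum.delta cong: if_cong)
  show ?thesis
  proof (rule that[of G])
    show "G absolutely_integrable_on {a..b}"
      by (subst absolutely_integrable_componentwise_iff) (use g(1) Gi in simp)
    show "(G has_integral (y x - y a)) {a..x}" if "x \<in> {a..b}" for x
      by (subst has_integral_componentwise_iff) (use g(2) Gi that in \<open>simp add: inner_diff_left\<close>)
  qed
qed

section \<open>Calculus of locally absolutely continuous functions\<close>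

lemma eventually_le_real: "\<forall>\<^sub>F n in sequentially. x \<le> real n"
proof -
  obtain N where N: "x \<le> real N" using real_arch_simple by blast
  show ?thesis using eventually_ge_at_top[of N] by eventually_elim (use N in auto)
qed

lemma interval_family_integral_le:
  fixes f :: "real \<Rightarrow> real"
  assumes P: "interval_family a b P" and f: "f integrable_on {a..b}" "\<And>x. x \<in> {a..b} \<Longrightarrow> 0 \<le> f x"
  shows "(\<Sum>(s, t)\<in>P. integral {s..t} f) \<le> integral {a..b} f"
proof -
  let ?I = "\<lambda>p::real \<times> real. {fst p<..<snd p}"
  have P': "a \<le> fst p" "fst p < snd p" "snd p \<le> b" if "p \<in> P" for p
    using interval_familyD[OF P, of "fst p" "snd p"] that by auto
  have "(f has_integral integral {fst p..snd p} f) (?I p)" if "p \<in> P" for p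
  proof -
    have "f integrable_on {fst p..snd p}"
      by (rule integrable_subinterval_real[OF f(1)]) (use P'[OF that] in auto)
    then have "(f has_integral integral {fst p..snd p} f) {fst p..snd p}" by (rule integrable_integral)
    then show ?thesis by (simp add: has_integral_Icc_iff_Ioo)
  qed
  moreover have "pairwise (\<lambda>p q. negligible (?I p \<inter> ?I q)) P"
    unfolding pairwise_def
  proof (intro ballI impI)
    fix p q assume "p \<in> P" "q \<in> P" "p \<noteq> q"
    then have "?I p \<inter> ?I q = {}"
      using P unfolding interval_family_def pairwise_def case_prod_unfold by blast
    then show "negligible (?I p \<inter> ?I q)" by simp
  qed
  ultimately have "(f has_integral (\<Sum>p\<in>P. integral {fst p..snd p} f)) (\<Union>p\<in>P. ?I p)"
    using P by (intro has_integral_UN) (auto simp: interval_family_def)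
  then have "(\<Sum>p\<in>P. integral {fst p..snd p} f) \<le> integral {a..b} f"
    using integrable_integral[OF f(1)] f(2) P' by (intro has_integral_subset_le[of "\<Union>p\<in>P. ?I p" "{a..b}" f]) fastforce+
  then show ?thesis by (simp add: case_prod_unfold)
qed

text \<open>
  The part of \<open>norm g\<close> above a high level \<open>N\<close> has a small integral by dominated convergence; the rest
  is bounded by \<open>N\<close> and contributes at most \<open>N\<close> times the total length of a family.
\<close>

lemma integral_abs_cont_on:
  fixes y g :: "real \<Rightarrow> 'a::euclidean_space"
  assumes g: "g absolutely_integrable_on {a..b}" and
    y: "\<And>x. x \<in> {a..b} \<Longrightarrow> (g has_integral (y x - y a)) {a..x}"
  shows "abs_cont_on a b y"
  unfolding abs_cont_on_iff
proof (intro allI impI)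
  fix e :: real assume e: "e > 0"
  let ?h = "\<lambda>x. norm (g x)"
  let ?f = "\<lambda>k x. max (?h x - real k) 0"
  have h: "?h absolutely_integrable_on {a..b}" using absolutely_integrable_norm[OF g] by (simp add: o_def)
  have f: "?f k absolutely_integrable_on {a..b}" for k
    by (intro absolutely_integrable_max_1 set_integral_diff(1) h) auto
  have "(\<lambda>k. integral {a..b} (?f k)) \<longlonglongrightarrow> integral {a..b} (\<lambda>x. 0)"
  proof (rule dominated_convergence(2)[where h="?h"])
    show "?f k integrable_on {a..b}" for k using f set_lebesgue_integral_eq_integral(1) by blast
    show "?h integrable_on {a..b}" using h set_lebesgue_integral_eq_integral(1) by blast
    show "norm (?f k x) \<le> ?h x" for k x by auto
    show "(\<lambda>k. ?f k x) \<longlonglongrightarrow> 0" for x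
      by (intro tendsto_eventually eventually_mono[OF eventually_le_real[of "?h x"]]) auto
  qed
  then have "(\<lambda>k. integral {a..b} (?f k)) \<longlonglongrightarrow> 0" by simp
  then have "\<forall>\<^sub>F k in sequentially. integral {a..b} (?f k) < e / 2"
    using e by (intro order_tendstoD) auto
  then obtain N where N: "integral {a..b} (?f N) < e / 2" by (auto simp: eventually_sequentially)
  define d where "d = e / (2 * (real N + 1))"
  have d: "d > 0" using e by (simp add: d_def)
  have int: "?h integrable_on {s..t}" "?f N integrable_on {s..t}" "g integrable_on {s..t}" if "a \<le> s" "t \<le> b" for s t
    using that g h f[of N] set_lebesgue_integral_eq_integral(1) integrable_subinterval_real
    by (metis atLeastatMost_subset_iff)+
  show "\<exists>d>0. \<forall>P. interval_family a b P \<and> (\<Sum>(s, t)\<in>P. t - s) < d \<longrightarrow> variation_over y P < e"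
  proof (intro exI[of _ d] conjI allI impI d)
    fix P assume P: "interval_family a b P \<and> (\<Sum>(s, t)\<in>P. t - s) < d"
    have "norm (y t - y s) \<le> integral {s..t} (?f N) + real N * (t - s)" if "(s, t) \<in> P" for s t
    proof -
      have st: "a \<le> s" "s < t" "t \<le> b" using interval_familyD[OF conjunct1[OF P] that] by auto
      have "integral {a..t} g - integral {a..s} g = integral {s..t} g"
        using st by (intro integral_diff_point[OF int(3)[of a b]]) auto
      moreover have "integral {a..t} g = y t - y a" "integral {a..s} g = y s - y a"
        using y st by (auto intro!: integral_unique)
      ultimately have "norm (y t - y s) = norm (integral {s..t} g)" by simp
      also have "\<dots> \<le> integral {s..t} ?h"
        using int[OF st(1,3)] by (intro integral_norm_bound_integral) auto
      also have "\<dots> \<le> integral {s..t} (\<lambda>x. ?f N x + real N)"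
        using int[OF st(1,3)] by (intro integral_le integrable_add) auto
      also have "\<dots> = integral {s..t} (?f N) + real N * (t - s)"
        using int[OF st(1,3)] st by (subst Henstock_Kurzweil_Integration.integral_add) (auto simp: mult.commute)
      finally show ?thesis .
    qed
    then have "variation_over y P \<le> (\<Sum>(s, t)\<in>P. integral {s..t} (?f N) + real N * (t - s))"
      unfolding variation_over_def by (intro sum_mono) auto
    also have "\<dots> = (\<Sum>(s, t)\<in>P. integral {s..t} (?f N)) + real N * (\<Sum>(s, t)\<in>P. t - s)"
      by (simp add: sum.distrib sum_distrib_left case_prod_unfold)
    also have "\<dots> < e / 2 + e / 2"
    proof (rule add_less_le_mono)
      have "(\<Sum>(s, t)\<in>P. integral {s..t} (?f N)) \<le> integral {a..b} (?f N)"
        using interval_family_integral_le[OF conjunct1[OF P] int(2)[of a b]] by simp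
      then show "(\<Sum>(s, t)\<in>P. integral {s..t} (?f N)) < e / 2" using N by simp
      have "real N * (\<Sum>(s, t)\<in>P. t - s) \<le> real N * d" using P by (intro mult_left_mono) auto
      also have "\<dots> \<le> e / 2" using e by (simp add: d_def field_simps)
      finally show "real N * (\<Sum>(s, t)\<in>P. t - s) \<le> e / 2" .
    qed
    finally show "variation_over y P < e" by simp
  qed
qed

text \<open>
  Local absolute continuity together with a chosen almost everywhere derivative, in integrated form.
  This form is stable under changes of the derivative on null sets.
\<close>

definition ac_deriv :: "(real \<Rightarrow> 'a::euclidean_space) \<Rightarrow> (real \<Rightarrow> 'a) \<Rightarrow> bool"
  where "ac_deriv y g \<longleftrightarrow> (\<forall>b>0. g absolutely_integrable_on {0..b}) \<and>
    (\<forall>x\<ge>0. (g has_integral (y x - y 0)) {0..x})"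

lemma ac_derivD:
  assumes "ac_deriv y g"
  shows "b > 0 \<Longrightarrow> g absolutely_integrable_on {0..b}" "x \<ge> 0 \<Longrightarrow> (g has_integral (y x - y 0)) {0..x}"
  using assms by (auto simp: ac_deriv_def)

lemma AE_half_line_iff: "(AE x in half_line. P x) \<longleftrightarrow> negligible {x. 0 \<le> x \<and> \<not> P x}"
proof -
  have "(AE x in half_line. P x) \<longleftrightarrow> (AE x in lebesgue. 0 \<le> x \<longrightarrow> P x)"
    by (subst AE_restrict_space_iff) auto
  also have "\<dots> \<longleftrightarrow> {x. 0 \<le> x \<and> \<not> P x} \<in> null_sets lebesgue"
    using AE_iff_null_sets[of "{x. 0 \<le> x \<and> \<not> P x}" lebesgue]
      completion.AE_iff_null_sets[of "\<lambda>x. 0 \<le> x \<longrightarrow> P x" lborel]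
    by (auto simp: eventually_ae_filter intro: completion.complete2 null_sets_completion_subset)
  finally show ?thesis by (simp add: negligible_iff_null_sets)
qed

lemma ac_deriv_imp_AC_loc: "ac_deriv y g \<Longrightarrow> AC_loc y"
  unfolding AC_loc_def by (intro allI impI integral_abs_cont_on[where g=g]) (auto dest: ac_derivD)

lemma AC_loc_imp_continuous_on: "AC_loc y \<Longrightarrow> continuous_on {0..} y"
proof -
  assume y: "AC_loc y"
  show ?thesis
    unfolding continuous_on_eq_continuous_within
  proof
    fix x :: real assume x: "x \<in> {0..}"
    have "continuous_on {0..x + 1} y"
      using y x by (intro abs_cont_on_imp_continuous_on) (auto simp: AC_loc_def)
    then have "continuous (at x within {0..x + 1}) y"
      using x by (auto simp: continuous_on_eq_continuous_within)
    moreover have "at x within {0..x + 1} = at x within {0..}"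
      using x by (intro at_within_nhd[of x "{..<x + 1}"]) auto
    ultimately show "continuous (at x within {0..}) y" by simp
  qed
qed

lemma indefinite_integral_derivative_half_line:
  assumes y: "\<And>t. t \<in> {0..b} \<Longrightarrow> (g has_integral (y t - y 0)) {0..t}" and x: "0 \<le> x" "x < b"
    and d: "((\<lambda>t. integral {0..t} g) has_vector_derivative g x) (at x within {0..b})"
  shows "(y has_vector_derivative g x) (at x within {0..})"
proof -
  have "((\<lambda>t. y 0 + integral {0..t} g) has_vector_derivative g x) (at x within {0..b})"
    using d by (auto intro!: derivative_eq_intros)
  then have "(y has_vector_derivative g x) (at x within {0..b})"
  proof (rule has_vector_derivative_transform[rotated 2])
    show "x \<in> {0..b}" using x by simp
    show "y t = y 0 + integral {0..t} g" if "t \<in> {0..b}" for t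
      using integral_unique[OF y[OF that]] by simp
  qed
  moreover have "at x within {0..b} = at x within {0..}"
    using x by (intro at_within_nhd[of x "{..<b}"]) auto
  ultimately show ?thesis by simp
qed

lemma ac_deriv_AE:
  assumes y: "ac_deriv y g"
  shows "AE x in half_line. (y has_vector_derivative g x) (at x within {0..})"
  unfolding AE_half_line_iff
proof (rule negligible_subset)
  let ?B = "\<lambda>b. {x \<in> {0..b}. \<not> ((\<lambda>t. integral {0..t} g) has_vector_derivative g x) (at x within {0..b})}"
  show "negligible (\<Union>n. ?B (real (Suc n)))"
    using ac_derivD(1)[OF y] by (intro negligible_Union_nat lebesgue_differentiation)
      (auto intro: set_lebesgue_integral_eq_integral(1))
  show "{x. 0 \<le> x \<and> \<not> (y has_vector_derivative g x) (at x within {0..})} \<subseteq> (\<Union>n. ?B (real (Suc n)))"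
  proof (rule subsetI, rule ccontr)
    fix x assume x: "x \<in> {x. 0 \<le> x \<and> \<not> (y has_vector_derivative g x) (at x within {0..})}"
      and nx: "x \<notin> (\<Union>n. ?B (real (Suc n)))"
    obtain n where n: "x < real (Suc n)"
      using real_arch_simple[of x] by (metis le_less_trans lessI of_nat_less_iff)
    have "(y has_vector_derivative g x) (at x within {0..})"
      by (rule indefinite_integral_derivative_half_line[of "real (Suc n)"])
        (use ac_derivD(2)[OF y] nx x n in auto)
    with x show False by simp
  qed
qed

lemma half_line_not_bot: "x \<ge> 0 \<Longrightarrow> at x within {0::real..} \<noteq> bot"
proof -
  assume "x \<ge> 0"
  then have "at_right x \<le> at x within {0..}" by (intro at_le) auto
  then show ?thesis using trivial_limit_at_right_real[of x] by (metis bot.extremum_unique)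
qed

lemma AC_loc_imp_ac_deriv:
  fixes y :: "real \<Rightarrow> 'a::euclidean_space"
  assumes y: "AC_loc y"
  shows "ac_deriv y (\<lambda>x. vector_derivative y (at x within {0..}))"
proof -
  let ?d = "\<lambda>x. vector_derivative y (at x within {0..})"
  have key: "?d absolutely_integrable_on {0..b}" "\<And>x. x \<in> {0..b} \<Longrightarrow> (?d has_integral (y x - y 0)) {0..x}"
    if b: "b > 0" for b
  proof -
    obtain g where g: "g absolutely_integrable_on {0..b}" "\<And>x. x \<in> {0..b} \<Longrightarrow> (g has_integral (y x - y 0)) {0..x}"
      using abs_cont_on_imp_integral[of 0 b y] y b by (auto simp: AC_loc_def)
    let ?N = "{x \<in> {0..b}. \<not> ((\<lambda>t. integral {0..t} g) has_vector_derivative g x) (at x within {0..b})}"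
    have N: "negligible (insert b ?N)"
      using lebesgue_differentiation[OF set_lebesgue_integral_eq_integral(1)[OF g(1)]] by simp
    have eq: "?d x = g x" if "x \<in> {0..b} - insert b ?N" for x
    proof -
      have x: "0 \<le> x" "x < b" using that by auto
      have "(y has_vector_derivative g x) (at x within {0..})"
        by (rule indefinite_integral_derivative_half_line[OF g(2) x]) (use that in auto)
      then show ?thesis
        using half_line_not_bot[OF x(1)] by (intro vector_derivative_within)
    qed
    show "?d absolutely_integrable_on {0..b}"
      by (rule absolutely_integrable_spike[OF g(1) N]) (use eq in auto)
    fix x assume x: "x \<in> {0..b}"
    show "(?d has_integral (y x - y 0)) {0..x}"
      by (rule has_integral_spike[OF N _ g(2)[OF x]]) (use eq x in auto)
  qed
  show ?thesis
    unfolding ac_deriv_def using key(1) key(2)[of "x + 1" x for x] by auto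
qed

lemma ac_deriv_AE_cong:
  assumes y: "ac_deriv y g" and eq: "AE x in half_line. h x = g x"
  shows "ac_deriv y h"
proof -
  let ?N = "{x. 0 \<le> x \<and> h x \<noteq> g x}"
  have N: "negligible ?N" using eq by (simp add: AE_half_line_iff)
  show ?thesis
    unfolding ac_deriv_def
  proof (intro conjI allI impI)
    show "h absolutely_integrable_on {0..b}" if "b > 0" for b
      by (rule absolutely_integrable_spike[OF ac_derivD(1)[OF y that] N]) auto
    show "(h has_integral (y x - y 0)) {0..x}" if "x \<ge> 0" for x
      by (rule has_integral_spike[OF N _ ac_derivD(2)[OF y that]]) auto
  qed
qed

text \<open>
  The fundamental theorem of calculus for Lebesgue integrals, on the half-line.
\<close>

theorem ac_deriv_iff:
  "ac_deriv y g \<longleftrightarrow> AC_loc y \<and> (AE x in half_line. (y has_vector_derivative g x) (at x within {0..}))"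
proof
  assume "ac_deriv y g"
  then show "AC_loc y \<and> (AE x in half_line. (y has_vector_derivative g x) (at x within {0..}))"
    using ac_deriv_imp_AC_loc ac_deriv_AE by blast
next
  assume *: "AC_loc y \<and> (AE x in half_line. (y has_vector_derivative g x) (at x within {0..}))"
  have "AE x in half_line. g x = vector_derivative y (at x within {0..})"
    using conjunct2[OF *] AE_space
  proof eventually_elim
    fix x assume "(y has_vector_derivative g x) (at x within {0..})" "x \<in> space half_line"
    then show "g x = vector_derivative y (at x within {0..})"
      using half_line_not_bot[of x] by (simp add: vector_derivative_within)
  qed
  then show "ac_deriv y g"
    using AC_loc_imp_ac_deriv * ac_deriv_AE_cong by blast
qed

lemma ac_deriv_product:
  fixes f :: "real \<Rightarrow> 'a::euclidean_space" and g :: "real \<Rightarrow> 'b::euclidean_space"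
    and prod :: "'a \<Rightarrow> 'b \<Rightarrow> 'c::euclidean_space"
  assumes prod: "bounded_bilinear prod" and f: "ac_deriv f f'" and g: "ac_deriv g g'"
  shows "ac_deriv (\<lambda>x. prod (f x) (g x)) (\<lambda>x. prod (f x) (g' x) + prod (f' x) (g x))"
  unfolding ac_deriv_iff
proof
  interpret bounded_bilinear prod by fact
  show "AC_loc (\<lambda>x. prod (f x) (g x))"
    unfolding AC_loc_def
  proof (intro allI impI)
    fix b :: real assume b: "b > 0"
    have acf: "abs_cont_on 0 b f" "abs_cont_on 0 b g"
      using f g b ac_deriv_imp_AC_loc by (auto simp: AC_loc_def)
    have "compact (f ` {0..b})" "compact (g ` {0..b})"
      by (intro compact_continuous_image abs_cont_on_imp_continuous_on acf compact_Icc)+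
    then obtain Mf Mg where M: "\<And>x. x \<in> {0..b} \<Longrightarrow> norm (f x) \<le> Mf" "\<And>x. x \<in> {0..b} \<Longrightarrow> norm (g x) \<le> Mg"
      by (metis bounded_iff compact_imp_bounded imageI)
    obtain K where K: "K > 0" "\<And>a b. norm (prod a b) \<le> norm a * norm b * K" using pos_bounded by blast
    show "abs_cont_on 0 b (\<lambda>x. prod (f x) (g x))"
    proof (rule abs_cont_on_dominated[OF acf, of _ "max Mf Mg * K"])
      fix s t assume st: "0 \<le> s" "s < t" "t \<le> b"
      have "prod (f t) (g t) - prod (f s) (g s) = prod (f t) (g t - g s) + prod (f t - f s) (g s)"
        by (simp add: diff_left diff_right)
      then have "norm (prod (f t) (g t) - prod (f s) (g s)) \<le> norm (f t) * norm (g t - g s) * K + norm (f t - f s) * norm (g s) * K"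
        using norm_triangle_ineq[of "prod (f t) (g t - g s)" "prod (f t - f s) (g s)"] K(2)[of "f t" "g t - g s"] K(2)[of "f t - f s" "g s"]
        by simp
      also have "\<dots> \<le> max Mf Mg * norm (g t - g s) * K + norm (f t - f s) * max Mf Mg * K"
        using M(1)[of t] M(2)[of s] st K(1) by (intro add_mono mult_right_mono mult_left_mono) auto
      also have "\<dots> = max Mf Mg * K * (norm (f t - f s) + norm (g t - g s))" by (simp add: algebra_simps)
      finally show "norm (prod (f t) (g t) - prod (f s) (g s)) \<le> max Mf Mg * K * (norm (f t - f s) + norm (g t - g s))" .
    qed
  qed
  show "AE x in half_line. ((\<lambda>x. prod (f x) (g x)) has_vector_derivative prod (f x) (g' x) + prod (f' x) (g x)) (at x within {0..})"
    using ac_deriv_AE[OF f] ac_deriv_AE[OF g]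
    by eventually_elim (rule has_vector_derivative)
qed

lemma ac_deriv_linear:
  fixes f :: "real \<Rightarrow> 'a::euclidean_space" and L :: "'a \<Rightarrow> 'b::euclidean_space"
  assumes L: "bounded_linear L" and f: "ac_deriv f f'"
  shows "ac_deriv (\<lambda>x. L (f x)) (\<lambda>x. L (f' x))"
  unfolding ac_deriv_def
proof (intro conjI allI impI)
  interpret bounded_linear L by fact
  show "(\<lambda>x. L (f' x)) absolutely_integrable_on {0..b}" if "b > 0" for b
    using absolutely_integrable_linear[OF ac_derivD(1)[OF f that] L] by (simp add: o_def)
  show "((\<lambda>x. L (f' x)) has_integral (L (f x) - L (f 0))) {0..x}" if "x \<ge> 0" for x
    using has_integral_linear[OF ac_derivD(2)[OF f that] L] by (simp add: o_def diff)
qed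

text \<open>
  The exponential is Lipschitz on the compact range of \<open>m\<close>, so the composition stays absolutely
  continuous and the chain rule may be applied almost everywhere.
\<close>

lemma ac_deriv_exp:
  fixes m :: "real \<Rightarrow> real"
  assumes m: "ac_deriv m m'"
  shows "ac_deriv (\<lambda>x. exp (m x)) (\<lambda>x. exp (m x) * m' x)"
  unfolding ac_deriv_iff
proof
  show "AC_loc (\<lambda>x. exp (m x))"
    unfolding AC_loc_def
  proof (intro allI impI)
    fix b :: real assume b: "b > 0"
    have ac: "abs_cont_on 0 b m" using m b ac_deriv_imp_AC_loc by (auto simp: AC_loc_def)
    have "compact (m ` {0..b})"
      by (intro compact_continuous_image abs_cont_on_imp_continuous_on ac compact_Icc)
    then obtain M where M: "\<And>x. x \<in> {0..b} \<Longrightarrow> \<bar>m x\<bar> \<le> M"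
      by (metis bounded_iff compact_imp_bounded imageI real_norm_def)
    \<comment> \<open>the increment is \<open>exp v (1 - exp (u - v))\<close>\<close>
    have lip: "exp v - exp u \<le> exp M * (v - u)" if "u \<le> v" "v \<le> M" for u v :: real
    proof -
      have "1 - exp (u - v) \<le> v - u" using exp_ge_add_one_self[of "u - v"] by linarith
      then have "exp v * (1 - exp (u - v)) \<le> exp M * (v - u)"
        using that by (intro mult_mono) auto
      then show ?thesis by (simp add: right_diff_distrib exp_diff)
    qed
    show "abs_cont_on 0 b (\<lambda>x. exp (m x))"
    proof (rule abs_cont_on_dominated[OF ac ac, of _ "exp M"])
      fix s t assume st: "0 \<le> s" "s < t" "t \<le> b"
      have "\<bar>exp (m t) - exp (m s)\<bar> \<le> exp M * \<bar>m t - m s\<bar>"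
        using lip[of "m s" "m t"] lip[of "m t" "m s"] M[of s] M[of t] st
        by (cases "m s \<le> m t") auto
      then show "norm (exp (m t) - exp (m s)) \<le> exp M * (norm (m t - m s) + norm (m t - m s))"
        by (simp add: algebra_simps add_increasing)
    qed
  qed
  show "AE x in half_line. ((\<lambda>x. exp (m x)) has_vector_derivative exp (m x) * m' x) (at x within {0..})"
    using ac_deriv_AE[OF m]
    by eventually_elim (auto simp flip: has_real_derivative_iff_has_vector_derivative intro!: derivative_eq_intros)
qed

lemma ac_deriv_diff:
  assumes "ac_deriv y g"  "0 \<le> a" "a \<le> b"
  shows "(g has_integral (y b - y a)) {a..b}"
proof -
  have g: "g integrable_on {0..b}" using ac_derivD(2)[OF assms(1), of b] assms by auto
  have "integral {a..b} g = integral {0..b} g - integral {0..a} g"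
    using integral_diff_point[OF g, of a b] assms by auto
  also have "\<dots> = y b - y a"
    using assms ac_derivD(2)[OF assms(1), THEN integral_unique] by simp
  finally show ?thesis
    using integrable_integral[OF integrable_subinterval_real[OF g, of a b]] assms by simp
qed

section \<open>Linear differential equations with locally integrable coefficients\<close>

lemma ac_deriv_integral:
  assumes "\<And>b. b > 0 \<Longrightarrow> g absolutely_integrable_on {0..b}"
  shows "ac_deriv (\<lambda>x. c + integral {0..x} g) g"
  unfolding ac_deriv_def
proof (intro conjI allI impI assms)
  fix x :: real assume "x \<ge> 0"
  then have "x + 1 > 0" by simp
  from set_lebesgue_integral_eq_integral(1)[OF assms[OF this]]
  have "g integrable_on {0..x}"
    by (rule integrable_subinterval_real) simp
  then show "(g has_integral c + integral {0..x} g - (c + integral {0..0} g)) {0..x}"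
    using integrable_integral by force
qed

lemma has_integral_norm_le:
  fixes f :: "'n::euclidean_space \<Rightarrow> 'a::banach"
  assumes f: "(f has_integral i) S" and g: "(g has_integral j) S" and le: "\<And>x. norm (f x) \<le> g x"
  shows "norm i \<le> j"
  using integral_norm_bound_integral[OF has_integral_integrable[OF f] has_integral_integrable[OF g] le]
    integral_unique[OF f] integral_unique[OF g] by simp

lemma absolutely_integrable_bilinear_continuous:
  fixes f :: "real \<Rightarrow> 'a::euclidean_space" and g :: "real \<Rightarrow> 'b::euclidean_space"
    and h :: "'b \<Rightarrow> 'a \<Rightarrow> 'c::euclidean_space"
  assumes h: "bounded_bilinear h" and f: "continuous_on {a..b} f" and g: "g absolutely_integrable_on {a..b}"
  shows "(\<lambda>x. h (g x) (f x)) absolutely_integrable_on {a..b}"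
proof (rule absolutely_integrable_bounded_measurable_product[of "\<lambda>u v. h v u" f "{a..b}" g])
  show "bilinear (\<lambda>u v. h v u)"
    using bounded_bilinear.flip[OF h] bilinear_conv_bounded_bilinear by blast
  show "f \<in> borel_measurable (lebesgue_on {a..b})"
    by (intro continuous_imp_measurable_on_sets_lebesgue f) auto
  show "bounded (f ` {a..b})"
    by (intro compact_imp_bounded compact_continuous_image f) auto
qed (use g in auto)

text \<open>
  A global Picard iteration. With \<open>m(x)\<close> twice the integral of \<open>k = K norm M\<close> over \<open>[0, x]\<close>, where \<open>K\<close>
  bounds the bilinear map, the weight \<open>exp (- m)\<close> turns the integral operator into a contraction
  with constant \<open>1/2\<close> on bounded continuous functions, because \<open>exp m k\<close> integrates to
  \<open>(exp m - 1)/2\<close>. Its fixed point is, up to the weight, a solution on the whole half-line.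
\<close>

theorem linear_ode_exists:
  fixes M :: "real \<Rightarrow> 'b::euclidean_space" and prod :: "'b \<Rightarrow> 'a::euclidean_space \<Rightarrow> 'a"
  assumes prod: "bounded_bilinear prod" and M: "\<And>b. b > 0 \<Longrightarrow> M absolutely_integrable_on {0..b}"
  obtains y where "y 0 = y0" "ac_deriv y (\<lambda>x. prod (M x) (y x))"
proof -
  interpret bounded_bilinear prod by fact
  obtain K where K: "K > 0" "\<And>a b. norm (prod a b) \<le> norm a * norm b * K" using pos_bounded by blast
  define k where "k = (\<lambda>t. K * norm (M t))"
  have k: "(\<lambda>t. 2 * k t) absolutely_integrable_on {0..b}" if "b > 0" for b
    using absolutely_integrable_norm[OF M[OF that]] by (auto simp: k_def o_def)
  define m where "m = (\<lambda>x. 0 + integral {0..x} (\<lambda>t. 2 * k t))"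
  have m: "ac_deriv m (\<lambda>t. 2 * k t)"
    unfolding m_def by (rule ac_deriv_integral[OF k])
  have m0: "m 0 = 0" by (simp add: m_def)
  have mcont: "continuous_on {0..} m" using m by (intro AC_loc_imp_continuous_on ac_deriv_imp_AC_loc)
  have weight: "((\<lambda>t. exp (m t) * k t) has_integral (exp (m x) - 1) / 2) {0..x}" if "x \<ge> 0" for x
  proof -
    have "((\<lambda>t. exp (m t) * (2 * k t)) has_integral (exp (m x) - exp (m 0))) {0..x}"
      by (rule ac_derivD(2)[OF ac_deriv_exp[OF m] that])
    from has_integral_mult_right[OF this, of "1/2"] show ?thesis by (simp add: m0 mult_ac)
  qed
  define G where "G = (\<lambda>u :: real \<Rightarrow>\<^sub>C 'a. \<lambda>t. prod (M t) (exp (m t) *\<^sub>R apply_bcontfun u t))"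
  define F where "F = (\<lambda>u x. y0 + integral {0..x} (G u))"
  have Gint: "G u absolutely_integrable_on {0..b}" if "b > 0" for u b
    unfolding G_def using mcont
    by (intro absolutely_integrable_bilinear_continuous[OF prod] M that continuous_intros)
      (auto intro: continuous_on_subset)
  have Fac: "ac_deriv (F u) (G u)" for u
    unfolding F_def by (rule ac_deriv_integral[OF Gint])
  have diff: "norm (exp (- m x) *\<^sub>R (F u x - F v x)) \<le> dist u v / 2" if x: "x \<ge> 0" for u v x
  proof -
    have "((\<lambda>t. G u t - G v t) has_integral (F u x - F v x)) {0..x}"
      using has_integral_diff[OF ac_derivD(2)[OF Fac x] ac_derivD(2)[OF Fac x], of u v] by (simp add: F_def)
    moreover have "((\<lambda>t. dist u v * (exp (m t) * k t)) has_integral (dist u v * ((exp (m x) - 1) / 2))) {0..x}"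
      by (rule has_integral_mult_right[OF weight[OF x]])
    moreover have "norm (G u t - G v t) \<le> dist u v * (exp (m t) * k t)" for t
    proof -
      have "G u t - G v t = prod (M t) (exp (m t) *\<^sub>R (u t - v t))"
        by (simp add: G_def diff_right[symmetric] scaleR_diff_right)
      then have "norm (G u t - G v t) \<le> norm (M t) * (exp (m t) * norm (u t - v t)) * K"
        using K(2)[of "M t" "exp (m t) *\<^sub>R (u t - v t)"] by simp
      also have "\<dots> \<le> norm (M t) * (exp (m t) * dist u v) * K"
        using K(1) dist_bounded[of u t v]
        by (intro mult_right_mono mult_left_mono) (auto simp: dist_norm)
      finally show ?thesis by (simp add: k_def mult_ac)
    qed
    ultimately have "norm (F u x - F v x) \<le> dist u v * ((exp (m x) - 1) / 2)"
      by (rule has_integral_norm_le)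
    then have "exp (- m x) * norm (F u x - F v x) \<le> exp (- m x) * (dist u v * ((exp (m x) - 1) / 2))"
      by (intro mult_left_mono) auto
    also have "\<dots> = dist u v / 2 - exp (- m x) * dist u v / 2"
      by (simp add: field_simps exp_minus)
    also have "\<dots> \<le> dist u v / 2" by simp
    finally show ?thesis by simp
  qed
  define r where "r = (\<lambda>x::real. max 0 x)"
  \<comment> \<open>the fixed point operator, made constant on the negative axis so that it acts on functions on the line\<close>
  define S where "S = (\<lambda>u x. exp (- m (r x)) *\<^sub>R F u (r x))"
  have m_nonneg: "m x \<ge> 0" if "x \<ge> 0" for x
    using has_integral_nonneg[OF ac_derivD(2)[OF m that]] K(1) by (simp add: m0 k_def)
  have S: "S u \<in> bcontfun" for u
  proof (rule bcontfun_normI)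
    have "continuous_on {0..} (\<lambda>x. exp (- m x) *\<^sub>R F u x)"
      using Fac[of u] by (intro continuous_intros mcont AC_loc_imp_continuous_on ac_deriv_imp_AC_loc)
    moreover have "continuous_on UNIV r" "range r \<subseteq> {0..}"
      by (auto simp: r_def intro!: continuous_intros)
    ultimately have "continuous_on UNIV (\<lambda>x. exp (- m (r x)) *\<^sub>R F u (r x))"
      by (rule continuous_on_compose2)
    then show "continuous_on UNIV (S u)" by (simp add: S_def)
    fix x
    have F0: "F 0 z = y0" for z by (simp add: F_def G_def zero_right)
    have "norm (S u x) \<le> norm (exp (- m (r x)) *\<^sub>R (F u (r x) - F 0 (r x))) + norm (exp (- m (r x)) *\<^sub>R F 0 (r x))"
      using norm_triangle_ineq[of "exp (- m (r x)) *\<^sub>R (F u (r x) - F 0 (r x))" "exp (- m (r x)) *\<^sub>R F 0 (r x)"]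
      by (simp add: S_def scaleR_diff_right)
    also have "\<dots> \<le> dist u 0 / 2 + norm y0"
    proof (rule add_mono[OF diff])
      show "norm (exp (- m (r x)) *\<^sub>R F 0 (r x)) \<le> norm y0"
        using m_nonneg[of "r x"] mult_right_mono[of "exp (- m (r x))" 1 "norm y0"] by (simp add: F0 r_def)
    qed (simp add: r_def)
    finally show "norm (S u x) \<le> dist u 0 / 2 + norm y0" .
  qed
  define T where "T = (\<lambda>u. Bcontfun (S u))"
  have T: "apply_bcontfun (T u) = S u" for u by (simp add: T_def Bcontfun_inverse S)
  have "\<exists>!u. T u = u"
  proof (rule banach_fix_type[of "1/2"])
    show "\<forall>u v. dist (T u) (T v) \<le> 1 / 2 * dist u v"
    proof (intro allI, rule dist_bound)
      fix u v :: "real \<Rightarrow>\<^sub>C 'a" and x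
      show "dist (T u x) (T v x) \<le> 1 / 2 * dist u v"
        using diff[of "r x" u v] by (simp add: T S_def dist_norm scaleR_diff_right[symmetric] r_def del: norm_scaleR)
    qed
  qed auto
  then obtain u where u: "T u = u" by blast
  define y where "y = F u"
  have y_eq: "y x = exp (m x) *\<^sub>R u x" if "x \<ge> 0" for x
  proof -
    have "u x = S u x" using T[of u] u by simp
    then show ?thesis using that by (simp add: y_def S_def r_def exp_minus)
  qed
  have "ac_deriv y (\<lambda>x. prod (M x) (y x))"
    unfolding y_def[symmetric]
  proof (rule ac_deriv_AE_cong)
    show "ac_deriv y (G u)" unfolding y_def by (rule Fac)
    show "AE x in half_line. prod (M x) (y x) = G u x"
      by (rule AE_I2) (simp add: G_def y_eq)
  qed
  moreover have "y 0 = y0" by (simp add: y_def F_def)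
  ultimately show ?thesis using that by blast
qed

section \<open>Matrices, inner products and integrals on the half-line\<close>

lemma cdot_commute: "cdot u v = cnj (cdot v u)"
  by (simp add: cdot_def mult.commute)

lemma cdot_add: "cdot (u + v) w = cdot u w + cdot v w" "cdot u (v + w) = cdot u v + cdot u w"
  by (simp_all add: cdot_def sum.distrib algebra_simps)

lemma cdot_smult: "cdot (c *s u) v = c * cdot u v" "cdot u (c *s v) = cnj c * cdot u v"
  by (simp_all add: cdot_def sum_distrib_left algebra_simps)

lemma cdot_scaleR: "cdot (r *\<^sub>R u) v = r *\<^sub>R cdot u v" "cdot u (r *\<^sub>R v) = r *\<^sub>R cdot u v"
  by (simp_all add: scaleR_eq_smult cdot_smult scaleR_conv_of_real)

lemma bounded_bilinear_cdot: "bounded_bilinear (cdot :: complex^'n \<Rightarrow> _)"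
  by (rule bounded_bilinear.intro) (auto simp: cdot_add cdot_scaleR intro!: exI[of _ 1] cdot_bound)

interpretation cdot: bounded_bilinear "cdot :: complex^'n::finite \<Rightarrow> _"
  by (rule bounded_bilinear_cdot)

lemma cdot_adjoint: "cdot (M *v u) v = cdot u (cadj M *v v)"
proof -
  have "cdot (M *v u) v = (\<Sum>i\<in>UNIV. \<Sum>j\<in>UNIV. M $ i $ j * u $ j * cnj (v $ i))"
    by (simp add: cdot_def matrix_vector_mult_def sum_distrib_right)
  also have "\<dots> = (\<Sum>j\<in>UNIV. \<Sum>i\<in>UNIV. M $ i $ j * u $ j * cnj (v $ i))"
    by (rule sum.swap)
  also have "\<dots> = cdot u (cadj M *v v)"
    by (simp add: cdot_def cadj_def matrix_vector_mult_def sum_distrib_left mult_ac)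
  finally show ?thesis .
qed

lemma cadj_cadj [simp]: "cadj (cadj M) = M"
  by (simp add: cadj_def vec_eq_iff)

lemma cadj_mult: "cadj (A ** B) = cadj B ** cadj A"
  by (simp add: cadj_def vec_eq_iff matrix_matrix_mult_def mult.commute)

lemma cadj_mat: "cadj (mat c) = mat (cnj c)"
  by (simp add: cadj_def vec_eq_iff mat_def)

lemma cadj_diff: "cadj (A - B) = cadj A - cadj B"
  and cadj_minus: "cadj (- A) = - cadj A"
  by (simp_all add: cadj_def vec_eq_iff)

lemma bounded_linear_cadj: "bounded_linear (cadj :: complex^'n^'n \<Rightarrow> _)"
  unfolding linear_conv_bounded_linear[symmetric]
  by (rule linearI) (simp_all add: cadj_def vec_eq_iff)

lemma bounded_bilinear_matrix_mult: "bounded_bilinear ((**) :: complex^'n^'n \<Rightarrow> complex^'n^'n \<Rightarrow> _)"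
  unfolding bilinear_conv_bounded_bilinear[symmetric] bilinear_def
  by (auto intro!: linearI simp: matrix_matrix_mult_def vec_eq_iff sum.distrib algebra_simps scaleR_sum_right)

lemma bounded_bilinear_matrix_vector_mult: "bounded_bilinear ((*v) :: complex^'n^'n \<Rightarrow> complex^'n \<Rightarrow> _)"
  unfolding bilinear_conv_bounded_bilinear[symmetric] bilinear_def
  by (auto intro!: linearI simp: matrix_vector_mult_def vec_eq_iff sum.distrib algebra_simps scaleR_sum_right)

interpretation mm: bounded_bilinear "(**) :: complex^'n::finite^'n \<Rightarrow> complex^'n^'n \<Rightarrow> _"
  by (rule bounded_bilinear_matrix_mult)

interpretation mv: bounded_bilinear "(*v) :: complex^'n::finite^'n \<Rightarrow> complex^'n \<Rightarrow> _"
  by (rule bounded_bilinear_matrix_vector_mult)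

lemma mat_mult_vec: "mat c *v v = c *s v"
  by (simp add: vec_eq_iff mat_def matrix_vector_mult_def if_distrib if_distribR sum.delta cong: if_cong)

lemma bounded_linear_matrix_vector_mult: "bounded_linear ((*v) (A :: complex^'n^'n))"
  by (rule mv.bounded_linear_right)

lemma measurable_bilinear:
  fixes prod :: "'a::euclidean_space \<Rightarrow> 'b::euclidean_space \<Rightarrow> 'c::euclidean_space"
  assumes "bounded_bilinear prod" "f \<in> borel_measurable M" "g \<in> borel_measurable M"
  shows "(\<lambda>x. prod (f x) (g x)) \<in> borel_measurable M"
proof (rule borel_measurable_continuous_Pair[OF assms(2,3)])
  show "continuous_on UNIV (\<lambda>p. prod (fst p) (snd p))"
    by (intro bounded_bilinear.continuous_on[OF assms(1)] continuous_intros)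
qed

lemma measurable_bounded_linear:
  fixes L :: "'a::euclidean_space \<Rightarrow> 'b::euclidean_space"
  assumes "bounded_linear L" "f \<in> borel_measurable M"
  shows "(\<lambda>x. L (f x)) \<in> borel_measurable M"
  by (rule measurable_compose[OF assms(2)])
    (intro borel_measurable_continuous_onI linear_continuous_on assms(1))

lemma half_line_integrable_iff:
  fixes f :: "real \<Rightarrow> 'a::euclidean_space"
  shows "integrable half_line f \<longleftrightarrow> f absolutely_integrable_on {0..}"
  by (simp add: integrable_restrict_space set_integrable_def)

lemma half_line_integral_cut:
  fixes f :: "real \<Rightarrow> 'a::euclidean_space"
  assumes f: "f absolutely_integrable_on {0..b}"
  shows "integrable half_line (\<lambda>x. if x \<le> b then f x else 0)"
    "(LINT x|half_line. (if x \<le> b then f x else 0)) = integral {0..b} f"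
proof -
  have "(\<lambda>x. indicator {0..} x *\<^sub>R (if x \<le> b then f x else 0)) = (\<lambda>x. indicator {0..b} x *\<^sub>R f x)"
    by (auto simp: fun_eq_iff split: split_indicator)
  then show int: "integrable half_line (\<lambda>x. if x \<le> b then f x else 0)"
    using f by (simp add: integrable_restrict_space set_integrable_def)
  have "{..b} \<inter> {0..} = {0..b}" by auto
  then have "integral {0..} (\<lambda>x. if x \<in> {..b} then f x else 0) = integral {0..b} f"
    by (subst Henstock_Kurzweil_Integration.integral_restrict_Int) simp
  then show "(LINT x|half_line. (if x \<le> b then f x else 0)) = integral {0..b} f"
    by (subst lebesgue_integral_eq_integral[OF int]) simp_all
qed

lemma half_line_measurableI:
  fixes f :: "real \<Rightarrow> 'a::euclidean_space"
  assumes f: "\<And>b. b > 0 \<Longrightarrow> f absolutely_integrable_on {0..b}"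
  shows "f \<in> borel_measurable half_line"
proof (rule borel_measurable_LIMSEQ_metric)
  show "(\<lambda>x. if x \<le> real (Suc n) then f x else 0) \<in> borel_measurable half_line" for n
    using half_line_integral_cut(1)[OF f[of "real (Suc n)"]] by (intro borel_measurable_integrable) simp
  show "(\<lambda>n. if x \<le> real (Suc n) then f x else 0) \<longlonglongrightarrow> f x" for x
    by (intro tendsto_eventually eventually_mono[OF eventually_le_real[of x]]) auto
qed

lemma L1_locD: "L1_loc Q \<Longrightarrow> b > 0 \<Longrightarrow> Q absolutely_integrable_on {0..b}"
  by (simp add: L1_loc_def)

lemma L1_loc_measurable: "L1_loc Q \<Longrightarrow> Q \<in> borel_measurable half_line"
  by (rule half_line_measurableI) (rule L1_locD)

lemma L1_loc_linear:
  assumes "L1_loc Q" "bounded_linear L"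
  shows "L1_loc (\<lambda>x. L (Q x))"
  using absolutely_integrable_linear[OF L1_locD[OF assms(1)] assms(2)] by (simp add: L1_loc_def o_def)

lemma L1_loc_cadj: "L1_loc Q \<Longrightarrow> L1_loc (\<lambda>x. cadj (Q x))"
  by (rule L1_loc_linear[OF _ bounded_linear_cadj])

lemma L1_loc_diff_mat:
  fixes Q :: "real \<Rightarrow> complex^'n^'n"
  assumes "L1_loc Q" shows "L1_loc (\<lambda>x. Q x - mat c)"
  unfolding L1_loc_def
proof (intro allI impI)
  fix b :: real assume "b > 0"
  have "(\<lambda>x. mat c :: complex^'n^'n) absolutely_integrable_on {0..b}"
    by (intro absolutely_integrable_continuous_real continuous_intros)
  then show "(\<lambda>x. Q x - mat c) absolutely_integrable_on {0..b}"
    by (rule set_integral_diff(1)[OF L1_locD[OF assms \<open>b > 0\<close>]])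
qed

lemma continuous_on_half_line_measurable:
  fixes y :: "real \<Rightarrow> 'a::euclidean_space"
  assumes "continuous_on {0..} y" shows "y \<in> borel_measurable half_line"
  by (intro continuous_imp_measurable_on_sets_lebesgue assms) simp

lemma ac_deriv_continuous_on: "ac_deriv y g \<Longrightarrow> continuous_on {0..} y"
  by (intro AC_loc_imp_continuous_on ac_deriv_imp_AC_loc)

lemma ac_deriv_measurable: "ac_deriv y g \<Longrightarrow> y \<in> borel_measurable half_line"
  "ac_deriv y g \<Longrightarrow> g \<in> borel_measurable half_line"
  by (intro continuous_on_half_line_measurable ac_deriv_continuous_on) (auto intro: half_line_measurableI dest: ac_derivD)

lemma ac_deriv_eq_0_beyond:
  assumes y: "ac_deriv y g" and b: "b \<ge> 0" "\<And>x. x \<ge> b \<Longrightarrow> y x = 0"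
  shows "AE x in half_line. x > b \<longrightarrow> g x = 0"
  using ac_deriv_AE[OF y]
proof eventually_elim
  fix x assume d: "(y has_vector_derivative g x) (at x within {0..})"
  show "x > b \<longrightarrow> g x = 0"
  proof
    assume x: "x > b"
    have "((\<lambda>_. 0) has_vector_derivative g x) (at x within {0..} \<inter> {b<..})"
      by (rule has_vector_derivative_transform[of _ _ _ y])
        (use x b in \<open>auto intro: has_vector_derivative_within_subset[OF d]\<close>)
    moreover have "at x within {0..} \<inter> {b<..} = at x within {0..}"
      using x by (intro at_within_nhd[of x "{b<..}"]) auto
    ultimately have "((\<lambda>_. 0) has_vector_derivative g x) (at x within {0..})" by simp
    then show "g x = 0"
      using half_line_not_bot[of x] x b by (intro vector_derivative_unique_within[of x "{0..}" "\<lambda>_. 0"]) auto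
  qed
qed

text \<open>
  The fundamental theorem up to infinity: where the function vanishes on an open half-line, its
  almost everywhere derivative vanishes too, so that only a bounded interval contributes.
\<close>

lemma ac_deriv_compact_support_integral:
  assumes y: "ac_deriv y g" and b: "b > 0" "\<And>x. x \<ge> b \<Longrightarrow> y x = 0"
  shows "integrable half_line g" "(LINT x|half_line. g x) = - y 0"
proof -
  let ?g = "\<lambda>x. if x \<le> b then g x else 0"
  have "AE x in half_line. x > b \<longrightarrow> g x = 0"
    by (rule ac_deriv_eq_0_beyond[OF y]) (use b in auto)
  then have ae: "AE x in half_line. g x = ?g x"
    by eventually_elim auto
  have g: "g \<in> borel_measurable half_line" by (rule ac_deriv_measurable[OF y])
  note cut = half_line_integral_cut[OF ac_derivD(1)[OF y b(1)]]
  show "integrable half_line g"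
    using integrable_cong_AE[OF g borel_measurable_integrable[OF cut(1)] ae] cut(1) by simp
  have "(LINT x|half_line. g x) = (LINT x|half_line. ?g x)"
    by (rule integral_cong_AE[OF g borel_measurable_integrable[OF cut(1)] ae])
  also have "\<dots> = integral {0..b} g" by (rule cut(2))
  also have "\<dots> = - y 0" using ac_derivD(2)[OF y, of b] b by (simp add: integral_unique)
  finally show "(LINT x|half_line. g x) = - y 0" .
qed

lemma sq_integrable_dominated:
  assumes f: "sq_integrable f" and g: "g \<in> borel_measurable half_line"
    and le: "AE x in half_line. norm (g x) \<le> K * norm (f x)"
  shows "sq_integrable g"
  unfolding sq_integrable_def
proof
  have "integrable half_line (\<lambda>x. K\<^sup>2 * (norm (f x))\<^sup>2)" using f by (simp add: sq_integrable_def)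
  then show "integrable half_line (\<lambda>x. (norm (g x))\<^sup>2)"
  proof (rule Bochner_Integration.integrable_bound)
    show "AE x in half_line. norm ((norm (g x))\<^sup>2) \<le> norm (K\<^sup>2 * (norm (f x))\<^sup>2)"
      using le
    proof eventually_elim
      case (elim x)
      then have "(norm (g x))\<^sup>2 \<le> (K * norm (f x))\<^sup>2" by (intro power_mono) auto
      then show ?case by (simp add: power_mult_distrib)
    qed
  qed (use g in measurable)
qed (rule g)

lemma sq_integrable_compact_support:
  fixes y :: "real \<Rightarrow> complex^'n"
  assumes y: "continuous_on {0..} y" and b: "\<And>x. x > b \<Longrightarrow> y x = 0"
  shows "sq_integrable y"
proof -
  have "continuous_on {0..b} (\<lambda>x. (norm (y x))\<^sup>2)"
    by (intro continuous_intros continuous_on_subset[OF y]) auto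
  then have "integrable half_line (\<lambda>x. if x \<le> b then (norm (y x))\<^sup>2 else 0)"
    by (intro half_line_integral_cut absolutely_integrable_continuous_real)
  also have "(\<lambda>x. if x \<le> b then (norm (y x))\<^sup>2 else 0) = (\<lambda>x. (norm (y x))\<^sup>2)"
    using b by (auto simp: fun_eq_iff)
  finally show ?thesis
    using continuous_on_half_line_measurable[OF y] by (simp add: sq_integrable_def)
qed

section \<open>Defect spaces of the minimal operator\<close>

definition core :: "complex^'n^'n \<Rightarrow> (real \<Rightarrow> complex^'n^'n) \<Rightarrow> (real \<Rightarrow> complex^'n) set"
  where "core J Q = {y \<in> D_max_fun J Q. compact (closure {x\<in>{0..}. y x \<noteq> 0}) \<and> y 0 = 0}"

definition core_graph :: "complex^'n::finite^'n \<Rightarrow> (real \<Rightarrow> complex^'n^'n) \<Rightarrow> ('n l2 \<times> 'n l2) set"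
  where "core_graph J Q = (\<lambda>y. (abs_l2 y, abs_l2 (D_expr J Q y))) ` core J Q"

lemma D_min_eq_closure: "D_min J Q = closure (core_graph J Q)"
  by (simp add: D_min_def core_graph_def core_def)

lemma coreD:
  assumes "y \<in> core J Q"
  shows "ac_deriv y (\<lambda>x. vector_derivative y (at x within {0..}))" "sq_integrable y" "sq_integrable (D_expr J Q y)"
    "y 0 = 0" "\<exists>b>0. \<forall>x\<ge>b. y x = 0"
proof -
  show "ac_deriv y (\<lambda>x. vector_derivative y (at x within {0..}))"
    using assms by (intro AC_loc_imp_ac_deriv) (simp add: core_def D_max_fun_def)
  show "sq_integrable y" "sq_integrable (D_expr J Q y)" "y 0 = 0"
    using assms by (simp_all add: core_def D_max_fun_def)
  have "bounded {x\<in>{0..}. y x \<noteq> 0}"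
    using assms compact_imp_bounded bounded_subset closure_subset by (auto simp: core_def)
  then obtain B where B: "\<And>x. x \<ge> 0 \<Longrightarrow> y x \<noteq> 0 \<Longrightarrow> \<bar>x\<bar> \<le> B" by (auto simp: bounded_iff)
  then show "\<exists>b>0. \<forall>x\<ge>b. y x = 0"
  proof (intro exI[of _ "max B 0 + 1"] conjI allI impI)
    fix x assume x: "x \<ge> max B 0 + 1"
    show "y x = 0"
    proof (rule ccontr)
      assume "y x \<noteq> 0"
      then have "\<bar>x\<bar> \<le> B" using x by (intro B) auto
      then show False using x by simp
    qed
  qed simp
qed

lemma coreI:
  assumes "AC_loc y" "sq_integrable (D_expr J Q y)" "y 0 = 0" and b: "\<And>x. x > b \<Longrightarrow> y x = 0"
  shows "y \<in> core J Q"
proof -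
  have "closure {x\<in>{0..}. y x \<noteq> 0} \<subseteq> {0..b}"
  proof (rule closure_minimal)
    have "x \<le> b" if "y x \<noteq> 0" for x using b[of x] that by linarith
    then show "{x\<in>{0..}. y x \<noteq> 0} \<subseteq> {0..b}" by auto
  qed simp
  then have "{x\<in>{0..}. y x \<noteq> 0} \<subseteq> {0..b}"
    by (rule order_trans[OF closure_subset])
  then have "compact (closure {x\<in>{0..}. y x \<noteq> 0})"
    unfolding compact_closure by (rule bounded_subset[rotated]) simp
  moreover have "sq_integrable y"
    using assms by (intro sq_integrable_compact_support AC_loc_imp_continuous_on)
  ultimately show ?thesis using assms by (simp add: core_def D_max_fun_def)
qed

lemma l2_cases:
  obtains f where "x = abs_l2 f" "sq_integrable f"
proof -
  have "\<exists>f. x = abs_l2 f \<and> sq_integrable f"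
    by (induct x rule: l2.abs_induct) (auto simp: l2_rel_def)
  then show ?thesis using that by blast
qed

lemma abs_l2_eqI: "sq_integrable f \<Longrightarrow> sq_integrable g \<Longrightarrow> AE x in half_line. f x = g x \<Longrightarrow> abs_l2 f = abs_l2 g"
  by (rule Quotient3_rel_abs[OF Quotient3_l2]) (simp add: l2_rel_def)

lemma abs_l2_eq_iff: "sq_integrable f \<Longrightarrow> sq_integrable g \<Longrightarrow> abs_l2 f = abs_l2 g \<longleftrightarrow> (AE x in half_line. f x = g x)"
  using Quotient3_rel[OF Quotient3_l2, of f g] by (auto simp: l2_rel_def)

lemma cinner_abs_l2: "sq_integrable f \<Longrightarrow> sq_integrable g \<Longrightarrow> cinner (abs_l2 f) (abs_l2 g) = (LINT x|half_line. cdot (f x) (g x))"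
  by (rule cinner.abs_eq) (simp_all add: l2_rel_def)

lemma scaleC_abs_l2: "sq_integrable f \<Longrightarrow> scaleC c (abs_l2 f) = abs_l2 (\<lambda>x. c *s f x)"
  by (rule scaleC.abs_eq) (simp add: l2_rel_def)

lemma plus_abs_l2: "sq_integrable f \<Longrightarrow> sq_integrable g \<Longrightarrow> abs_l2 f + abs_l2 g = abs_l2 (\<lambda>x. f x + g x)"
  by (rule plus_l2.abs_eq) (simp_all add: l2_rel_def)

lemma cinner_eq_Complex_inner: "cinner f g = Complex (inner f g) (inner f (scaleC \<i> g))"
proof -
  have "cinner f (scaleC \<i> g) = - \<i> * cinner f g"
    by (subst cinner_commute, subst cinner_scaleC_left, subst (2) cinner_commute) simp
  then show ?thesis by (simp add: inner_l2_def complex_eq_iff)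
qed

lemma continuous_on_cinner_left: "continuous_on S f \<Longrightarrow> continuous_on S (\<lambda>x. cinner (f x) g)"
  unfolding cinner_eq_Complex_inner by (intro continuous_intros)

text \<open>
  For fixed \<open>(g, h)\<close> the equation that defines the adjoint is continuous in the pair \<open>(f, k)\<close>, so it
  passes to the closure. Adjoints of the minimal operator may thus be tested on the core.
\<close>

lemma adj_op_closure: "adj_op (closure T) = adj_op T"
proof
  show "adj_op (closure T) \<subseteq> adj_op T" using closure_subset by (fastforce simp: adj_op_def)
  show "adj_op T \<subseteq> adj_op (closure T)"
  proof clarify
    fix g h assume gh: "(g, h) \<in> adj_op T"
    let ?S = "{p. cinner (snd p) g = cinner (fst p) h}"
    have "closed ?S"
      by (intro closed_Collect_eq continuous_on_cinner_left continuous_intros)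
    moreover have "T \<subseteq> ?S" using gh by (auto simp: adj_op_def)
    ultimately have "closure T \<subseteq> ?S" by (rule closure_minimal[rotated])
    then show "(g, h) \<in> adj_op (closure T)" by (auto simp: adj_op_def)
  qed
qed

text \<open>
  As \<open>J J = - 1\<close>, the equation \<open>Z' = J K Z\<close> is \<open>J Z' + K Z = 0\<close> solved for \<open>Z'\<close>.
\<close>

lemma fundamental_matrix_exists:
  fixes J :: "complex^'n::finite^'n"
  assumes "L1_loc K"
  obtains Z where "Z 0 = mat 1" "ac_deriv Z (\<lambda>x. J ** K x ** Z x)"
proof -
  have "(\<lambda>x. J ** K x) absolutely_integrable_on {0..b}" if "b > 0" for b
    using L1_loc_linear[OF assms mm.bounded_linear_right] that by (simp add: L1_loc_def)
  from linear_ode_exists[OF bounded_bilinear_matrix_mult this] that show ?thesis by blast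
qed

lemma fundamental_matrix_solution:
  fixes J :: "complex^'n::finite^'n" and Z :: "real \<Rightarrow> complex^'n^'n"
  assumes "ac_deriv Z (\<lambda>x. J ** K x ** Z x)"
  shows "ac_deriv (\<lambda>x. Z x *v \<eta>) (\<lambda>x. J *v (K x *v (Z x *v \<eta>)))"
  using ac_deriv_linear[OF mv.bounded_linear_left assms, of \<eta>]
  by (simp add: matrix_vector_mul_assoc matrix_mul_assoc)

lemma symplectic_mult:
  fixes J A :: "complex^'n::finite^'n"
  assumes "J ** J = - mat 1"
  shows "J *v (J *v v) = - v" "J ** (J ** A) = - A"
  using assms by (simp_all add: matrix_vector_mul_assoc matrix_mul_assoc mv.minus_left mm.minus_left)

text \<open>
  The derivatives of the two factors cancel, so the product keeps its initial value \<open>J\<close>. In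
  particular both fundamental matrices are invertible everywhere.
\<close>

lemma fundamental_matrix_adjoint:
  fixes J :: "complex^'n::finite^'n"
  assumes J: "cadj J = - J" "J ** J = - mat 1"
    and Z: "Z 0 = mat 1" "ac_deriv Z (\<lambda>x. J ** K x ** Z x)"
    and U: "U 0 = mat 1" "ac_deriv U (\<lambda>x. J ** cadj (K x) ** U x)"
    and x: "x \<ge> 0"
  shows "cadj (U x) ** (J ** Z x) = J"
proof -
  have "cadj (U x) ** (J ** (J ** K x ** Z x)) + cadj (J ** cadj (K x) ** U x) ** (J ** Z x) = 0" for x
  proof -
    have "J ** (J ** K x ** Z x) = - (K x ** Z x)"
      using symplectic_mult(2)[OF J(2)] by (simp add: matrix_mul_assoc[symmetric])
    moreover have "cadj (J ** cadj (K x) ** U x) ** (J ** Z x) = - (cadj (U x) ** (K x ** (J ** (J ** Z x))))"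
      by (simp add: cadj_mult J(1) matrix_mul_assoc mm.minus_left mm.minus_right)
    ultimately show ?thesis
      using symplectic_mult(2)[OF J(2)] by (simp add: mm.minus_right)
  qed
  then have "ac_deriv (\<lambda>x. cadj (U x) ** (J ** Z x)) (\<lambda>x. 0)"
    using ac_deriv_product[OF bounded_bilinear_matrix_mult ac_deriv_linear[OF bounded_linear_cadj U(2)]
        ac_deriv_linear[OF mm.bounded_linear_right Z(2), of J]] by simp
  from ac_derivD(2)[OF this x] have "cadj (U x) ** (J ** Z x) = cadj (U 0) ** (J ** Z 0)"
    using has_integral_0_eq by force
  then show ?thesis using U(1) Z(1) by (simp add: cadj_mat)
qed

lemma cdot_symplectic:
  fixes J :: "complex^'n::finite^'n"
  assumes "cadj J = - J" "J ** J = - mat 1"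
  shows "cdot (J *v u) (J *v v) = cdot u v"
  by (simp add: cdot_adjoint assms(1) mv.minus_left symplectic_mult(1)[OF assms(2)])

text \<open>
  Lagrange's identity: the difference of the two integrands is the derivative of \<open>(J y, z)\<close>, which
  vanishes at \<open>0\<close> and beyond the support of \<open>y\<close>.
\<close>

lemma green_identity_core:
  fixes J :: "complex^'n::finite^'n"
  assumes J: "cadj J = - J" "J ** J = - mat 1"
    and y: "y \<in> core J (\<lambda>x. cadj (Q x))"
    and z: "ac_deriv z (\<lambda>x. J *v ((Q x - mat l) *v z x))" "sq_integrable z"
  shows "(LINT x|half_line. cdot (D_expr J (\<lambda>x. cadj (Q x)) y x) (z x)) = (LINT x|half_line. cdot (y x) (l *s z x))"
proof -
  let ?D = "D_expr J (\<lambda>x. cadj (Q x)) y" and ?y' = "\<lambda>x. vector_derivative y (at x within {0..})"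
  note y' = coreD[OF y]
  obtain b where b: "b > 0" "\<And>x. x \<ge> b \<Longrightarrow> y x = 0" using y'(5) by blast
  define w where "w = (\<lambda>x. cdot (J *v y x) (J *v ((Q x - mat l) *v z x)) + cdot (J *v ?y' x) (z x))"
  have W: "ac_deriv (\<lambda>x. cdot (J *v y x) (z x)) w"
    unfolding w_def by (intro ac_deriv_product bounded_bilinear_cdot z ac_deriv_linear[OF bounded_linear_matrix_vector_mult] y')
  have "w x = cdot (?D x) (z x) - cdot (y x) (l *s z x)" for x
  proof -
    have "cdot (J *v y x) (J *v ((Q x - mat l) *v z x)) = cdot (y x) ((Q x - mat l) *v z x)"
      by (rule cdot_symplectic[OF J])
    also have "\<dots> = cdot (cadj (Q x) *v y x) (z x) - cdot (y x) (l *s z x)"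
      by (simp add: matrix_vector_mult_diff_rdistrib mat_mult_vec cdot.diff_right cdot_adjoint)
    finally show ?thesis by (simp add: w_def D_expr_def cdot_add)
  qed
  then have "(LINT x|half_line. w x) = (LINT x|half_line. cdot (?D x) (z x)) - (LINT x|half_line. cdot (y x) (l *s z x))"
    using y' z(2) by (simp add: integrable_cdot sq_integrable_smult)
  moreover have "(LINT x|half_line. w x) = 0"
    using ac_deriv_compact_support_integral(2)[OF W b(1)] b(2) y'(4) by (simp add: mv.zero_right cdot.zero_left)
  ultimately show ?thesis by simp
qed

lemma matrix_function_bounded:
  fixes A :: "real \<Rightarrow> complex^'n::finite^'n"
  assumes "continuous_on {0..} A"
  obtains B where "\<And>x v. 0 \<le> x \<Longrightarrow> x \<le> b \<Longrightarrow> norm (A x *v v) \<le> B * norm v"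
proof -
  obtain K where K: "K > 0" "\<And>(M :: complex^'n^'n) v. norm (M *v v) \<le> norm M * norm v * K"
    using mv.pos_bounded by blast
  have "compact (A ` {0..b})"
    by (intro compact_continuous_image continuous_on_subset[OF assms]) auto
  then obtain M where M: "\<And>x. x \<in> {0..b} \<Longrightarrow> norm (A x) \<le> M"
    by (metis bounded_iff compact_imp_bounded imageI)
  show ?thesis
  proof (rule that[of "M * K"])
    fix x and v :: "complex^'n" assume "0 \<le> x" "x \<le> b"
    then have "norm (A x) * norm v * K \<le> M * norm v * K"
      using M[of x] K(1) by (intro mult_right_mono) auto
    then show "norm (A x *v v) \<le> M * K * norm v"
      using K(2)[of "A x" v] by (simp add: mult_ac)
  qed
qed

lemma sq_integrable_cut_integrable:
  assumes f: "sq_integrable f" and b: "\<And>x. x > b \<Longrightarrow> f x = 0"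
  shows "integrable half_line f"
proof -
  have "integrable half_line (\<lambda>x. if x \<le> b then 1::real else 0)"
    by (rule half_line_integral_cut) (intro absolutely_integrable_continuous_real continuous_intros)
  then have "integrable half_line (\<lambda>x. (if x \<le> b then 1::real else 0) + (norm (f x))\<^sup>2)"
    using f by (intro Bochner_Integration.integrable_add) (auto simp: sq_integrable_def)
  then show ?thesis
  proof (rule Bochner_Integration.integrable_bound)
    have "norm (f x) \<le> norm ((if x \<le> b then 1::real else 0) + (norm (f x))\<^sup>2)" for x
    proof (cases "x \<le> b")
      case True
      have "norm (f x) \<le> 1 + (norm (f x))\<^sup>2"
        using sum_squares_bound[of 1 "norm (f x)"] norm_ge_zero[of "f x"] unfolding one_power2 mult_1_right by linarith
      then show ?thesis using True by simp
    next
      case False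
      then have "f x = 0" using b[of x] by simp
      then show ?thesis by simp
    qed
    then show "AE x in half_line. norm (f x) \<le> norm ((if x \<le> b then 1::real else 0) + (norm (f x))\<^sup>2)"
      by simp
  qed (use f in \<open>simp add: sq_integrable_def\<close>)
qed

lemma D_expr_measurable:
  assumes "L1_loc Q" "AC_loc y"
  shows "D_expr J Q y \<in> borel_measurable half_line"
proof -
  have "D_expr J Q y = (\<lambda>x. J *v vector_derivative y (at x within {0..}) + Q x *v y x)"
    by (simp add: fun_eq_iff D_expr_def)
  moreover note ac = AC_loc_imp_ac_deriv[OF assms(2)]
  ultimately show ?thesis
    using measurable_bounded_linear[OF bounded_linear_matrix_vector_mult ac_deriv_measurable(2)[OF ac], of J]
      measurable_bilinear[OF bounded_bilinear_matrix_vector_mult L1_loc_measurable[OF assms(1)] ac_deriv_measurable(1)[OF ac]]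
    by simp
qed

lemma D_expr_AE:
  assumes "ac_deriv y y'"
  shows "AE x in half_line. D_expr J Q y x = J *v y' x + Q x *v y x"
  using ac_deriv_AE[OF assms] AE_space
proof eventually_elim
  fix x assume "(y has_vector_derivative y' x) (at x within {0..})" "x \<in> space half_line"
  then show "D_expr J Q y x = J *v y' x + Q x *v y x"
    using half_line_not_bot[of x] by (simp add: D_expr_def vector_derivative_within)
qed

text \<open>
  The argument of du Bois-Reymond in the frame of the adjoint fundamental matrix \<open>U\<close>. For a test
  function \<open>y = U \<phi>\<close> the weak equation reads \<open>(\<phi>', U\<^sup>* J f) = 0\<close>; taking for \<open>\<phi>'\<close> the function
  \<open>U\<^sup>* J f\<close> minus its mean over \<open>[0, b]\<close> makes \<open>\<phi>\<close> vanish at \<open>b\<close> and the left-hand side equal to the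
  squared norm of \<open>\<phi>'\<close>.
\<close>

lemma weak_solution_constant_on_interval:
  fixes J :: "complex^'n::finite^'n"
  assumes J: "cadj J = - J" "J ** J = - mat 1" and Q: "L1_loc Q"
    and U: "U 0 = mat 1" "ac_deriv U (\<lambda>x. J ** cadj (Q x - mat l) ** U x)"
    and f: "sq_integrable f" and b: "b > 0"
    and weak: "\<And>y. y \<in> core J (\<lambda>x. cadj (Q x)) \<Longrightarrow>
      (LINT x|half_line. cdot (D_expr J (\<lambda>x. cadj (Q x)) y x) (f x)) = (LINT x|half_line. cdot (y x) (l *s f x))"
  shows "\<exists>c. AE x in half_line. x \<le> b \<longrightarrow> cadj (U x) *v (J *v f x) = c"
proof -
  let ?Qs = "\<lambda>x. cadj (Q x)"
 have Ucont: "continuous_on {0..} U" by (rule ac_deriv_continuous_on[OF U(2)])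
  have Um: "U \<in> borel_measurable half_line" by (rule ac_deriv_measurable[OF U(2)])
  have fm: "f \<in> borel_measurable half_line" using f by (simp add: sq_integrable_def)
  define h where "h = (\<lambda>x. if x \<le> b then cadj (U x) *v (J *v f x) else 0)"
  have h0: "h x = 0" if "x > b" for x using that by (simp add: h_def)
  have h: "sq_integrable h"
  proof -
    have "continuous_on {0..} (\<lambda>x. cadj (U x) ** J)"
      using linear_continuous_on_compose[OF Ucont] bounded_linear_cadj
      by (intro continuous_intros mm.continuous_on) (auto simp: linear_conv_bounded_linear)
    then obtain B where B: "\<And>x v. 0 \<le> x \<Longrightarrow> x \<le> b \<Longrightarrow> norm ((cadj (U x) ** J) *v v) \<le> B * norm v"
      by (rule matrix_function_bounded[of _ b]) blast
    have B0: "0 \<le> B * norm v" for v :: "complex^'n" using order_trans[OF norm_ge_zero B[of 0 v]] b by simp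
    show ?thesis
    proof (rule sq_integrable_dominated[OF f, of _ B])
      have "(\<lambda>x. cadj (U x) *v (J *v f x)) \<in> borel_measurable half_line"
        by (intro measurable_bilinear[OF bounded_bilinear_matrix_vector_mult]
            measurable_bounded_linear[OF bounded_linear_cadj] measurable_bounded_linear[OF bounded_linear_matrix_vector_mult] Um fm)
      moreover have "{x \<in> space half_line. x \<le> b} \<in> sets half_line"
      proof -
        have "{x \<in> space half_line. x \<le> b} = {0..b}" by auto
        then show ?thesis by (simp add: sets_restrict_space_iff)
      qed
      ultimately show "h \<in> borel_measurable half_line"
        unfolding h_def by (intro measurable_If borel_measurable_const)
      show "AE x in half_line. norm (h x) \<le> B * norm (f x)"
        using B B0 by (intro AE_I2) (auto simp: h_def matrix_vector_mul_assoc)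
    qed
  qed
  define c where "c = (1 / b) *\<^sub>R (LINT x|half_line. h x)"
  define C where "C = (\<lambda>x::real. if x \<le> b then c else 0)"
  have C: "integrable half_line C" "(LINT x|half_line. C x) = b *\<^sub>R c" "sq_integrable C"
  proof -
    have "(\<lambda>x::real. c) absolutely_integrable_on {0..b}"
      by (intro absolutely_integrable_continuous_real continuous_intros)
    from half_line_integral_cut[OF this] show C1: "integrable half_line C" "(LINT x|half_line. C x) = b *\<^sub>R c"
      unfolding C_def using b by simp_all
    have "(\<lambda>x::real. (norm c)\<^sup>2) absolutely_integrable_on {0..b}"
      by (intro absolutely_integrable_continuous_real continuous_intros)
    from half_line_integral_cut(1)[OF this] have "integrable half_line (\<lambda>x. (norm (C x))\<^sup>2)"
      by (rule back_subst[of "integrable half_line"]) (auto simp: C_def)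
    then show "sq_integrable C" using C1(1) by (simp add: sq_integrable_def)
  qed
  \<comment> \<open>\<open>\<psi>\<close> has mean zero and vanishes beyond \<open>b\<close>, so its primitive \<open>\<phi>\<close> has compact support\<close>
  define \<psi> where "\<psi> = (\<lambda>x. h x - C x)"
  have \<psi>0: "\<psi> x = 0" if "x > b" for x using that by (simp add: \<psi>_def h_def C_def)
  have hint: "integrable half_line h" by (rule sq_integrable_cut_integrable[OF h h0])
  have \<psi>: "integrable half_line \<psi>" "(LINT x|half_line. \<psi> x) = 0"
    unfolding \<psi>_def using hint C b by (simp_all add: c_def)
  have "sq_integrable (\<lambda>x. h x + (-1) *s C x)" by (intro sq_integrable_add h sq_integrable_smult C)
  then have \<psi>sq: "sq_integrable \<psi>" by (simp add: \<psi>_def)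
  have \<psi>ac: "\<psi> absolutely_integrable_on {0..a}" for a
    using \<psi>(1) unfolding half_line_integrable_iff by (rule set_integrable_subset) auto
  define \<phi> where "\<phi> = (\<lambda>x. 0 + integral {0..x} \<psi>)"
  have \<phi>: "ac_deriv \<phi> \<psi>" unfolding \<phi>_def by (rule ac_deriv_integral[OF \<psi>ac])
  have \<phi>0: "\<phi> x = 0" if "x \<ge> b" for x
  proof -
    have "(\<lambda>t. if t \<le> x then \<psi> t else 0) = \<psi>" using that \<psi>0 by (auto simp: fun_eq_iff)
    then show ?thesis using half_line_integral_cut(2)[OF \<psi>ac, of x] \<psi>(2) by (simp add: \<phi>_def)
  qed
  define y where "y = (\<lambda>x. U x *v \<phi> x)"
  have y: "ac_deriv y (\<lambda>x. U x *v \<psi> x + (J ** cadj (Q x - mat l) ** U x) *v \<phi> x)"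
    unfolding y_def by (rule ac_deriv_product[OF bounded_bilinear_matrix_vector_mult U(2) \<phi>])
  let ?D = "D_expr J ?Qs y"
  define G where "G = (\<lambda>x. J *v (U x *v \<psi> x))"
  \<comment> \<open>the coefficient is absorbed by \<open>U\<close>; only the derivative of \<open>\<phi>\<close> and the spectral parameter remain\<close>
  have D: "AE x in half_line. ?D x = G x + cnj l *s y x"
    using D_expr_AE[OF y, of J "\<lambda>x. cadj (Q x)"]
  proof eventually_elim
    case (elim x)
    have "J *v ((J ** cadj (Q x - mat l) ** U x) *v \<phi> x) = - (cadj (Q x - mat l) *v y x)"
      by (simp add: y_def matrix_vector_mul_assoc[symmetric] symplectic_mult(1)[OF J(2)])
    also have "\<dots> = cnj l *s y x - cadj (Q x) *v y x"
      by (simp add: cadj_diff cadj_mat matrix_vector_mult_diff_rdistrib mat_mult_vec)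
    finally show ?case using elim by (simp add: G_def matrix_vector_right_distrib)
  qed
  have ysq: "sq_integrable y"
    using \<phi>0 by (intro sq_integrable_compact_support[of _ b] ac_deriv_continuous_on[OF y]) (simp add: y_def mv.zero_right)
  have G: "sq_integrable G"
  proof -
    have "continuous_on {0..} (\<lambda>x. J ** U x)"
      by (intro mm.continuous_on continuous_intros Ucont)
    then obtain B where B: "\<And>x v. 0 \<le> x \<Longrightarrow> x \<le> b \<Longrightarrow> norm ((J ** U x) *v v) \<le> B * norm v"
      by (rule matrix_function_bounded[of _ b]) blast
    show ?thesis
    proof (rule sq_integrable_dominated[OF \<psi>sq, of _ B])
      show "G \<in> borel_measurable half_line"
        unfolding G_def using \<psi>sq
        by (intro measurable_bounded_linear[OF bounded_linear_matrix_vector_mult] Um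
            measurable_bilinear[OF bounded_bilinear_matrix_vector_mult]) (simp_all add: sq_integrable_def)
      show "AE x in half_line. norm (G x) \<le> B * norm (\<psi> x)"
      proof (rule AE_I2)
        fix x assume "x \<in> space half_line"
        then show "norm (G x) \<le> B * norm (\<psi> x)"
          using B[of x "\<psi> x"] \<psi>0[of x] by (cases "x \<le> b") (auto simp: G_def matrix_vector_mul_assoc mv.zero_right)
      qed
    qed
  qed
  have Dsq: "sq_integrable ?D"
  proof (rule sq_integrable_dominated[OF sq_integrable_add[OF G sq_integrable_smult[OF ysq]]])
    show "?D \<in> borel_measurable half_line"
      by (intro D_expr_measurable L1_loc_cadj Q ac_deriv_imp_AC_loc[OF y])
    show "AE x in half_line. norm (?D x) \<le> 1 * norm (G x + cnj l *s y x)"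
      using D by eventually_elim simp
  qed
  have core: "y \<in> core J ?Qs"
    using Dsq \<phi>0 by (intro coreI[of _ _ _ b] ac_deriv_imp_AC_loc[OF y]) (auto simp: y_def \<phi>_def mv.zero_right)
  have "(LINT x|half_line. cdot (y x) (l *s f x)) = (LINT x|half_line. cdot (?D x) (f x))"
    using weak[OF core] by simp
  also have "\<dots> = (LINT x|half_line. cdot (G x) (f x) + cdot (y x) (l *s f x))"
  proof (rule integral_cong_AE)
    show "AE x in half_line. cdot (?D x) (f x) = cdot (G x) (f x) + cdot (y x) (l *s f x)"
      using D by eventually_elim (simp add: cdot_add cdot_smult)
  qed (use Dsq G ysq f in \<open>auto intro!: borel_measurable_add measurable_cdot sq_integrable_measurable sq_integrable_smult\<close>)
  also have "\<dots> = (LINT x|half_line. cdot (G x) (f x)) + (LINT x|half_line. cdot (y x) (l *s f x))"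
    by (intro Bochner_Integration.integral_add integrable_cdot sq_integrable_smult G ysq f)
  finally have "(LINT x|half_line. cdot (G x) (f x)) = 0" by simp
  moreover have "cdot (G x) (f x) = - cdot (\<psi> x) (h x)" for x
  proof (cases "x \<le> b")
    case True
    then show ?thesis
      by (simp add: G_def h_def cdot_adjoint J(1) mv.minus_left mv.minus_right cdot.minus_right)
  qed (simp add: \<psi>0 G_def mv.zero_right cdot.zero_left)
  ultimately have 1: "(LINT x|half_line. cdot (\<psi> x) (h x)) = 0" by simp
  have "cdot (\<psi> x) (C x) = cdot (\<psi> x) c" for x
    using \<psi>0[of x] by (cases "x \<le> b") (auto simp: C_def cdot.zero_left)
  then have "(LINT x|half_line. cdot (\<psi> x) (C x)) = cdot (LINT x|half_line. \<psi> x) c"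
    using integral_bounded_linear[OF cdot.bounded_linear_left \<psi>(1)] by simp
  then have 2: "(LINT x|half_line. cdot (\<psi> x) (C x)) = 0" using \<psi>(2) by (simp add: cdot.zero_left)
  have "(LINT x|half_line. cdot (\<psi> x) (\<psi> x)) = (LINT x|half_line. cdot (\<psi> x) (h x)) - (LINT x|half_line. cdot (\<psi> x) (C x))"
    unfolding \<psi>_def[abs_def] using integrable_cdot[OF \<psi>sq h] integrable_cdot[OF \<psi>sq C(3)]
    by (simp add: cdot.diff_right \<psi>_def)
  then have "(LINT x|half_line. cdot (\<psi> x) (\<psi> x)) = 0" using 1 2 by simp
  then have "(LINT x|half_line. (norm (\<psi> x))\<^sup>2) = 0"
    by (simp add: cdot_self del: of_real_power)
  then have "AE x in half_line. (norm (\<psi> x))\<^sup>2 = 0"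
    using \<psi>sq by (subst (asm) integral_nonneg_eq_0_iff_AE) (auto simp: sq_integrable_def)
  then have "AE x in half_line. x \<le> b \<longrightarrow> cadj (U x) *v (J *v f x) = c"
    by eventually_elim (auto simp: \<psi>_def h_def C_def)
  then show ?thesis by blast
qed

text \<open>
  Almost everywhere statements on \<open>[0, 1]\<close> that do not involve the point hold outright, since \<open>[0, 1]\<close>
  is not negligible.
\<close>

lemma AE_half_line_const:
  assumes "AE x in half_line. x \<le> 1 \<longrightarrow> P"
  shows P
proof (rule ccontr)
  assume "\<not> P"
  then have "negligible {0..1::real}"
    using assms unfolding AE_half_line_iff by (simp add: atLeastAtMost_def atLeast_def atMost_def Int_def)
  then show False using negligible_interval(1)[of "0::real" 1] by simp
qed

text \<open>
  One inclusion is Lagrange's identity. For the other, a weak solution satisfies \<open>U\<^sup>* J f = c\<close> almost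
  everywhere, with a constant that does not depend on the interval, and \<open>U\<^sup>* J Z = J\<close> allows to solve
  for \<open>f = - Z J c\<close>.
\<close>

theorem defect_space_D_min_adjoint:
  fixes J :: "complex^'n::finite^'n"
  assumes J: "cadj J = - J" "J ** J = - mat 1" and Q: "L1_loc Q"
    and Z: "Z 0 = mat 1" "ac_deriv Z (\<lambda>x. J ** (Q x - mat l) ** Z x)"
  shows "defect_space l (D_min J (\<lambda>x. cadj (Q x))) = {abs_l2 (\<lambda>x. Z x *v \<eta>) | \<eta>. sq_integrable (\<lambda>x. Z x *v \<eta>)}"
proof -
  let ?Qs = "\<lambda>x. cadj (Q x)"
  have defect: "abs_l2 f \<in> defect_space l (D_min J ?Qs) \<longleftrightarrow> (\<forall>y\<in>core J ?Qs.
      (LINT x|half_line. cdot (D_expr J ?Qs y x) (f x)) = (LINT x|half_line. cdot (y x) (l *s f x)))"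
    if "sq_integrable f" for f
  proof -
    have "abs_l2 f \<in> defect_space l (D_min J ?Qs) \<longleftrightarrow> (\<forall>y\<in>core J ?Qs.
      cinner (abs_l2 (D_expr J ?Qs y)) (abs_l2 f) = cinner (abs_l2 y) (scaleC l (abs_l2 f)))"
      by (simp add: defect_space_def D_min_eq_closure adj_op_closure) (simp add: adj_op_def core_graph_def)
    then show ?thesis
      using that by (simp add: scaleC_abs_l2 cinner_abs_l2 sq_integrable_smult coreD(2,3))
  qed
  show ?thesis
  proof (intro equalityI subsetI)
    fix F assume F: "F \<in> defect_space l (D_min J ?Qs)"
    obtain f where f: "F = abs_l2 f" "sq_integrable f" by (rule l2_cases)
    obtain U where U: "U 0 = mat 1" "ac_deriv U (\<lambda>x. J ** cadj (Q x - mat l) ** U x)"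
      by (rule fundamental_matrix_exists[where J=J, OF L1_loc_cadj[OF L1_loc_diff_mat[OF Q]]])
    have "\<forall>n. \<exists>c. AE x in half_line. x \<le> real (Suc n) \<longrightarrow> cadj (U x) *v (J *v f x) = c"
    proof
      fix n
      show "\<exists>c. AE x in half_line. x \<le> real (Suc n) \<longrightarrow> cadj (U x) *v (J *v f x) = c"
        using defect[OF f(2)] F f(1) by (intro weak_solution_constant_on_interval[OF J Q U f(2)]) auto
    qed
    from choice[OF this] obtain c
      where c: "\<And>n. AE x in half_line. x \<le> real (Suc n) \<longrightarrow> cadj (U x) *v (J *v f x) = c n"
      by blast
    have c0: "c n = c 0" for n
    proof (rule AE_half_line_const)
      show "AE x in half_line. x \<le> 1 \<longrightarrow> c n = c 0"
        using c[of n] c[of 0] by eventually_elim auto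
    qed
    have "AE x in half_line. \<forall>n. x \<le> real (Suc n) \<longrightarrow> cadj (U x) *v (J *v f x) = c 0"
      unfolding AE_all_countable 
    proof
      fix n
      show "AE x in half_line. x \<le> real (Suc n) \<longrightarrow> cadj (U x) *v (J *v f x) = c 0"
        using c[of n] unfolding c0[of n] .
    qed
    then have "AE x in half_line. f x = Z x *v - (J *v c 0)"
      using AE_space
    proof eventually_elim
      fix x assume x: "\<forall>n. x \<le> real (Suc n) \<longrightarrow> cadj (U x) *v (J *v f x) = c 0" "x \<in> space half_line"
      obtain n where "x \<le> real n" using real_arch_simple by blast
      then have "x \<le> real (Suc n)" by simp
      then have eq: "cadj (U x) *v (J *v f x) = c 0" using x by blast
      have "cadj (U x) ** (J ** Z x) = J"
        using x by (intro fundamental_matrix_adjoint[OF J Z U]) auto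
      then have "cadj (U x) ** (- (J ** Z x ** J)) = mat 1"
        using J(2) by (simp add: mm.minus_right matrix_mul_assoc)
      \<comment> \<open>a one-sided inverse of a square matrix is two-sided\<close>
      then have "(- (J ** Z x ** J)) ** cadj (U x) = mat 1"
        by (rule matrix_left_right_inverse1)
      then have "J *v f x = (- (J ** Z x ** J)) *v c 0"
        using matrix_vector_mul_assoc[of "- (J ** Z x ** J)" "cadj (U x)" "J *v f x"] eq by simp
      then have "J *v f x = J *v (Z x *v - (J *v c 0))"
        by (simp add: mv.minus_left mv.minus_right matrix_vector_mul_assoc matrix_mul_assoc)
      then have "J *v (J *v f x) = J *v (J *v (Z x *v - (J *v c 0)))" by simp
      then show "f x = Z x *v - (J *v c 0)" by (simp only: symplectic_mult(1)[OF J(2)] neg_equal_iff_equal)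
    qed
    moreover have "sq_integrable (\<lambda>x. Z x *v - (J *v c 0))"
    proof (rule sq_integrable_dominated[OF f(2)])
      show "(\<lambda>x. Z x *v - (J *v c 0)) \<in> borel_measurable half_line"
        by (intro measurable_bounded_linear[OF mv.bounded_linear_left] ac_deriv_measurable[OF Z(2)])
      show "AE x in half_line. norm (Z x *v - (J *v c 0)) \<le> 1 * norm (f x)"
        using calculation by eventually_elim simp
    qed
    ultimately show "F \<in> {abs_l2 (\<lambda>x. Z x *v \<eta>) | \<eta>. sq_integrable (\<lambda>x. Z x *v \<eta>)}"
      using f abs_l2_eqI by blast
  next
    fix F assume "F \<in> {abs_l2 (\<lambda>x. Z x *v \<eta>) | \<eta>. sq_integrable (\<lambda>x. Z x *v \<eta>)}"
    then obtain \<eta> where \<eta>: "F = abs_l2 (\<lambda>x. Z x *v \<eta>)" "sq_integrable (\<lambda>x. Z x *v \<eta>)" by blast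
    note fundamental_matrix_solution[OF Z(2)]
    then show "F \<in> defect_space l (D_min J ?Qs)"
      using green_identity_core[OF J] \<eta> defect by blast
  qed
qed

section \<open>The dimension of the space of square integrable solutions\<close>

lemma vec_complement_exists:
  fixes L :: "(complex^'n::finite) set"
  assumes L: "vec.subspace L"
  obtains W where "vec.subspace W" "L \<inter> W = {0}" "vec.dim L + vec.dim W = CARD('n)"
proof -
  obtain B where B: "B \<subseteq> L" "vec.independent B" "L \<subseteq> vec.span B" "card B = vec.dim L"
    using vec.basis_exists by blast
  let ?E = "vec.extend_basis B"
  have E: "B \<subseteq> ?E" "vec.independent ?E" "vec.span ?E = UNIV"
    using vec.extend_basis_superset[OF B(2)] vec.independent_extend_basis[OF B(2)] vec.span_extend_basis[OF B(2)] by auto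
  have spanB: "vec.span B = L" using B L by (metis subset_antisym vec.span_minimal)
  let ?W = "vec.span (?E - B)"
  have fin: "finite ?E" using E(2) by (rule vec.finiteI_independent)
  have "card ?E = vec.dim (UNIV :: (complex^'n) set)"
    by (rule vec.dim_eq_card[symmetric]) (use E in simp_all)
  also have "\<dots> = CARD('n)" by (rule vec_dim_card)
  finally have dimW: "vec.dim L + vec.dim ?W = CARD('n)"
    using vec.dim_span_eq_card_independent[OF vec.independent_mono[OF E(2), of "?E - B"]] B(4) E(1) fin
      dim_subset_UNIV_cart_gen[of L]
    by (simp add: card_Diff_subset finite_subset card_mono)
  have "{x + y |x y. x \<in> L \<and> y \<in> ?W} = vec.span (B \<union> (?E - B))"
    unfolding vec.span_Un spanB by blast
  also have "\<dots> = UNIV" using E by (simp add: Un_absorb1)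
  finally have "vec.dim (L \<inter> ?W) = 0"
    using vec.dim_sums_Int[OF L vec.subspace_span[of "?E - B"]] dimW vec_dim_card[where 'a=complex and 'n='n] by simp
  then have "L \<inter> ?W = {0}" using L vec.subspace_0[OF L] vec.span_zero by auto
  then show ?thesis using that dimW vec.subspace_span by blast
qed

lemma matrix_kernel_meets_subspace:
  fixes A :: "complex^'n::finite^'n"
  assumes W: "vec.subspace W" and N: "\<And>v. v \<in> W \<Longrightarrow> A *v v \<in> N" and less: "vec.dim N < vec.dim W"
  obtains v where "v \<in> W" "v \<noteq> 0" "A *v v = 0"
proof -
  have "\<exists>v\<in>W. v \<noteq> 0 \<and> A *v v = 0"
  proof (rule ccontr)
    assume *: "\<not> ?thesis"
    have "inj_on ((*v) A) (vec.span W)"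
    proof (rule inj_onI)
      fix u v assume "u \<in> vec.span W" "v \<in> vec.span W" "A *v u = A *v v"
      then have "u - v \<in> W" "A *v (u - v) = 0"
        using vec.subspace_diff[OF W, of u v] by (simp_all add: vec.span_eq_iff[THEN iffD2, OF W] matrix_vector_mult_diff_distrib)
      then show "u = v" using * by auto
    qed
    then have "vec.dim ((*v) A ` W) = vec.dim W"
      by (rule vec.dim_image_eq[OF matrix_vector_mul_linear_gen])
    moreover have "vec.dim ((*v) A ` W) \<le> vec.dim N" using N by (intro vec.dim_subset) auto
    ultimately show False using less by simp
  qed
  then show ?thesis using that by blast
qed

lemma matrix_kernel_subspace: "vec.subspace {v. (A :: complex^'n::finite^'n) *v v = 0}"
  by (rule vec.subspaceI) (auto simp: matrix_vector_right_distrib mv.zero_right vector_scalar_commute)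

lemma eigen_iff:
  "v \<in> {v. (J + mat c) *v v = 0} \<longleftrightarrow> J *v v = - c *s v" "v \<in> {v. (J - mat c) *v v = 0} \<longleftrightarrow> J *v v = c *s v"
  for J :: "complex^'n::finite^'n"
  by (auto simp: matrix_vector_mult_add_rdistrib matrix_vector_mult_diff_rdistrib mat_mult_vec eq_neg_iff_add_eq_0)

text \<open>
  The projections \<open>(1 \<plusminus> \<i> J)/2\<close> split every vector into eigenvectors of \<open>J\<close> for \<open>- \<i>\<close> and \<open>\<i>\<close>.
\<close>

lemma kappa_sum:
  fixes J :: "complex^'n::finite^'n"
  assumes J: "J ** J = - mat 1"
  shows "kappa_plus J + kappa_minus J = CARD('n)"
proof -
  let ?P = "{v. (J + mat \<i>) *v v = 0}" and ?N = "{v. (J - mat \<i>) *v v = 0}"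
  have "v \<in> {x + y |x y. x \<in> ?P \<and> y \<in> ?N}" for v
  proof -
    let ?x = "(1/2) *s (v + \<i> *s (J *v v))" and ?y = "(1/2) *s (v - \<i> *s (J *v v))"
    have "J *v ?x = - \<i> *s ?x" "J *v ?y = \<i> *s ?y"
      by (simp_all add: vector_scalar_commute matrix_vector_right_distrib matrix_vector_mult_diff_distrib
          symplectic_mult(1)[OF J] vec_eq_iff algebra_simps)
    then have "?x \<in> ?P" "?y \<in> ?N" unfolding eigen_iff by auto
    moreover have "v = ?x + ?y" by (simp add: vec_eq_iff algebra_simps)
    ultimately show ?thesis by blast
  qed
  then have all: "{x + y |x y. x \<in> ?P \<and> y \<in> ?N} = UNIV" by blast
  have "?P \<inter> ?N \<subseteq> {0}"
  proof
    fix v assume "v \<in> ?P \<inter> ?N"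
    then have "J *v v = - \<i> *s v" "J *v v = \<i> *s v" unfolding Int_iff eigen_iff by auto
    then show "v \<in> {0}" by (auto simp: vec_eq_iff)
  qed
  then have "vec.dim (?P \<inter> ?N) = 0" by simp
  then show ?thesis
    using vec.dim_sums_Int[OF matrix_kernel_subspace matrix_kernel_subspace, of "J + mat \<i>" "J - mat \<i>"]
    unfolding all vec_dim_card kappa_plus_def kappa_minus_def by linarith
qed

lemma norm_symplectic:
  fixes J :: "complex^'n::finite^'n"
  assumes J: "cadj J = - J" "J ** J = - mat 1"
  shows "norm (J *v v) = norm v"
proof -
  have "(norm (J *v v))\<^sup>2 = (norm v)\<^sup>2"
    using cdot_symplectic[OF J, of v v] unfolding cdot_self of_real_eq_iff .
  then show ?thesis by simp
qed

text \<open>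
  The quadratic form that appears in Lagrange's identity; \<open>(J v, v)\<close> is purely imaginary when \<open>J\<close> is
  skew.
\<close>

definition boundary_form :: "complex^'n^'n \<Rightarrow> complex^'n \<Rightarrow> real"
  where "boundary_form J v = Im (cdot (J *v v) v)"

lemma boundary_form_bound:
  fixes J :: "complex^'n::finite^'n"
  assumes J: "cadj J = - J" "J ** J = - mat 1"
  shows "boundary_form J v \<le> (norm v)\<^sup>2"
proof -
  have "boundary_form J v \<le> cmod (cdot (J *v v) v)" unfolding boundary_form_def using abs_Im_le_cmod abs_le_D1 by blast
  also have "\<dots> \<le> (norm v)\<^sup>2" using cdot_bound[of "J *v v" v] norm_symplectic[OF J, of v] by (simp add: power2_eq_square)
  finally show ?thesis .
qed

lemma boundary_form_eigen:
  "J *v v = \<i> *s v \<Longrightarrow> boundary_form J v = (norm v)\<^sup>2"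
  "J *v v = - \<i> *s v \<Longrightarrow> boundary_form J v = - (norm v)\<^sup>2"
  by (simp_all add: boundary_form_def cdot_smult cdot.minus_left cdot_self del: of_real_power)

lemma continuous_on_boundary_form:
  fixes J :: "complex^'n::finite^'n"
  shows "continuous_on S f \<Longrightarrow> continuous_on S (\<lambda>x. boundary_form J (f x))"
  unfolding boundary_form_def by (intro continuous_intros cdot.continuous_on mv.continuous_on)

lemma has_integral_le_AE:
  fixes f g :: "real \<Rightarrow> real"
  assumes f: "(f has_integral i) S" and g: "(g has_integral j) S" and N: "negligible N"
    and le: "\<And>x. x \<in> S - N \<Longrightarrow> f x \<le> g x"
  shows "i \<le> j"
proof (rule has_integral_le)
  show "((\<lambda>x. if x \<in> N then g x else f x) has_integral i) S"
    by (rule has_integral_spike[OF N _ f]) simp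
  show "(g has_integral j) S" by fact
qed (use le in auto)

context
  fixes J :: "complex^'n::finite^'n" and Q Z :: "real \<Rightarrow> complex^'n^'n" and l :: complex and \<beta> :: real
  assumes J: "cadj J = - J" "J ** J = - mat 1"
    and Z: "Z 0 = mat 1" "ac_deriv Z (\<lambda>x. J ** (Q x - mat l) ** Z x)"
    and Im_le: "AE x in half_line. \<forall>h. Im (cdot (Q x *v h) h) \<le> \<beta> * (norm h)\<^sup>2"
    and l: "Im l > \<beta>"
begin

lemma solution_continuous: "continuous_on {0..} (\<lambda>x. Z x *v \<eta>)"
  by (intro mv.continuous_on ac_deriv_continuous_on[OF Z(2)] continuous_intros)

lemma solution_norm_integrable: "0 \<le> a \<Longrightarrow> (\<lambda>x. (norm (Z x *v \<eta>))\<^sup>2) integrable_on {a..b}"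
  by (intro integrable_continuous_real continuous_intros continuous_on_subset[OF solution_continuous]) auto

text \<open>
  The derivative of the boundary form along a solution is \<open>2 (Im l |z|\<^sup>2 - Im (Q z, z))\<close>.
\<close>

lemma boundary_form_growth:
  assumes "0 \<le> a" "a \<le> b"
  shows "2 * (Im l - \<beta>) * integral {a..b} (\<lambda>x. (norm (Z x *v \<eta>))\<^sup>2)
    \<le> boundary_form J (Z b *v \<eta>) - boundary_form J (Z a *v \<eta>)"
proof -
  let ?z = "\<lambda>x. Z x *v \<eta>" and ?z' = "\<lambda>x. J *v ((Q x - mat l) *v (Z x *v \<eta>))"
  have z: "ac_deriv ?z ?z'"
    by (rule fundamental_matrix_solution[OF Z(2)])
  let ?w = "\<lambda>x. Im (cdot (J *v ?z x) (?z' x) + cdot (J *v ?z' x) (?z x))"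
  have W: "ac_deriv (\<lambda>x. boundary_form J (?z x)) ?w"
    unfolding boundary_form_def
    by (intro ac_deriv_linear[OF bounded_linear_Im] ac_deriv_product[OF bounded_bilinear_cdot]
        ac_deriv_linear[OF bounded_linear_matrix_vector_mult] z)
  have w: "?w x = 2 * (Im l * (norm (?z x))\<^sup>2 - Im (cdot (Q x *v ?z x) (?z x)))" for x
  proof -
    let ?a = "cdot ((Q x - mat l) *v ?z x) (?z x)"
    have "cdot (J *v ?z x) (?z' x) = cdot (?z x) ((Q x - mat l) *v ?z x)"
      by (rule cdot_symplectic[OF J])
    also have "\<dots> = cnj ?a" by (rule cdot_commute)
    finally have 1: "cdot (J *v ?z x) (?z' x) = cnj ?a" .
    have 2: "cdot (J *v ?z' x) (?z x) = - ?a"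
      by (simp only: symplectic_mult(1)[OF J(2)] cdot.minus_left)
    have 3: "?a = cdot (Q x *v ?z x) (?z x) - l * of_real ((norm (?z x))\<^sup>2)"
      by (simp add: matrix_vector_mult_diff_rdistrib mat_mult_vec cdot.diff_left cdot_smult cdot_self del: of_real_power)
    show ?thesis unfolding 1 2 unfolding 3 by (simp del: of_real_power)
  qed
  let ?N = "{x. 0 \<le> x \<and> \<not> (\<forall>h. Im (cdot (Q x *v h) h) \<le> \<beta> * (norm h)\<^sup>2)}"
  have N: "negligible ?N" using Im_le unfolding AE_half_line_iff .
  have 1: "((\<lambda>x. 2 * (Im l - \<beta>) * (norm (?z x))\<^sup>2) has_integral
      2 * (Im l - \<beta>) * integral {a..b} (\<lambda>x. (norm (?z x))\<^sup>2)) {a..b}"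
    using solution_norm_integrable[OF assms(1)] by (intro has_integral_mult_right integrable_integral)
  show ?thesis
  proof (rule has_integral_le_AE[OF 1 ac_deriv_diff[OF W assms] N])
    fix x assume "x \<in> {a..b} - ?N"
    then have "Im (cdot (Q x *v ?z x) (?z x)) \<le> \<beta> * (norm (?z x))\<^sup>2" using assms by auto
    then show "2 * (Im l - \<beta>) * (norm (?z x))\<^sup>2 \<le> ?w x" unfolding w by (simp add: algebra_simps)
  qed
qed

lemma boundary_form_mono:
  assumes "0 \<le> a" "a \<le> b"
  shows "boundary_form J (Z a *v \<eta>) \<le> boundary_form J (Z b *v \<eta>)"
proof -
  have "0 \<le> integral {a..b} (\<lambda>x. (norm (Z x *v \<eta>))\<^sup>2)"
    by (intro Henstock_Kurzweil_Integration.integral_nonneg solution_norm_integrable assms) auto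
  then have "0 \<le> 2 * (Im l - \<beta>) * integral {a..b} (\<lambda>x. (norm (Z x *v \<eta>))\<^sup>2)" using l by simp
  then show ?thesis using boundary_form_growth[OF assms, of \<eta>] by linarith
qed

text \<open>
  A positive value of the boundary form would persist by monotonicity and bound \<open>|z|\<^sup>2\<close> from below on
  a half-line.
\<close>

lemma sq_integrable_imp_boundary_form_nonpos:
  assumes z: "sq_integrable (\<lambda>x. Z x *v \<eta>)" and x: "x \<ge> 0"
  shows "boundary_form J (Z x *v \<eta>) \<le> 0"
proof (rule ccontr)
  define w where "w = boundary_form J (Z x *v \<eta>)"
  assume "\<not> ?thesis"
  then have w: "w > 0" by (simp add: w_def)
  let ?n = "\<lambda>x. (norm (Z x *v \<eta>))\<^sup>2"
  have n: "?n integrable_on {0..}"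
    using z unfolding sq_integrable_def half_line_integrable_iff by (auto intro: set_lebesgue_integral_eq_integral(1))
  \<comment> \<open>so far out that \<open>(b - x) w\<close> exceeds the whole integral\<close>
  define b where "b = x + integral {0..} ?n / w + 1"
  have I: "0 \<le> integral {0..} ?n" by (intro Henstock_Kurzweil_Integration.integral_nonneg n) auto
  have b: "x \<le> b" using I w by (simp add: b_def add_nonneg_pos less_imp_le)
  have "(b - x) * w = integral {x..b} (\<lambda>_. w)" using b by simp
  also have "\<dots> \<le> integral {x..b} ?n"
  proof (rule integral_le)
    fix t assume t: "t \<in> {x..b}"
    show "w \<le> ?n t"
      using boundary_form_mono[of x t \<eta>] x t boundary_form_bound[OF J, of "Z t *v \<eta>"] by (simp add: w_def)
  qed (use solution_norm_integrable x in auto)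
  also have "\<dots> \<le> integral {0..} ?n"
    by (rule integral_subset_le) (use x n solution_norm_integrable[OF x] in auto)
  finally have "(b - x) * w \<le> integral {0..} ?n" .
  moreover have "(b - x) * w = integral {0..} ?n + w" using w by (simp add: b_def field_simps)
  ultimately show False using w by linarith
qed

lemma boundary_form_nonpos_imp_sq_integrable:
  assumes w: "\<And>x. x \<ge> 0 \<Longrightarrow> boundary_form J (Z x *v \<eta>) \<le> 0"
  shows "sq_integrable (\<lambda>x. Z x *v \<eta>)"
proof -
  let ?n = "\<lambda>x. (norm (Z x *v \<eta>))\<^sup>2"
  let ?f = "\<lambda>k x. if x \<in> {..real k} then ?n x else 0"
  define B where "B = - boundary_form J (Z 0 *v \<eta>) / (2 * (Im l - \<beta>))"
  have I: "integral {0..real k} ?n \<le> B" for k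
  proof -
    have "2 * (Im l - \<beta>) * integral {0..real k} ?n \<le> - boundary_form J (Z 0 *v \<eta>)"
      using boundary_form_growth[of 0 "real k" \<eta>] w[of "real k"] by simp
    then show ?thesis using l by (simp add: B_def field_simps)
  qed
  have "?n integrable_on {0..}"
  proof (rule conjunct1[OF monotone_convergence_increasing[where f="?f"]])
    have cap: "{..real k} \<inter> {0..} = {0..real k}" for k by auto
    show int: "?f k integrable_on {0..}" for k
      using solution_norm_integrable[of 0 \<eta> "real k"] by (simp only: integrable_restrict_Int cap) 
    show "?f k x \<le> ?f (Suc k) x" for k x by auto
    show "(\<lambda>k. ?f k x) \<longlonglongrightarrow> ?n x" for x
      by (intro tendsto_eventually eventually_mono[OF eventually_le_real[of x]]) auto
    have "integral {0..} (?f k) = integral {0..real k} ?n" for k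
      by (simp only: Henstock_Kurzweil_Integration.integral_restrict_Int cap)
    moreover have "0 \<le> integral {0..real k} ?n" for k
      by (intro Henstock_Kurzweil_Integration.integral_nonneg solution_norm_integrable) auto
    ultimately show "bounded (range (\<lambda>k. integral {0..} (?f k)))"
      using I by (intro boundedI[of _ B]) auto
  qed
  then have "integrable half_line ?n"
    unfolding half_line_integrable_iff by (rule nonnegative_absolutely_integrable_1) auto
  then show ?thesis
    using continuous_on_half_line_measurable[OF solution_continuous] by (simp add: sq_integrable_def)
qed

lemma solution_norm_integral_pos:
  assumes "\<eta> \<noteq> 0"
  shows "0 < integral {0..1} (\<lambda>x. (norm (Z x *v \<eta>))\<^sup>2)"
proof -
  let ?n = "\<lambda>x. (norm (Z x *v \<eta>))\<^sup>2"
  have "continuous_on {0..1} ?n"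
    by (intro continuous_intros continuous_on_subset[OF solution_continuous]) auto
  then have "integral (cbox 0 1) ?n = 0 \<longleftrightarrow> (\<forall>x\<in>cbox 0 1. ?n x = 0)"
    by (intro integral_cbox_eq_0_iff) auto
  moreover have "?n 0 \<noteq> 0" using assms Z(1) by simp
  moreover have "0 \<le> integral {0..1} ?n"
    by (intro Henstock_Kurzweil_Integration.integral_nonneg solution_norm_integrable) auto
  ultimately show ?thesis by force
qed

text \<open>
  On \<open>[0, 1]\<close> the form increases by a positive amount and ends at a value that is at most \<open>0\<close>.
\<close>

lemma sq_integrable_imp_boundary_form_neg:
  assumes "sq_integrable (\<lambda>x. Z x *v \<eta>)" "\<eta> \<noteq> 0"
  shows "boundary_form J \<eta> < 0"
proof -
  have "0 < 2 * (Im l - \<beta>) * integral {0..1} (\<lambda>x. (norm (Z x *v \<eta>))\<^sup>2)"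
    using solution_norm_integral_pos[OF assms(2)] l by simp
  then show ?thesis
    using boundary_form_growth[of 0 1 \<eta>] sq_integrable_imp_boundary_form_nonpos[OF assms(1), of 1] Z(1) by simp
qed

lemma sq_integrable_solutions_subspace: "vec.subspace {\<eta>. sq_integrable (\<lambda>x. Z x *v \<eta>)}"
  by (rule vec.subspaceI)
    (auto simp: mv.zero_right matrix_vector_right_distrib vector_scalar_commute sq_integrable_add sq_integrable_smult)

text \<open>
  Upper bound: on \<open>ker (J - \<i>)\<close> the form is nonnegative, on the initial values of square integrable
  solutions it is negative. Lower bound: if the space were too small, each \<open>N\<close> would allow a unit
  vector in a fixed complement \<open>W\<close> whose solution lies in \<open>ker (J + \<i>)\<close> at \<open>N\<close>; a limit of these
  vectors would be the initial value of a square integrable solution.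
\<close>

theorem dim_sq_integrable_solutions: "vec.dim {\<eta>. sq_integrable (\<lambda>x. Z x *v \<eta>)} = kappa_plus J"
proof (rule antisym)
  let ?L = "{\<eta>. sq_integrable (\<lambda>x. Z x *v \<eta>)}" and ?N = "{v. (J - mat \<i>) *v v = 0}"
  have "?L \<inter> ?N \<subseteq> {0}"
  proof
    fix \<eta> assume \<eta>: "\<eta> \<in> ?L \<inter> ?N"
    then have "boundary_form J \<eta> = (norm \<eta>)\<^sup>2" unfolding Int_iff eigen_iff by (intro boundary_form_eigen) auto
    then show "\<eta> \<in> {0}" using sq_integrable_imp_boundary_form_neg[of \<eta>] \<eta> by force
  qed
  then have "vec.dim (?L \<inter> ?N) = 0" by simp
  then have "vec.dim ?L + kappa_minus J \<le> CARD('n)"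
    using vec.dim_sums_Int[OF sq_integrable_solutions_subspace matrix_kernel_subspace, of "J - mat \<i>"]
      dim_subset_UNIV_cart_gen[of "{x + y |x y. x \<in> ?L \<and> y \<in> ?N}"]
    unfolding kappa_minus_def by linarith
  then show "vec.dim ?L \<le> kappa_plus J" using kappa_sum[OF J(2)] by simp
  show "kappa_plus J \<le> vec.dim ?L"
  proof (rule ccontr)
    assume less: "\<not> kappa_plus J \<le> vec.dim ?L"
    obtain W where W: "vec.subspace W" "?L \<inter> W = {0}" "vec.dim ?L + vec.dim W = CARD('n)"
      using vec_complement_exists[OF sq_integrable_solutions_subspace] by blast
    have dimN: "vec.dim ?N < vec.dim W"
      using less W(3) kappa_sum[OF J(2)] by (simp add: kappa_minus_def)
    have "\<forall>k. \<exists>\<eta>. \<eta> \<in> W \<and> norm \<eta> = 1 \<and> (\<forall>x\<in>{0..real k}. boundary_form J (Z x *v \<eta>) \<le> 0)"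
    proof
      fix k
      \<comment> \<open>\<open>(J - \<i>) (J + \<i>) = 0\<close>, so \<open>(J + \<i>) Z\<close> maps \<open>W\<close> into the smaller space \<open>ker (J - \<i>)\<close> and has a kernel there\<close>
      have "(J - mat \<i>) *v (((J + mat \<i>) ** Z (real k)) *v v) = 0" for v
        by (simp add: matrix_vector_mul_assoc[symmetric] matrix_vector_mult_add_rdistrib matrix_vector_mult_diff_rdistrib
            matrix_vector_right_distrib mat_mult_vec symplectic_mult(1)[OF J(2)] vector_scalar_commute)
      then obtain v where v: "v \<in> W" "v \<noteq> 0" "((J + mat \<i>) ** Z (real k)) *v v = 0"
        using matrix_kernel_meets_subspace[OF W(1) _ dimN, of "(J + mat \<i>) ** Z (real k)"] by auto
      define \<eta> where "\<eta> = complex_of_real (1 / norm v) *s v"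
      have \<eta>: "\<eta> \<in> W" "norm \<eta> = 1" using v W(1) by (simp_all add: \<eta>_def vec.subspace_scale norm_vector_smult norm_divide)
      have "((J + mat \<i>) ** Z (real k)) *v \<eta> = 0" using v(3) by (simp add: \<eta>_def vector_scalar_commute)
      then have "Z (real k) *v \<eta> \<in> {v. (J + mat \<i>) *v v = 0}" by (simp add: matrix_vector_mul_assoc)
      then have "boundary_form J (Z (real k) *v \<eta>) = - (norm (Z (real k) *v \<eta>))\<^sup>2"
        unfolding eigen_iff by (rule boundary_form_eigen)
      then have "boundary_form J (Z x *v \<eta>) \<le> 0" if "x \<in> {0..real k}" for x
        using boundary_form_mono[of x "real k" \<eta>] that by (auto intro: order_trans)
      then show "\<exists>\<eta>. \<eta> \<in> W \<and> norm \<eta> = 1 \<and> (\<forall>x\<in>{0..real k}. boundary_form J (Z x *v \<eta>) \<le> 0)"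
        using \<eta> by blast
    qed
    from choice[OF this] obtain v where v: "\<And>k. v k \<in> W" "\<And>k. norm (v k) = 1"
        "\<And>k x. x \<in> {0..real k} \<Longrightarrow> boundary_form J (Z x *v v k) \<le> 0"
      by blast
    have "compact (sphere (0 :: complex^'n) 1)" by simp
    moreover have "\<forall>k. v k \<in> sphere 0 1" using v(2) by simp
    ultimately obtain \<eta> r where \<eta>: "\<eta> \<in> sphere 0 1" "strict_mono r" "(v \<circ> r) \<longlonglongrightarrow> \<eta>"
      unfolding compact_def by meson
    have "subspace W" using W(1)
      by (auto simp: subspace_def vec.subspace_def scaleR_eq_smult)
    then have "closed W" by (rule closed_subspace)
    then have "\<eta> \<in> W" by (rule closed_sequentially[OF _ _ \<eta>(3)]) (simp add: v(1))
    moreover have "boundary_form J (Z x *v \<eta>) \<le> 0" if x: "x \<ge> 0" for x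
    proof (rule tendsto_upperbound)
      have "continuous_on UNIV (\<lambda>\<eta>. Z x *v \<eta>)"
        by (rule linear_continuous_on[OF bounded_linear_matrix_vector_mult])
      then have "isCont (\<lambda>\<eta>. boundary_form J (Z x *v \<eta>)) \<eta>"
        using continuous_on_boundary_form continuous_on_eq_continuous_at[OF open_UNIV] by blast
      then show "(\<lambda>k. boundary_form J (Z x *v (v \<circ> r) k)) \<longlonglongrightarrow> boundary_form J (Z x *v \<eta>)"
        by (rule isCont_tendsto_compose) (rule \<eta>(3))
      show "\<forall>\<^sub>F k in sequentially. boundary_form J (Z x *v (v \<circ> r) k) \<le> 0"
        using eventually_le_real[of x]
      proof eventually_elim
        case (elim k)
        then have "x \<in> {0..real (r k)}"
          using seq_suble[OF \<eta>(2), of k] x by (simp add: order_trans[of x "real k"])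
        then show ?case using v(3) by simp
      qed
    qed simp
    then have "\<eta> \<in> ?L" using boundary_form_nonpos_imp_sq_integrable by blast
    ultimately have "\<eta> \<in> ?L \<inter> W" by blast
    then show False using W(2) \<eta>(1) by auto
  qed
qed

text \<open>
  Initial values parametrise the solutions injectively, also as elements of the Hilbert space, so a
  basis of initial values is carried to a basis.
\<close>

theorem has_cdim_sq_integrable_solutions:
  "has_cdim {abs_l2 (\<lambda>x. Z x *v \<eta>) | \<eta>. sq_integrable (\<lambda>x. Z x *v \<eta>)} (kappa_plus J)"
proof -
  let ?L = "{\<eta>. sq_integrable (\<lambda>x. Z x *v \<eta>)}" and ?f = "\<lambda>\<eta>. abs_l2 (\<lambda>x. Z x *v \<eta>)"
  interpret p: vector_space_pair "(*s) :: complex \<Rightarrow> complex^'n \<Rightarrow> _" "scaleC :: complex \<Rightarrow> 'n l2 \<Rightarrow> _" ..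
  note L = sq_integrable_solutions_subspace
  obtain B where B: "B \<subseteq> ?L" "vec.independent B" "?L \<subseteq> vec.span B" "card B = vec.dim ?L"
    using vec.basis_exists by blast
  have spanB: "vec.span B = ?L" using B L by (metis subset_antisym vec.span_minimal)
  obtain g where g: "Vector_Spaces.linear (*s) scaleC g" "\<forall>\<eta>\<in>B. g \<eta> = ?f \<eta>"
    using p.linear_independent_extend[OF B(2), of ?f] by blast
  interpret g: Vector_Spaces.linear "(*s)" scaleC g by fact
  have "vec.span B \<subseteq> {\<eta> \<in> ?L. g \<eta> = ?f \<eta>}"
  proof (rule vec.span_minimal)
    show "B \<subseteq> {\<eta> \<in> ?L. g \<eta> = ?f \<eta>}" using B(1) g(2) by auto
    show "vec.subspace {\<eta> \<in> ?L. g \<eta> = ?f \<eta>}"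
      by (rule vec.subspaceI)
        (auto simp: g.zero g.add g.scale mv.zero_right zero_l2_def plus_abs_l2 scaleC_abs_l2 matrix_vector_right_distrib
          vector_scalar_commute sq_integrable_add sq_integrable_smult)
  qed
  then have gf: "g \<eta> = ?f \<eta>" if "\<eta> \<in> ?L" for \<eta> using that spanB by auto
  have inj: "inj_on g (vec.span B)"
  proof (rule inj_onI)
    fix u v assume "u \<in> vec.span B" "v \<in> vec.span B" "g u = g v"
    then have d: "u - v \<in> ?L" "g (u - v) = 0"
      using vec.subspace_diff[OF L, of u v] spanB by (auto simp: g.diff)
    then have "abs_l2 (\<lambda>x. Z x *v (u - v)) = abs_l2 (\<lambda>x. 0)" using gf by (simp add: zero_l2_def)
    then have "AE x in half_line. Z x *v (u - v) = 0" using d(1) by (subst (asm) abs_l2_eq_iff) auto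
    then have "negligible {x. 0 \<le> x \<and> Z x *v (u - v) \<noteq> 0}" by (simp add: AE_half_line_iff)
    then have "((\<lambda>x. (norm (Z x *v (u - v)))\<^sup>2) has_integral 0) {0..1}"
      by (rule has_integral_spike[where f="\<lambda>x. 0"]) auto
    then show "u = v" using solution_norm_integral_pos[of "u - v"] by (auto simp: integral_unique)
  qed
  have "l2.independent (g ` B)"
    using B(2) inj g.dependent_inj_imageD by blast 
  moreover have "l2.span (g ` B) = {?f \<eta> | \<eta>. \<eta> \<in> ?L}"
    using g.span_image[of B] gf spanB by auto
  moreover have "card (g ` B) = kappa_plus J"
    using inj_on_subset[OF inj vec.span_superset] B(4) dim_sq_integrable_solutions by (simp add: card_image)
  moreover have "finite (g ` B)" using vec.finiteI_independent[OF B(2)] by simp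
  ultimately show ?thesis unfolding has_cdim_def by auto
qed

end

section \<open>Essential bounds of the imaginary part\<close>

lemma Im_part_form: "cdot (Im_part M *v h) h = of_real (Im (cdot (M *v h) h))"
  for M :: "complex^'n::finite^'n"
proof -
  have "Im_part M *v h = (1 / (2 * \<i>)) *s ((M - cadj M) *v h)"
    by (simp add: Im_part_def vec_eq_iff matrix_vector_mult_def sum_divide_distrib sum_distrib_left sum_negf mult.assoc)
  moreover have "cdot ((M - cadj M) *v h) h = cdot (M *v h) h - cnj (cdot (M *v h) h)"
    using cdot_adjoint[of "cadj M" h h] cdot_commute[of h "M *v h"]
    by (simp add: matrix_vector_mult_diff_rdistrib cdot.diff_left)
  ultimately show ?thesis
    by (simp add: cdot_smult cdot.minus_left complex_eq_iff)
qed

lemma Im_cdot_cadj: "Im (cdot (cadj M *v h) h) = - Im (cdot (M *v h) h)"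
  for M :: "complex^'n::finite^'n"
  using cdot_adjoint[of "cadj M" h h] cdot_commute[of h "M *v h"] by simp

lemma onorm_matrix:
  fixes M :: "complex^'n::finite^'n"
  shows "norm (M *v v) \<le> onorm ((*v) M) * norm v"
  by (rule onorm[OF bounded_linear_matrix_vector_mult])

lemma form_quotient_bound:
  fixes M :: "complex^'n::finite^'n"
  shows "\<bar>Re (cdot (M *v h) h) / (norm h)\<^sup>2\<bar> \<le> onorm ((*v) M)"
proof (cases "h = 0")
  case False
  have "\<bar>Re (cdot (M *v h) h)\<bar> \<le> cmod (cdot (M *v h) h)" by (rule abs_Re_le_cmod)
  also have "\<dots> \<le> norm (M *v h) * norm h" by (rule cdot_bound)
  also have "\<dots> \<le> onorm ((*v) M) * norm h * norm h" by (intro mult_right_mono onorm_matrix) simp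
  finally show ?thesis using False by (simp add: abs_divide divide_le_eq power2_eq_square mult_ac)
qed (simp add: onorm_pos_le[OF bounded_linear_matrix_vector_mult])

lemma exists_nonzero_vector: "\<exists>h :: complex^'n::finite. h \<noteq> 0"
  by (intro exI[of _ "vec 1"]) (simp add: vec_eq_iff)

text \<open>
  The quotients are bounded by the operator norm, so the supremum is a genuine one.
\<close>

lemma form_upper_le_iff:
  fixes M :: "complex^'n::finite^'n"
  shows "form_upper M \<le> c \<longleftrightarrow> (\<forall>h. Re (cdot (M *v h) h) \<le> c * (norm h)\<^sup>2)"
proof -
  have bdd: "bdd_above ((\<lambda>h. Re (cdot (M *v h) h) / (norm h)\<^sup>2) ` (- {0}))"
    by (intro bdd_aboveI2[where M="onorm ((*v) M)"] order_trans[OF abs_ge_self form_quotient_bound])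
  have ne: "(- {0} :: (complex^'n) set) \<noteq> {}" using exists_nonzero_vector by auto
  have "form_upper M \<le> c \<longleftrightarrow> (\<forall>h\<in>-{0}. Re (cdot (M *v h) h) / (norm h)\<^sup>2 \<le> c)"
    unfolding form_upper_def by (rule cSUP_le_iff[OF ne bdd])
  also have "\<dots> \<longleftrightarrow> (\<forall>h. Re (cdot (M *v h) h) \<le> c * (norm h)\<^sup>2)"
  proof (intro iffI allI ballI)
    fix h assume "\<forall>h\<in>-{0}. Re (cdot (M *v h) h) / (norm h)\<^sup>2 \<le> c"
    then show "Re (cdot (M *v h) h) \<le> c * (norm h)\<^sup>2"
      by (cases "h = 0") (auto simp: divide_le_eq cdot.zero_right)
  qed (auto simp: divide_le_eq)
  finally show ?thesis .
qed

lemma form_upper_bound: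
  fixes M :: "complex^'n::finite^'n"
  shows "form_upper M \<le> onorm ((*v) M)"
  unfolding form_upper_le_iff
proof
  fix h show "Re (cdot (M *v h) h) \<le> onorm ((*v) M) * (norm h)\<^sup>2"
    using form_quotient_bound[of M h] by (cases "h = 0") (auto simp: abs_le_iff divide_le_eq cdot.zero_right)
qed

lemma form_lower_eq: "form_lower M = - form_upper (- M)"
  for M :: "complex^'n::finite^'n"
  unfolding form_lower_def form_upper_def Inf_real_def
  by (simp add: image_image mv.minus_left cdot.minus_left)

lemma form_upper_add: "form_upper (M + N) \<le> form_upper M + form_upper N"
  for M N :: "complex^'n::finite^'n"
  unfolding form_upper_le_iff
proof
  fix h
  show "Re (cdot ((M + N) *v h) h) \<le> (form_upper M + form_upper N) * (norm h)\<^sup>2"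
    using form_upper_le_iff[of M "form_upper M"] form_upper_le_iff[of N "form_upper N"]
    by (simp add: matrix_vector_mult_add_rdistrib cdot_add distrib_right add_mono)
qed

text \<open>
  Subadditivity makes the supremum Lipschitz in the matrix. Continuity gives the measurability on
  which the value of the essential supremum depends.
\<close>

lemma continuous_on_form_upper: "continuous_on UNIV (form_upper :: complex^'n::finite^'n \<Rightarrow> real)"
proof -
  obtain K where K: "K > 0" "\<And>(M :: complex^'n^'n) v. norm (M *v v) \<le> norm M * norm v * K"
    using mv.pos_bounded by blast
  have on: "onorm ((*v) M) \<le> K * norm M" for M :: "complex^'n^'n"
    using K by (intro onorm_bound) (simp_all add: mult_ac)
  have le: "form_upper M - form_upper N \<le> K * dist M N" for M N :: "complex^'n^'n"
    using form_upper_add[of N "M - N"] form_upper_bound[of "M - N"] on[of "M - N"] by (simp add: dist_norm)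
  show ?thesis
    unfolding continuous_on_iff
  proof (intro ballI allI impI)
    fix M :: "complex^'n^'n" and e :: real assume e: "e > 0"
    show "\<exists>d>0. \<forall>N\<in>UNIV. dist N M < d \<longrightarrow> dist (form_upper N) (form_upper M) < e"
    proof (intro exI[of _ "e / K"] conjI ballI impI)
      fix N assume "dist N M < e / K"
      then have "K * dist N M < e" using K(1) by (simp add: field_simps)
      then show "dist (form_upper N) (form_upper M) < e"
        using le[of N M] le[of M N] by (simp add: dist_real_def dist_commute abs_less_iff)
    qed (use e K(1) in simp)
  qed
qed

lemma bounded_linear_Im_part: "bounded_linear (Im_part :: complex^'n::finite^'n \<Rightarrow> _)"
  unfolding linear_conv_bounded_linear[symmetric]
  by (rule linearI)
    (simp_all add: Im_part_def cadj_def vec_eq_iff add_divide_distrib diff_divide_distrib algebra_simps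
      scaleR_conv_of_real[where 'a=complex])

text \<open>
  The point is finiteness of the essential supremum: only then is its conversion to a real number
  faithful. It is at most \<open>C\<close>, and not \<open>- \<infinity>\<close> because the half-line has positive measure.
\<close>

lemma beta_ess_AE:
  fixes Q :: "real \<Rightarrow> complex^'n::finite^'n"
  assumes Q: "L1_loc Q" and C: "AE x in half_line. onorm ((*v) (Im_part (Q x))) \<le> C"
  shows "AE x in half_line. \<forall>h. Im (cdot (Q x *v h) h) \<le> beta_ess Q * (norm h)\<^sup>2"
proof -
  let ?f = "\<lambda>x. ereal (form_upper (Im_part (Q x)))"
  have "(\<lambda>x. form_upper (Im_part (Q x))) \<in> borel_measurable half_line"
    using measurable_compose[OF measurable_bounded_linear[OF bounded_linear_Im_part L1_loc_measurable[OF Q]]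
      borel_measurable_continuous_onI[OF continuous_on_form_upper]] .
  then have m: "?f \<in> borel_measurable half_line" by simp
  have "AE x in half_line. ?f x \<le> ereal C"
    using C by eventually_elim (use form_upper_bound order_trans in \<open>auto\<close>)
  then have "esssup half_line ?f \<le> ereal C" by (rule esssup_I[OF m])
  moreover have "esssup half_line ?f \<noteq> - \<infinity>"
  proof
    assume "esssup half_line ?f = - \<infinity>"
    then have "AE x in half_line. False"
      using esssup_AE[of ?f half_line] by simp
    then have "AE x in half_line. x \<le> 1 \<longrightarrow> False"
      by eventually_elim simp
    then show False by (rule AE_half_line_const)
  qed
  ultimately have eq: "esssup half_line ?f = ereal (beta_ess Q)"
    unfolding beta_ess_def by (cases "esssup half_line ?f") auto
  show ?thesis
    using esssup_AE[of ?f half_line] unfolding eq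
  proof eventually_elim
    case (elim x)
    then have "form_upper (Im_part (Q x)) \<le> beta_ess Q" by simp
    then show ?case unfolding form_upper_le_iff Im_part_form by simp
  qed
qed

text \<open>
  The lower bound is the upper bound for \<open>- Q\<close>, which spares a second treatment.
\<close>

lemma alpha_ess_eq:
  fixes Q :: "real \<Rightarrow> complex^'n::finite^'n"
  shows "alpha_ess Q = - beta_ess (\<lambda>x. - Q x)"
proof -
  have "- form_lower (Im_part M) = form_upper (Im_part (- M))" for M :: "complex^'n^'n"
    using linear_neg[OF bounded_linear.linear[OF bounded_linear_Im_part], of M] by (simp add: form_lower_eq)
  then show ?thesis by (simp add: alpha_ess_def beta_ess_def)
qed

lemma alpha_ess_AE:
  fixes Q :: "real \<Rightarrow> complex^'n::finite^'n"
  assumes Q: "L1_loc Q" and C: "AE x in half_line. onorm ((*v) (Im_part (Q x))) \<le> C"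
  shows "AE x in half_line. \<forall>h. - Im (cdot (Q x *v h) h) \<le> - alpha_ess Q * (norm h)\<^sup>2"
proof -
  have "onorm ((*v) (Im_part (- M))) = onorm ((*v) (Im_part M))" for M :: "complex^'n^'n"
  proof -
    have "(*v) (Im_part (- M)) = (\<lambda>v. - (Im_part M *v v))"
      using linear_neg[OF bounded_linear.linear[OF bounded_linear_Im_part], of M] by (simp add: fun_eq_iff mv.minus_left)
    then show ?thesis using onorm_neg[of "(*v) (Im_part M)"] by simp
  qed
  then have "AE x in half_line. onorm ((*v) (Im_part (- Q x))) \<le> C" using C by simp
  moreover have "L1_loc (\<lambda>x. - Q x)" by (rule L1_loc_linear[OF Q]) (simp add: bounded_linear_minus)
  ultimately have "AE x in half_line. \<forall>h. Im (cdot (- Q x *v h) h) \<le> beta_ess (\<lambda>x. - Q x) * (norm h)\<^sup>2"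
    by (intro beta_ess_AE)
  then show ?thesis unfolding alpha_ess_eq by (simp add: mv.minus_left cdot.minus_left)
qed

section \<open>The numerical range of the minimal operator\<close>

lemma norm_scaleC: "norm (scaleC c f) = cmod c * norm f"
proof -
  have "cinner (scaleC c f) (scaleC c f) = c * (cnj c * cinner f f)"
    by (subst cinner_scaleC_left, subst cinner_commute, subst cinner_scaleC_left, subst (2) cinner_commute) simp
  also have "\<dots> = of_real ((cmod c)\<^sup>2) * cinner f f"
    by (simp only: complex_norm_square mult.assoc)
  finally have "inner (scaleC c f) (scaleC c f) = (cmod c)\<^sup>2 * inner f f"
    by (simp add: inner_l2_def del: of_real_power)
  then show ?thesis by (simp add: norm_l2_def real_sqrt_mult)
qed

lemma bounded_linear_scaleC: "bounded_linear (scaleC c :: 'n::finite l2 \<Rightarrow> _)"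
proof (rule bounded_linear_intro[of _ "cmod c"])
  show "scaleC c (r *\<^sub>R f) = r *\<^sub>R scaleC c f" for r and f :: "'n l2"
    by (simp add: scaleR_l2_def mult.commute)
qed (simp_all add: norm_scaleC l2.scale_right_distrib mult.commute)

lemma Im_cinner: "Im (cinner f g) = inner f (scaleC \<i> g)"
  by (simp add: cinner_eq_Complex_inner)

text \<open>
  The factor \<open>\<sigma>\<close> stands for a sign and covers upper and lower bounds at the same time.
\<close>

lemma D_min_form_bound:
  fixes J :: "complex^'n::finite^'n"
  assumes J: "cadj J = - J"
    and Q: "AE x in half_line. \<forall>h. \<sigma> * Im (cdot (Q x *v h) h) \<le> \<beta> * (norm h)\<^sup>2"
    and fk: "(f, k) \<in> D_min J Q"
  shows "\<sigma> * Im (cinner k f) \<le> \<beta> * (norm f)\<^sup>2"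
proof -
  let ?S = "{p :: 'n l2 \<times> 'n l2. \<sigma> * inner (snd p) (scaleC \<i> (fst p)) \<le> \<beta> * (norm (fst p))\<^sup>2}"
  have "closed ?S"
    by (intro closed_Collect_le continuous_intros bounded_linear.continuous_on[OF bounded_linear_scaleC])
  moreover have "core_graph J Q \<subseteq> ?S"
  proof
    fix p assume "p \<in> core_graph J Q"
    then obtain y where y: "y \<in> core J Q" "p = (abs_l2 y, abs_l2 (D_expr J Q y))" by (auto simp: core_graph_def)
    let ?y' = "\<lambda>x. vector_derivative y (at x within {0..})"
    note y' = coreD[OF y(1)]
    obtain b where b: "b > 0" "\<And>x. x \<ge> b \<Longrightarrow> y x = 0" using y'(5) by blast
    let ?w = "\<lambda>x. Im (cdot (J *v y x) (?y' x) + cdot (J *v ?y' x) (y x))"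
    have W: "ac_deriv (\<lambda>x. boundary_form J (y x)) ?w"
      unfolding boundary_form_def
      by (intro ac_deriv_linear[OF bounded_linear_Im] ac_deriv_product[OF bounded_bilinear_cdot]
          ac_deriv_linear[OF bounded_linear_matrix_vector_mult] y')
    \<comment> \<open>as \<open>J\<close> is skew, both summands of the product rule have the same imaginary part\<close>
    have w: "?w x = 2 * Im (cdot (J *v ?y' x) (y x))" for x
      using cdot_adjoint[of J "y x" "?y' x"] cdot_commute[of "y x" "J *v ?y' x"]
      by (simp add: J mv.minus_left cdot.minus_right)
    have W0: "integrable half_line ?w" "(LINT x|half_line. ?w x) = 0"
      using ac_deriv_compact_support_integral[OF W b(1)] b(2) y'(4)
      by (simp_all add: boundary_form_def cdot.zero_right)
    have n: "integrable half_line (\<lambda>x. (norm (y x))\<^sup>2)" using y'(2) by (simp add: sq_integrable_def)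
    have c: "integrable half_line (\<lambda>x. cdot (D_expr J Q y x) (y x))" by (rule integrable_cdot[OF y'(3,2)])
    have "\<sigma> * Im (cinner (snd p) (fst p)) = (LINT x|half_line. \<sigma> * Im (cdot (D_expr J Q y x) (y x)))"
      using integral_bounded_linear[OF bounded_linear_Im c] y'(2,3) by (simp add: y(2) cinner_abs_l2)
    also have "\<dots> \<le> (LINT x|half_line. \<sigma> / 2 * ?w x + \<beta> * (norm (y x))\<^sup>2)"
    proof (rule integral_mono_AE)
      show "integrable half_line (\<lambda>x. \<sigma> * Im (cdot (D_expr J Q y x) (y x)))"
        using integrable_bounded_linear[OF bounded_linear_Im c] by simp
      show "integrable half_line (\<lambda>x. \<sigma> / 2 * ?w x + \<beta> * (norm (y x))\<^sup>2)" using W0(1) n by simp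
      show "AE x in half_line. \<sigma> * Im (cdot (D_expr J Q y x) (y x)) \<le> \<sigma> / 2 * ?w x + \<beta> * (norm (y x))\<^sup>2"
        using Q
      proof eventually_elim
        case (elim x)
        have "\<sigma> * Im (cdot (D_expr J Q y x) (y x)) = \<sigma> / 2 * ?w x + \<sigma> * Im (cdot (Q x *v y x) (y x))"
          unfolding w by (simp add: D_expr_def cdot_add algebra_simps)
        then show ?case using elim by simp
      qed
    qed
    also have "\<dots> = \<sigma> / 2 * (LINT x|half_line. ?w x) + \<beta> * (LINT x|half_line. (norm (y x))\<^sup>2)"
      using W0(1) n by (subst Bochner_Integration.integral_add) simp_all
    also have "\<dots> = \<beta> * (norm (fst p))\<^sup>2"
      unfolding W0(2) using y'(2) by (simp add: y(2) norm_abs_l2 integral_nonneg_AE)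
    finally show "p \<in> ?S" by (simp add: Im_cinner)
  qed
  ultimately have "D_min J Q \<subseteq> ?S" unfolding D_min_eq_closure by (rule closure_minimal[rotated])
  then show ?thesis using fk by (auto simp: Im_cinner)
qed

text \<open>
  If \<open>\<sigma> Im (T f, f)\<close> stays below \<open>\<beta> |f|\<^sup>2\<close>, then \<open>|((T - l) f, f)|\<close> is at least \<open>(\<sigma> Im l - \<beta>) |f|\<^sup>2\<close>.
\<close>

lemma rho_hatI:
  assumes T: "\<And>f k. (f, k) \<in> T \<Longrightarrow> \<sigma> * Im (cinner k f) \<le> \<beta> * (norm f)\<^sup>2"
    and \<sigma>: "\<bar>\<sigma>\<bar> = 1" and l: "\<sigma> * Im l > \<beta>"
  shows "l \<in> rho_hat T"
proof -
  have "(\<sigma> * Im l - \<beta>) * norm f \<le> norm (k - scaleC l f)" if fk: "(f, k) \<in> T" for f k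
  proof (cases "f = 0")
    case False
    let ?u = "k - scaleC l f"
    have "cinner k f = cinner ?u f + l * cinner f f"
      using cinner_add_left[of ?u "scaleC l f" f] by (simp add: cinner_scaleC_left)
    moreover have "cinner f f = of_real ((norm f)\<^sup>2)"
      using cinner_commute[of f f] by (simp add: complex_eq_iff power2_norm_eq_inner inner_l2_def del: of_real_power)
    ultimately have "\<sigma> * Im (cinner k f) = \<sigma> * Im (cinner ?u f) + \<sigma> * Im l * (norm f)\<^sup>2"
      by (simp add: algebra_simps del: of_real_power)
    then have "(\<sigma> * Im l - \<beta>) * (norm f)\<^sup>2 \<le> - (\<sigma> * Im (cinner ?u f))"
      using T[OF fk] by (simp add: algebra_simps)
    also have "\<dots> \<le> \<bar>Im (cinner ?u f)\<bar>"
      using \<sigma> by (metis abs_ge_minus_self abs_mult mult_1)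
    also have "\<dots> \<le> norm ?u * norm f"
      unfolding Im_cinner using Cauchy_Schwarz_ineq2[of ?u "scaleC \<i> f"] by (simp add: norm_scaleC)
    finally show ?thesis using False by (simp add: power2_eq_square mult.assoc[symmetric])
  qed (simp add: norm_scaleC)
  then show ?thesis using l unfolding rho_hat_def by (auto intro!: exI[of _ "\<sigma> * Im l - \<beta>"])
qed

section \<open>Bounded perturbations\<close>

lemma D_expr_perturb: "D_expr J Q' y x = D_expr J Q y x + (Q' x - Q x) *v y x"
  for J :: "complex^'n::finite^'n"
  by (simp add: D_expr_def matrix_vector_mult_diff_rdistrib)

lemma norm_abs_l2_le:
  assumes "sq_integrable u" "sq_integrable v" "K \<ge> 0" "AE x in half_line. norm (u x) \<le> K * norm (v x)"
  shows "norm (abs_l2 u) \<le> K * norm (abs_l2 v)"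
proof -
  have "(LINT x|half_line. (norm (u x))\<^sup>2) \<le> (LINT x|half_line. K\<^sup>2 * (norm (v x))\<^sup>2)"
  proof (rule integral_mono_AE)
    show "AE x in half_line. (norm (u x))\<^sup>2 \<le> K\<^sup>2 * (norm (v x))\<^sup>2"
      using assms(4) by eventually_elim (auto simp flip: power_mult_distrib intro: power_mono)
  qed (use assms in \<open>auto simp: sq_integrable_def\<close>)
  then have "sqrt (LINT x|half_line. (norm (u x))\<^sup>2) \<le> sqrt (K\<^sup>2 * (LINT x|half_line. (norm (v x))\<^sup>2))"
    by simp
  then show ?thesis using assms by (simp add: norm_abs_l2 real_sqrt_mult)
qed

context
  fixes J :: "complex^'n::finite^'n" and Q Q' :: "real \<Rightarrow> complex^'n^'n" and K :: real
  assumes Q: "L1_loc Q" and Q': "L1_loc Q'" and K: "K \<ge> 0"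
    and bound: "AE x in half_line. \<forall>v. norm ((Q' x - Q x) *v v) \<le> K * norm v"
begin

lemma perturbation_sq_integrable:
  assumes "sq_integrable y"
  shows "sq_integrable (\<lambda>x. (Q' x - Q x) *v y x)"
proof (rule sq_integrable_dominated[OF assms])
  show "(\<lambda>x. (Q' x - Q x) *v y x) \<in> borel_measurable half_line"
    using L1_loc_measurable[OF Q] L1_loc_measurable[OF Q'] assms
    by (intro measurable_bilinear[OF bounded_bilinear_matrix_vector_mult] borel_measurable_diff) (auto simp: sq_integrable_def)
  show "AE x in half_line. norm ((Q' x - Q x) *v y x) \<le> K * norm (y x)"
    using bound by eventually_elim blast
qed

lemma perturbation_norm:
  assumes "sq_integrable y"
  shows "norm (abs_l2 (\<lambda>x. (Q' x - Q x) *v y x)) \<le> K * norm (abs_l2 y)"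
proof (rule norm_abs_l2_le[OF perturbation_sq_integrable[OF assms] assms K])
  show "AE x in half_line. norm ((Q' x - Q x) *v y x) \<le> K * norm (y x)"
    using bound by eventually_elim blast
qed

lemma core_perturb: "y \<in> core J Q \<Longrightarrow> y \<in> core J Q'"
  using sq_integrable_add[OF _ perturbation_sq_integrable, of "D_expr J Q y" y]
  by (auto simp: core_def D_max_fun_def D_expr_perturb[of J Q' y _ Q, abs_def])

text \<open>
  If \<open>y\<^sub>n\<close> converges in graph norm for \<open>Q\<close>, then \<open>(Q' - Q) y\<^sub>n\<close> converges as well, so the same sequence
  converges in graph norm for \<open>Q'\<close>.
\<close>

lemma op_dom_D_min_perturb: "op_dom (D_min J Q) \<subseteq> op_dom (D_min J Q')"
proof
  fix f assume "f \<in> op_dom (D_min J Q)"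
  then obtain k where "(f, k) \<in> closure (core_graph J Q)" by (auto simp: op_dom_def D_min_eq_closure)
  then obtain p where p: "\<forall>n. p n \<in> core_graph J Q" "p \<longlonglongrightarrow> (f, k)"
    unfolding closure_sequential by blast
  have "\<forall>n. \<exists>y. y \<in> core J Q \<and> p n = (abs_l2 y, abs_l2 (D_expr J Q y))"
    using p(1) by (auto simp: core_graph_def)
  from choice[OF this] obtain y where y: "\<And>n. y n \<in> core J Q" "\<And>n. p n = (abs_l2 (y n), abs_l2 (D_expr J Q (y n)))"
    by blast
  obtain u where u: "f = abs_l2 u" "sq_integrable u" by (rule l2_cases)
  let ?R = "\<lambda>y. abs_l2 (\<lambda>x. (Q' x - Q x) *v y x)"
  have lim: "(\<lambda>n. abs_l2 (y n)) \<longlonglongrightarrow> f" "(\<lambda>n. abs_l2 (D_expr J Q (y n))) \<longlonglongrightarrow> k"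
    using tendsto_fst[OF p(2)] tendsto_snd[OF p(2)] by (simp_all add: y(2))
  have "(\<lambda>n. ?R (y n)) \<longlonglongrightarrow> ?R u"
  proof (rule Lim_null_comparison[THEN LIM_zero_cancel])
    have d: "abs_l2 v - abs_l2 w = abs_l2 (\<lambda>x. v x + (-1) *s w x)" if "sq_integrable v" "sq_integrable w"
      for v w :: "real \<Rightarrow> complex^'n"
    proof -
      have "abs_l2 v - abs_l2 w = abs_l2 v + scaleC (-1) (abs_l2 w)" by simp
      also have "\<dots> = abs_l2 (\<lambda>x. v x + (-1) *s w x)"
        unfolding scaleC_abs_l2[OF that(2)] by (rule plus_abs_l2[OF that(1) sq_integrable_smult[OF that(2)]])
      finally show ?thesis .
    qed
    have "norm (?R (y n) - ?R u) \<le> K * norm (abs_l2 (y n) - f)" for n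
    proof -
      note yn = coreD(2)[OF y(1)[of n]]
      have "?R (y n) - ?R u = ?R (\<lambda>x. y n x + (-1) *s u x)"
        using d[OF perturbation_sq_integrable[OF yn] perturbation_sq_integrable[OF u(2)]]
        by (simp add: matrix_vector_mult_diff_distrib)
      then show ?thesis
        using perturbation_norm[OF sq_integrable_add[OF yn sq_integrable_smult[OF u(2)]], of "-1"] d[OF yn u(2)] u(1)
        by simp
    qed
    then show "\<forall>\<^sub>F n in sequentially. norm (?R (y n) - ?R u) \<le> K * norm (abs_l2 (y n) - f)" by simp
    show "(\<lambda>n. K * norm (abs_l2 (y n) - f)) \<longlonglongrightarrow> 0"
      using lim(1) by (intro tendsto_mult_right_zero tendsto_norm_zero LIM_zero)
  qed
  then have "(\<lambda>n. (abs_l2 (y n), abs_l2 (D_expr J Q (y n)) + ?R (y n))) \<longlonglongrightarrow> (f, k + ?R u)"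
    by (intro tendsto_intros lim)
  moreover have "abs_l2 (D_expr J Q (y n)) + ?R (y n) = abs_l2 (D_expr J Q' (y n))" for n
    using plus_abs_l2[OF coreD(3)[OF y(1)[of n]] perturbation_sq_integrable[OF coreD(2)[OF y(1)[of n]]]]
    by (simp add: D_expr_perturb[of J Q' "y n" _ Q, abs_def])
  ultimately have "(f, k + ?R u) \<in> closure (core_graph J Q')"
    unfolding closure_sequential using core_perturb[OF y(1)]
    by (intro exI[of _ "\<lambda>n. (abs_l2 (y n), abs_l2 (D_expr J Q' (y n)))"]) (auto simp: core_graph_def)
  then show "f \<in> op_dom (D_min J Q')" by (force simp: op_dom_def D_min_eq_closure)
qed

end

text \<open>
  The adjoint of multiplication by \<open>Q' - Q\<close> is multiplication by the adjoint matrices, so the image of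
  \<open>g\<close> under the adjoint changes by an element of the Hilbert space.
\<close>

lemma op_dom_adj_D_min_perturb:
  fixes J :: "complex^'n::finite^'n"
  assumes Q: "L1_loc Q" and Q': "L1_loc Q'" and K: "K \<ge> 0"
    and bound: "AE x in half_line. \<forall>v. norm ((Q' x - Q x) *v v) \<le> K * norm v"
    and bound': "AE x in half_line. \<forall>v. norm ((cadj (Q' x) - cadj (Q x)) *v v) \<le> K * norm v"
  shows "op_dom (adj_op (D_min J Q)) \<subseteq> op_dom (adj_op (D_min J Q'))"
proof
  fix g assume "g \<in> op_dom (adj_op (D_min J Q))"
  then obtain h where gh: "(g, h) \<in> adj_op (core_graph J Q)"
    by (auto simp: op_dom_def D_min_eq_closure adj_op_closure)
  obtain u where u: "g = abs_l2 u" "sq_integrable u" by (rule l2_cases)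
  let ?Ru = "\<lambda>x. (cadj (Q' x) - cadj (Q x)) *v u x"
  have Ru: "sq_integrable ?Ru"
    by (rule perturbation_sq_integrable[OF L1_loc_cadj[OF Q] L1_loc_cadj[OF Q'] K bound' u(2)])
  let ?h = "h + abs_l2 ?Ru"
  have "cinner (abs_l2 (D_expr J Q' y)) g = cinner (abs_l2 y) ?h" if y': "y \<in> core J Q'" for y
  proof -
    have "AE x in half_line. \<forall>v. norm ((Q x - Q' x) *v v) \<le> K * norm v"
      using bound by eventually_elim (metis minus_diff_eq mv.minus_left norm_minus_cancel)
    then have y: "y \<in> core J Q" using core_perturb[OF Q' Q K _ y'] by blast
    note yD = coreD(2,3)[OF y]
    let ?Ry = "\<lambda>x. (Q' x - Q x) *v y x"
    have Ry: "sq_integrable ?Ry"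
      by (rule perturbation_sq_integrable[OF Q Q' K bound yD(1)])
    have "abs_l2 (D_expr J Q' y) = abs_l2 (D_expr J Q y) + abs_l2 ?Ry"
      using plus_abs_l2[OF yD(2) Ry] by (simp add: D_expr_perturb[of J Q' y _ Q, abs_def])
    then have "cinner (abs_l2 (D_expr J Q' y)) g = cinner (abs_l2 (D_expr J Q y)) g + cinner (abs_l2 ?Ry) g"
      by (simp add: cinner_add_left)
    moreover have "cinner (abs_l2 (D_expr J Q y)) g = cinner (abs_l2 y) h"
      using gh y by (auto simp: adj_op_def core_graph_def)
    moreover have "cinner (abs_l2 ?Ry) g = cinner (abs_l2 y) (abs_l2 ?Ru)"
      using Ry Ru u yD by (simp add: cinner_abs_l2 cdot_adjoint cadj_diff)
    moreover have "cinner (abs_l2 y) ?h = cinner (abs_l2 y) h + cinner (abs_l2 y) (abs_l2 ?Ru)"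
      by (subst (1 2 3) cinner_commute) (simp add: cinner_add_left)
    ultimately show ?thesis by simp
  qed
  then have "(g, ?h) \<in> adj_op (core_graph J Q')" by (auto simp: adj_op_def core_graph_def)
  then show "g \<in> op_dom (adj_op (D_min J Q'))" by (force simp: op_dom_def D_min_eq_closure adj_op_closure)
qed

section \<open>Defect numbers\<close>

lemma kappa_plus_minus: "kappa_plus (- J) = kappa_minus J"
  for J :: "complex^'n::finite^'n"
proof -
  have "(- J + mat \<i>) *v v = - ((J - mat \<i>) *v v)" for v
    by (simp add: matrix_vector_mult_add_rdistrib matrix_vector_mult_diff_rdistrib mv.minus_left)
  then show ?thesis by (simp add: kappa_plus_def kappa_minus_def)
qed

theorem defect_number_plus:
  fixes J :: "complex^'n::finite^'n"
  assumes J: "cadj J = - J" "J ** J = - mat 1" and Q: "L1_loc Q"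
    and Im_le: "AE x in half_line. \<forall>h. Im (cdot (Q x *v h) h) \<le> \<beta> * (norm h)\<^sup>2" and l: "Im l > \<beta>"
  shows "has_cdim (defect_space l (D_min J (\<lambda>x. cadj (Q x)))) (kappa_plus J)"
proof -
  obtain Z where Z: "Z 0 = mat 1" "ac_deriv Z (\<lambda>x. J ** (Q x - mat l) ** Z x)"
    by (rule fundamental_matrix_exists[where J=J, OF L1_loc_diff_mat[OF Q]])
  show ?thesis
    unfolding defect_space_D_min_adjoint[OF J Q Z]
    by (rule has_cdim_sq_integrable_solutions[OF J Z Im_le l])
qed

text \<open>
  Changing the signs of \<open>J\<close>, \<open>Q\<close> and \<open>l\<close> together preserves the equation and its fundamental matrix,
  but turns a lower bound of \<open>Im Q\<close> into an upper one and exchanges the eigenspaces of \<open>J\<close>.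
\<close>

theorem defect_number_minus:
  fixes J :: "complex^'n::finite^'n"
  assumes J: "cadj J = - J" "J ** J = - mat 1" and Q: "L1_loc Q"
    and Im_ge: "AE x in half_line. \<forall>h. - Im (cdot (Q x *v h) h) \<le> \<beta> * (norm h)\<^sup>2" and l: "- Im l > \<beta>"
  shows "has_cdim (defect_space l (D_min J (\<lambda>x. cadj (Q x)))) (kappa_minus J)"
proof -
  obtain Z where Z: "Z 0 = mat 1" "ac_deriv Z (\<lambda>x. J ** (Q x - mat l) ** Z x)"
    by (rule fundamental_matrix_exists[where J=J, OF L1_loc_diff_mat[OF Q]])
  have J': "cadj (- J) = - (- J)" "- J ** - J = - mat 1"
    using J by (simp_all add: cadj_minus mm.minus_left mm.minus_right)
  have m: "mat (- l) = - (mat l :: complex^'n^'n)" by (simp add: vec_eq_iff mat_def)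
  have "J ** (Q x - mat l) ** Z x = - J ** (- Q x - mat (- l)) ** Z x" for x
    unfolding m by (simp add: mm.minus_left mm.minus_right mm.diff_right)
  then have Z': "ac_deriv Z (\<lambda>x. - J ** (- Q x - mat (- l)) ** Z x)" using Z(2) by simp
  have Im': "AE x in half_line. \<forall>h. Im (cdot (- Q x *v h) h) \<le> \<beta> * (norm h)\<^sup>2"
    using Im_ge by (simp add: mv.minus_left cdot.minus_left)
  show ?thesis
    unfolding defect_space_D_min_adjoint[OF J Q Z] kappa_plus_minus[symmetric]
    by (rule has_cdim_sq_integrable_solutions[OF J' Z(1) Z' Im']) (use l in simp)
qed

theorem proposition4p11:
  fixes J :: "complex^'n::finite^'n" and Q :: "real \<Rightarrow> complex^'n^'n" and C :: real
  assumes "invertible J" and "cadj J = matrix_inv J" and "matrix_inv J = - J"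
    and "L1_loc Q"
    and "AE x in half_line. onorm ((*v) (Im_part (Q x))) \<le> C"
  shows "let A = D_min J Q; B = D_min J (\<lambda>x. cadj (Q x)) in
      op_dom A = op_dom B \<and> op_dom (adj_op A) = op_dom (adj_op B) \<and>
      (\<forall>(f, Af)\<in>A. alpha_ess Q * (norm f)\<^sup>2 \<le> Im (cinner Af f) \<and>
                    Im (cinner Af f) \<le> beta_ess Q * (norm f)\<^sup>2) \<and>
      (\<forall>(f, Bf)\<in>B. - beta_ess Q * (norm f)\<^sup>2 \<le> Im (cinner Bf f) \<and>
                    Im (cinner Bf f) \<le> - alpha_ess Q * (norm f)\<^sup>2) \<and>
      {z. Im z < alpha_ess Q} \<union> {z. Im z > beta_ess Q} \<subseteq> rho_hat_pair A B \<and>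
      (\<forall>l. Im l > beta_ess Q \<longrightarrow>
          has_cdim (defect_space l B) (kappa_plus J) \<and>
          has_cdim (defect_space (cnj l) A) (kappa_minus J)) \<and>
      (\<forall>l. Im l < alpha_ess Q \<longrightarrow>
          has_cdim (defect_space l B) (kappa_minus J) \<and>
          has_cdim (defect_space (cnj l) A) (kappa_plus J))"
proof -
  have "J ** matrix_inv J = mat 1"
    using assms(1) unfolding invertible_def matrix_inv_def by (metis (mono_tags, lifting) someI_ex)
  then have J: "cadj J = - J" "J ** J = - mat 1"
    using assms(2,3) by (simp, metis assms(3) minus_minus mm.minus_right)
  define Qs where "Qs = (\<lambda>x. cadj (Q x))"
  have Qs: "L1_loc Qs" unfolding Qs_def by (rule L1_loc_cadj[OF assms(4)])
  have Qss: "(\<lambda>x. cadj (Qs x)) = Q" by (simp add: Qs_def)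
  note \<beta> = beta_ess_AE[OF assms(4,5)] and \<alpha> = alpha_ess_AE[OF assms(4,5)]
  have \<beta>s: "AE x in half_line. \<forall>h. - Im (cdot (Qs x *v h) h) \<le> beta_ess Q * (norm h)\<^sup>2"
    and \<alpha>s: "AE x in half_line. \<forall>h. Im (cdot (Qs x *v h) h) \<le> - alpha_ess Q * (norm h)\<^sup>2"
    using \<beta> \<alpha> by (simp_all add: Qs_def Im_cdot_cadj)
  define K where "K = 2 * \<bar>C\<bar>"
  have K: "K \<ge> 0" by (simp add: K_def)
  have b1: "AE x in half_line. \<forall>v. norm ((Q x - Qs x) *v v) \<le> K * norm v"
    using assms(5)
  proof eventually_elim
    case (elim x)
    have "(Q x - Qs x) *v v = (2 * \<i>) *s (Im_part (Q x) *v v)" for v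
      by (simp add: Qs_def Im_part_def vec_eq_iff matrix_vector_mult_def sum_distrib_left)
    then have "norm ((Q x - Qs x) *v v) = 2 * norm (Im_part (Q x) *v v)" for v
      by (simp add: norm_vector_smult norm_mult)
    moreover have "norm (Im_part (Q x) *v v) \<le> \<bar>C\<bar> * norm v" for v
      by (rule order_trans[OF onorm_matrix]) (use elim in \<open>intro mult_right_mono, auto\<close>)
    ultimately show ?case by (simp add: K_def)
  qed
  have b2: "AE x in half_line. \<forall>v. norm ((Qs x - Q x) *v v) \<le> K * norm v"
    using b1 by eventually_elim (metis minus_diff_eq mv.minus_left norm_minus_cancel)
  have dom: "op_dom (D_min J Q) = op_dom (D_min J Qs)"
    using op_dom_D_min_perturb[OF assms(4) Qs K b2] op_dom_D_min_perturb[OF Qs assms(4) K b1] by blast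
  have dom_adj: "op_dom (adj_op (D_min J Q)) = op_dom (adj_op (D_min J Qs))"
    using op_dom_adj_D_min_perturb[OF assms(4) Qs K b2] op_dom_adj_D_min_perturb[OF Qs assms(4) K b1] b1 b2
    by (auto simp: Qs_def)
  have A1: "1 * Im (cinner k f) \<le> beta_ess Q * (norm f)\<^sup>2" if "(f, k) \<in> D_min J Q" for f k
    by (rule D_min_form_bound[OF J(1) _ that]) (use \<beta> in simp)
  have A2: "- 1 * Im (cinner k f) \<le> - alpha_ess Q * (norm f)\<^sup>2" if "(f, k) \<in> D_min J Q" for f k
    by (rule D_min_form_bound[OF J(1) _ that]) (use \<alpha> in simp)
  have B1: "- 1 * Im (cinner k f) \<le> beta_ess Q * (norm f)\<^sup>2" if "(f, k) \<in> D_min J Qs" for f k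
    by (rule D_min_form_bound[OF J(1) _ that]) (use \<beta>s in simp)
  have B2: "1 * Im (cinner k f) \<le> - alpha_ess Q * (norm f)\<^sup>2" if "(f, k) \<in> D_min J Qs" for f k
    by (rule D_min_form_bound[OF J(1) _ that]) (use \<alpha>s in simp)
  have rho: "{z. Im z < alpha_ess Q} \<union> {z. Im z > beta_ess Q} \<subseteq> rho_hat_pair (D_min J Q) (D_min J Qs)"
    using rho_hatI[OF A1] rho_hatI[OF A2] rho_hatI[OF B1] rho_hatI[OF B2] by (auto simp: rho_hat_pair_def)
  have plus: "has_cdim (defect_space l (D_min J Qs)) (kappa_plus J)"
    "has_cdim (defect_space (cnj l) (D_min J Q)) (kappa_minus J)" if "Im l > beta_ess Q" for l
    using defect_number_plus[OF J assms(4) \<beta>, of l] defect_number_minus[OF J Qs \<beta>s, of "cnj l"] that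
    by (simp_all add: Qs_def)
  have minus: "has_cdim (defect_space l (D_min J Qs)) (kappa_minus J)"
    "has_cdim (defect_space (cnj l) (D_min J Q)) (kappa_plus J)" if "Im l < alpha_ess Q" for l
    using defect_number_minus[OF J assms(4) \<alpha>, of l] defect_number_plus[OF J Qs \<alpha>s, of "cnj l"] that
    by (simp_all add: Qs_def)
  show ?thesis
    unfolding Let_def Qs_def[symmetric]
    using dom dom_adj A1 A2 B1 B2 rho plus minus by fastforce
qed

end
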